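(* Let $p$ be a prime and let $f\in\mathbb Z_p[x]$ be a monic polynomial of degree $n\ge1$ with non-zero constant term. The Šunić group $G_{p,f}$ has a simple Nekrashevych algebra $\mathcal N_K(G_{p,f},\mathbb Z_p)$ over all fields $K$ if $f$ has degree one. Otherwise, it has a non-simple Nekrashevych algebra in characteristic $p$, and if the characteristic of $K$ is different from $p$, then $\mathcal N_K(G_{p,f},\mathbb Z_p)$ is simple if and only if the companion matrix $M_f$ acts transitively on $\mathbb P(\mathbb Z_p^n)$ where $n$ is the degree of $f$.
   Context: For a finite alphabet $X$ with $|X|\ge2$, $X^*$ is the free monoid on $X$. A self-similar group over $X$ is a group $\Gamma$ with a faithful action on $X^*$ by length-preserving permutations such that for all $g\in\Gamma$, $x\in X$ there is $g|_x\in\Gamma$ (the section) with $g(xw)=g(x)\,g|_x(w)$ for all $w\in X^*$. For a field $K$, the Nekrashevych algebra $\mathcal N_K(\Gamma,X)$ is the $*$-algebra over $K$ (with $K$-linear involution satisfying $(ab)^*=b^*a^*$) generated by $X\cup\Gamma$ with relations: $g^*=g^{-1}$ and $g\cdot h=gh$ for $g,h\in\Gamma$; $gx=g(x)g|_x$ for $g\in\Gamma$, $x\in X$; $y^*x=\delta_{x,y}$ for $x,y\in X$; $\sum_{x\in X}xx^*=1$. Simple means nonzero with no two-sided ideals other than $0$ and itself. Šunić groups. $\mathbb Z_p=\{0,1,\dots,p-1\}$ is the field with $p$ elements. Let $f=x^n+a_{n-1}x^{n-1}+\cdots+a_0\in\mathbb Z_p[x]$ with $a_0\ne0$, and let $M_f\in\mathrm{GL}_n(\mathbb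 Z_p)$ be its companion matrix (ones on the subdiagonal, last column $(-a_0,\dots,-a_{n-1})^T$, other entries $0$). Let $G=\mathbb Z_p^n$ (column vectors) and let $H=\mathbb Z_p$ act on the alphabet $X=\mathbb Z_p$ by addition. Let $\Phi(0)\in\mathrm{Aut}(G)$ be multiplication by $M_f$, let $\Phi(p-1)\colon G\to H$ be the projection to the last coordinate, and let $\Phi(k)\colon G\to H$ be the trivial homomorphism for $0<k<p-1$. Elements of $H$ and $G$ act on $X^*$ (fixing the empty word) by $h(xw)=(h+x)w$ for $h\in H$, and, for $g\in G$, recursively by $g(xw)=x\,(\Phi(x)(g))(w)$, where $\Phi(x)(g)\in G$ if $x=0$ and $\Phi(x)(g)\in H$ otherwise. $G_{p,f}$ is the (self-similar) group of permutations of $X^*$ generated by these permutations for all $g\in G$, $h\in H$. $\mathbb P(\mathbb Z_p^n)$ is the set of lines through the origin (one-dimensional subspaces) in the space $\mathbb Z_p^n$ of row vectors; $M_f$ acts on it on the right via right multiplication on row vectors, and "$M_f$ acts transitively" means that the cyclic group generated by $M_f$ acts transitively. *)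

theory Defs
  imports
    "HOL-Algebra.Bij"
    "HOL-Algebra.Generated_Groups"
    "HOL-Algebra.QuotRing"
    "HOL-Library.Poly_Mapping"
    "Jordan_Normal_Form.Matrix"
    "Berlekamp_Zassenhaus.Finite_Field"
begin

section \<open>Self-similar groups\<close>

text \<open>
  The alphabet is the type \<open>'x\<close>, and \<open>X\<^sup>*\<close> is \<open>'x list\<close>. A group acting faithfully on \<open>X\<^sup>*\<close> is
  identified with the group of permutations of \<open>X\<^sup>*\<close> that it induces, so products of group elements
  are compositions. The section of \<open>g\<close> at \<open>x\<close> is determined by \<open>g(xw) = g(x) g|\<^sub>x(w)\<close>.
\<close>

definition section_at :: "('x list \<Rightarrow> 'x list) \<Rightarrow> 'x \<Rightarrow> 'x list \<Rightarrow> 'x list" where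
  "section_at g x w = tl (g (x # w))"

definition self_similar_group :: "('x list \<Rightarrow> 'x list) set \<Rightarrow> bool" where
  "self_similar_group \<Gamma> \<longleftrightarrow>
     subgroup \<Gamma> (BijGroup UNIV) \<and>
     (\<forall>g\<in>\<Gamma>. \<forall>w. length (g w) = length w) \<and>
     (\<forall>g\<in>\<Gamma>. \<forall>x. \<exists>h\<in>\<Gamma>. \<forall>w. g (x # w) = g [x] @ h w)"

lemma self_similar_group_section_at:
  assumes "self_similar_group \<Gamma>" and "g \<in> \<Gamma>"
  shows "section_at g x \<in> \<Gamma>" and "g (x # w) = hd (g [x]) # section_at g x w"
proof -
  from assms obtain h where h: "h \<in> \<Gamma>" "\<And>w. g (x # w) = g [x] @ h w"
    unfolding self_similar_group_def by blast
  have "length (g [x]) = 1"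
    using assms by (simp add: self_similar_group_def)
  then obtain y where y: "g [x] = [y]"
    by (auto simp: length_Suc_conv)
  have gx: "g (x # v) = y # h v" for v
    using h(2)[of v] y by (metis append_Cons append_Nil)
  have "section_at g x = h"
    by (rule ext) (simp only: section_at_def gx list.sel)
  with h(1) show "section_at g x \<in> \<Gamma>" by simp
  show "g (x # w) = hd (g [x]) # section_at g x w"
    by (simp only: section_at_def gx y list.sel)
qed


section \<open>The free \<open>*\<close>-algebra on a set of generators\<close>

instantiation list :: (type) monoid_add
begin
definition zero_list :: "'a list" where "zero_list = []"
definition plus_list :: "'a list \<Rightarrow> 'a list \<Rightarrow> 'a list" where "plus_list = (@)"
instance by standard (simp_all add: zero_list_def plus_list_def)
end

text \<open>
  The list \<open>[(s\<^sub>1, \<epsilon>\<^sub>1), \<dots>, (s\<^sub>k, \<epsilon>\<^sub>k)]\<close> stands for the monomial \<open>s\<^sub>1\<^sup>\<epsilon>\<^sup>1 \<dots> s\<^sub>k\<^sup>\<epsilon>\<^sup>k\<close>, in which a letter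
  \<open>(s, True)\<close> is the formal adjoint of \<open>s\<close>. As concatenation is the addition of \<^class>\<open>monoid_add\<close>, the
  product of \<^type>\<open>poly_mapping\<close> is that of non-commuting polynomials. The field \<open>'k\<close> is embedded as
  the (central) multiples of the empty word.
\<close>

type_synonym ('s, 'k) star_poly = "('s \<times> bool) list \<Rightarrow>\<^sub>0 'k"

definition adj_word :: "('s \<times> bool) list \<Rightarrow> ('s \<times> bool) list" where
  "adj_word w = rev (map (\<lambda>(s, b). (s, \<not> b)) w)"

lemma adj_word_adj_word [simp]: "adj_word (adj_word w) = w"
  by (simp add: adj_word_def rev_map [symmetric] o_def case_prod_unfold)

lemma inj_adj_word: "inj adj_word"
  by (metis adj_word_adj_word injI)

text \<open>
  \<^const>\<open>Poly_Mapping.map_key\<close> precomposes with an injection; \<^const>\<open>adj_word\<close> is its own inverse, so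
  this is the linear extension of \<^const>\<open>adj_word\<close>.
\<close>

definition adj :: "('s, 'k::zero) star_poly \<Rightarrow> ('s, 'k) star_poly" where
  "adj a = Poly_Mapping.map_key adj_word a"

definition free_star_algebra :: "'s set \<Rightarrow> ('s, 'k::field) star_poly ring" where
  "free_star_algebra S =
     \<lparr>carrier = {a. Poly_Mapping.keys a \<subseteq> lists (S \<times> UNIV)},
      monoid.mult = (*), one = 1, zero = 0, add = (+)\<rparr>"

definition gen :: "'s \<Rightarrow> ('s, 'k::field) star_poly" where
  "gen s = Poly_Mapping.single [(s, False)] 1"

text \<open>
  A \<open>*\<close>-algebra presentation is the quotient by the smallest \<open>*\<close>-ideal containing the relators, i.e. by
  the two-sided ideal generated by the relators and their adjoints. Two-sided ideals are automatically
  \<open>'k\<close>-subspaces, because scalars are elements of the algebra.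
\<close>

definition star_presentation :: "'s set \<Rightarrow> ('s, 'k::field) star_poly set \<Rightarrow> ('s, 'k) star_poly set ring" where
  "star_presentation S R =
     free_star_algebra S Quot (Idl\<^bsub>free_star_algebra S\<^esub> (R \<union> adj ` R))"

definition simple_ring :: "('a, 'b) ring_scheme \<Rightarrow> bool" where
  "simple_ring R \<longleftrightarrow>
     carrier R \<noteq> {\<zero>\<^bsub>R\<^esub>} \<and> (\<forall>I. ideal I R \<longrightarrow> I = {\<zero>\<^bsub>R\<^esub>} \<or> I = carrier R)"


section \<open>Nekrashevych algebras\<close>

datatype 'x nek_gen = Letter 'x | Elem "'x list \<Rightarrow> 'x list"

abbreviation letter :: "'x \<Rightarrow> ('x nek_gen, 'k::field) star_poly" where
  "letter x \<equiv> gen (Letter x)"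

abbreviation elem :: "('x list \<Rightarrow> 'x list) \<Rightarrow> ('x nek_gen, 'k::field) star_poly" where
  "elem g \<equiv> gen (Elem g)"

definition nek_gens :: "('x list \<Rightarrow> 'x list) set \<Rightarrow> 'x nek_gen set" where
  "nek_gens \<Gamma> = range Letter \<union> Elem ` \<Gamma>"

text \<open>
  The first relator identifies the neutral element of \<open>\<Gamma>\<close> with the unit of the algebra. This is part
  of reading \<open>g\<^sup>* = g\<^sup>-\<^sup>1\<close> in the algebra (the elements of \<open>\<Gamma>\<close> become unitaries); the relators in the
  remaining lines by themselves would only make that element a central idempotent.
\<close>

definition nek_relators ::
    "('x::finite list \<Rightarrow> 'x list) set \<Rightarrow> ('x nek_gen, 'k::field) star_poly set" where
  "nek_relators \<Gamma> =
     {elem id - 1}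
     \<union> {adj (elem g) - elem (inv_into UNIV g) | g. g \<in> \<Gamma>}
     \<union> {elem g * elem h - elem (g \<circ> h) | g h. g \<in> \<Gamma> \<and> h \<in> \<Gamma>}
     \<union> {elem g * letter x - letter (hd (g [x])) * elem (section_at g x) | g x. g \<in> \<Gamma>}
     \<union> {adj (letter y) * letter x - (if x = y then 1 else 0) | x y. True}
     \<union> {(\<Sum>x\<in>UNIV. letter x * adj (letter x)) - 1}"

definition nekrashevych_algebra ::
    "'k::field itself \<Rightarrow> ('x::finite list \<Rightarrow> 'x list) set \<Rightarrow> ('x nek_gen, 'k) star_poly set ring" where
  "nekrashevych_algebra K \<Gamma> = star_presentation (nek_gens \<Gamma>) (nek_relators \<Gamma>)"


section \<open>Sunic groups\<close>

text \<open>
  \<open>'p mod_ring\<close> with \<open>'p :: prime_card\<close> is the field with \<open>p = CARD('p)\<close> elements; its element \<open>p - 1\<close>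
  is \<open>-1\<close>. Vectors and matrices are indexed from \<open>0\<close>.
\<close>

definition companion :: "'a::comm_ring_1 poly \<Rightarrow> 'a mat" where
  "companion f = mat (degree f) (degree f)
     (\<lambda>(i, j). if j = degree f - 1 then - coeff f i else if i = j + 1 then 1 else 0)"

definition Phi :: "'p::prime_card mod_ring poly \<Rightarrow> 'p mod_ring \<Rightarrow> 'p mod_ring vec
    \<Rightarrow> 'p mod_ring vec + 'p mod_ring" where
  "Phi f x g =
     (if x = 0 then Inl (companion f *\<^sub>v g)
      else if x = -1 then Inr (g $ (degree f - 1))
      else Inr 0)"

fun H_act :: "'p::prime_card mod_ring \<Rightarrow> 'p mod_ring list \<Rightarrow> 'p mod_ring list" where
  "H_act h [] = []"
| "H_act h (x # w) = (h + x) # w"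

fun G_act :: "'p::prime_card mod_ring poly \<Rightarrow> 'p mod_ring vec
    \<Rightarrow> 'p mod_ring list \<Rightarrow> 'p mod_ring list" where
  "G_act f g [] = []"
| "G_act f g (x # w) = x # (case Phi f x g of Inl g' \<Rightarrow> G_act f g' w | Inr h \<Rightarrow> H_act h w)"

definition sunic_group ::
    "'p::prime_card mod_ring poly \<Rightarrow> ('p mod_ring list \<Rightarrow> 'p mod_ring list) set" where
  "sunic_group f =
     generate (BijGroup UNIV) (range H_act \<union> G_act f ` carrier_vec (degree f))"


section \<open>The action on the projective space of row vectors\<close>

definition projective_space :: "'a::field itself \<Rightarrow> nat \<Rightarrow> 'a vec set set" where
  "projective_space _ n =
     {{c \<cdot>\<^sub>v v | c. True} | v. v \<in> carrier_vec n \<and> v \<noteq> 0\<^sub>v n}"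

definition vec_mat_mult :: "'a::semiring_0 vec \<Rightarrow> 'a mat \<Rightarrow> 'a vec" (infixl \<open>\<^sub>v*\<close> 70) where
  "v \<^sub>v* A = vec (dim_col A) (\<lambda>j. v \<bullet> col A j)"

text \<open>\<open>units_of (ring_mat \<dots> n ())\<close> is \<open>GL\<^sub>n\<close>.\<close>

definition acts_transitively_on_lines :: "nat \<Rightarrow> 'a::field mat \<Rightarrow> bool" where
  "acts_transitively_on_lines n M \<longleftrightarrow>
     (\<forall>L \<in> projective_space TYPE('a) n. \<forall>L' \<in> projective_space TYPE('a) n.
        \<exists>A \<in> generate (units_of (ring_mat TYPE('a) n ())) {M}. (\<lambda>v. v \<^sub>v* A) ` L = L')"

end

theory Submission
  imports Defs "Jordan_Normal_Form.Determinant"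
begin

text \<open>
  Let \<open>\<Gamma>\<close> be the Sunic group, \<open>A\<close> its Nekrashevych algebra over \<open>K\<close>, \<open>G\<close> the group of column vectors
  and \<open>T\<close> the multiplication by the companion matrix \<open>M\<close>. The section of \<open>g \<in> G\<close> at the word \<open>0\<^sup>k\<close> is
  \<open>T\<^sup>k g\<close>, its section at \<open>0\<^sup>k(-1)\<close> is the element of \<open>H\<close> given by the last coordinate of \<open>T\<^sup>k g\<close>, and
  its other sections past a nonzero letter are trivial. Hence near an infinite word that is not
  eventually \<open>0\<close>, an element \<open>a = \<Sum> \<alpha>(g) g\<close> of the group algebra of \<open>G\<close> is only seen through the
  push-forwards of \<open>\<alpha>\<close> along the functionals \<open>\<ell>\<^sub>k(g) = (T\<^sup>k g)\<^sub>n\<^sub>-\<^sub>1\<close>, whereas at \<open>0\<^sup>\<infinity>\<close> the elements of \<open>G\<close>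
  have pairwise different germs. The theorem rests on the resulting criterion
  \<open>simple_iff_push_injective\<close>: \<open>A\<close> is simple if and only if a function \<open>\<alpha>\<close> on \<open>G\<close> all of whose
  push-forwards along the \<open>\<ell>\<^sub>k\<close> vanish is zero.

  If \<open>\<alpha> \<noteq> 0\<close> has vanishing push-forwards, let \<open>A\<close> act on the vector space spanned by pairs of an
  infinite word and a vector that records germs. The element \<open>a\<close> is nonzero in \<open>A\<close>, because it acts
  nontrivially at \<open>0\<^sup>\<infinity>\<close> (\<open>gsum_not_in_J\<close>), but it acts as zero on the invariant subspace of the words
  that are not eventually \<open>0\<close> (\<open>gsum_annihilates\<close>), on which \<open>1\<close> does not; so it generates a proper
  ideal.

  Conversely, let \<open>b\<close> be a nonzero element of an ideal of \<open>A\<close>. Multiplied by a long word \<open>x\<close> on the right,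
  it becomes a combination of terms \<open>u g\<close> with words \<open>u\<close> and \<open>g \<in> \<Gamma>\<close> (\<open>normal_form\<close>). For some \<open>u\<close>,
  the terms with this \<open>u\<close> give a nonzero element \<open>u a\<close> with \<open>a\<close> in the image of the group algebra of
  \<open>\<Gamma>\<close>. As \<open>\<Gamma>\<close> is contracting with nucleus \<open>G \<union> H\<close>, a corner \<open>y\<^sup>* a w\<close> with words \<open>y, w\<close> of equal
  length is a nonzero combination of elements of \<open>G \<union> H\<close>, and injectivity of the push-forwards
  produces a further corner that is a nonzero scalar (\<open>scalar_corner\<close>). Continuing \<open>y\<close> and \<open>w\<close> by a
  long prefix of an aperiodic infinite word kills the terms with another prefix \<open>u'\<close>, because elements
  of \<open>\<Gamma>\<close> change only finitely many letters of an infinite word (\<open>aperiodic_separates\<close>). Thus the ideal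
  contains \<open>1\<close>.

  What remains is linear algebra over the field with \<open>p\<close> elements, where \<open>\<ell>\<^sub>k\<close> is the row vector
  \<open>e\<^sub>n\<^sub>-\<^sub>1 M\<^sup>k\<close>. For \<open>n = 1\<close> already \<open>\<ell>\<^sub>0\<close> is injective. For \<open>n \<ge> 2\<close> in characteristic \<open>p\<close>, the constant
  function \<open>1\<close> has vanishing push-forwards, since the fibres have \<open>p\<^sup>n\<^sup>-\<^sup>1\<close> elements. In
  other characteristics, if every line of row vectors contains some \<open>\<ell>\<^sub>k\<close>, then the push-forwards along
  all functionals vanish and Radon inversion recovers \<open>p\<^sup>n \<alpha>(g)\<close>; if the line of \<open>m\<close> contains none, then
  the difference of the indicator functions of \<open>m = 0\<close> and \<open>m = 1\<close> has vanishing push-forwards.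
\<close>

section \<open>Ideals of quotient rings\<close>

text \<open>
  The ideals of the quotient by \<open>J\<close> correspond to the ideals that contain \<open>J\<close>, by taking
  images and preimages under the projection.
\<close>

lemma (in ring) simple_ring_quotient_iff:
  assumes "ideal J R"
  shows "simple_ring (R Quot J) \<longleftrightarrow>
    J \<noteq> carrier R \<and> (\<forall>I. ideal I R \<longrightarrow> J \<subseteq> I \<longrightarrow> I = J \<or> I = carrier R)"
proof -
  let ?Q = "R Quot J"
  let ?h = "\<lambda>x. J +> x"
  interpret J: ideal J R by fact
  interpret hom: ring_hom_ring R ?Q ?h by (rule J.rcos_ring_hom_ring)
  have Jcarr: "J \<subseteq> carrier R" by (rule J.a_subset)
  have zeroJ: "\<zero> \<in> J" using additive_subgroup.zero_closed[OF ideal.axioms(1)[OF assms]] .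
  have carr: "carrier ?Q = ?h ` carrier R"
    unfolding FactRing_def A_RCOSETS_def' by auto
  have zero: "\<zero>\<^bsub>?Q\<^esub> = J" unfolding FactRing_def by simp
  have cosJ: "?h x = J \<longleftrightarrow> x \<in> J" if "x \<in> carrier R" for x
    using that J.a_rcos_const[of x] J.a_rcos_self[of x] by blast
  have all_cosJ: "?h ` A = {J} \<longleftrightarrow> A \<subseteq> J" if "A \<subseteq> carrier R" "A \<noteq> {}" for A
  proof
    assume A: "?h ` A = {J}"
    show "A \<subseteq> J"
    proof
      fix x assume "x \<in> A"
      then have "?h x \<in> {J}" unfolding A[symmetric] by (rule imageI)
      then show "x \<in> J" using cosJ[of x] that(1) \<open>x \<in> A\<close> by blast
    qed
  next
    assume "A \<subseteq> J"
    then have "?h ` A = (\<lambda>_. J) ` A"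
      by (intro image_cong refl) (use cosJ that(1) in blast)
    then show "?h ` A = {J}" using that(2) by (simp add: image_constant_conv)
  qed
  have triv: "carrier ?Q = {\<zero>\<^bsub>?Q\<^esub>} \<longleftrightarrow> J = carrier R"
    unfolding carr zero using all_cosJ[of "carrier R"] Jcarr zeroJ by blast
  have fwd: "I = J \<or> I = carrier R"
    if all: "\<And>I. ideal I ?Q \<Longrightarrow> I = {J} \<or> I = ?h ` carrier R"
      and I: "ideal I R" "J \<subseteq> I" for I
  proof -
    have Icarr: "I \<subseteq> carrier R" by (rule additive_subgroup.a_subset[OF ideal.axioms(1)[OF I(1)]])
    have mem_I: "x \<in> I" if x: "x \<in> carrier R" "?h x \<in> ?h ` I" for x
    proof -
      from x(2) obtain y where y: "y \<in> I" "?h x = ?h y" by (rule imageE)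
      have "x \<in> ?h y" using y(2) x(1) J.a_rcos_self[of x] by simp
      then obtain j where j: "j \<in> J" "x = j \<oplus> y" unfolding a_r_coset_def' by blast
      show ?thesis unfolding j(2)
        by (rule additive_subgroup.a_closed[OF ideal.axioms(1)[OF I(1)]]) (use j y I in blast)+
    qed
    from all[OF ring_ideal_imp_quot_ideal[OF assms I(1)]] show ?thesis
    proof
      assume "?h ` I = {J}"
      then have "I \<subseteq> J" using all_cosJ[OF Icarr] I(2) zeroJ by blast
      with I(2) show ?thesis by blast
    next
      assume eq: "?h ` I = ?h ` carrier R"
      have "carrier R \<subseteq> I"
      proof
        fix x assume x: "x \<in> carrier R"
        then have "?h x \<in> ?h ` I" unfolding eq by (rule imageI)
        with x show "x \<in> I" by (rule mem_I)
      qed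
      with Icarr show ?thesis by blast
    qed
  qed
  have bwd: "I = {J} \<or> I = ?h ` carrier R"
    if all: "\<And>I. ideal I R \<Longrightarrow> J \<subseteq> I \<Longrightarrow> I = J \<or> I = carrier R"
      and I: "ideal I ?Q" for I
  proof -
    let ?V = "{r \<in> carrier R. ?h r \<in> I}"
    have V: "ideal ?V R" by (rule hom.ideal_vimage[OF I])
    have "J \<in> I"
      using additive_subgroup.zero_closed[OF ideal.axioms(1)[OF I]] unfolding zero .
    then have "x \<in> ?V" if "x \<in> J" for x
      using that cosJ[of x] Jcarr by auto
    then have JV: "J \<subseteq> ?V" by (rule subsetI)
    have "I \<subseteq> ?h ` carrier R"
      using additive_subgroup.a_subset[OF ideal.axioms(1)[OF I]] unfolding carr .
    then have img: "I = ?h ` ?V" by blast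
    from all[OF V JV] show ?thesis
    proof
      assume eq: "?V = J"
      have "J \<noteq> {}" using zeroJ by blast
      then have "?h ` ?V = {J}" unfolding eq using all_cosJ[OF Jcarr] by blast
      then show ?thesis using img by simp
    next
      assume "?V = carrier R"
      then show ?thesis using img by simp
    qed
  qed
  have "(\<forall>I. ideal I ?Q \<longrightarrow> I = {J} \<or> I = ?h ` carrier R) \<longleftrightarrow>
    (\<forall>I. ideal I R \<longrightarrow> J \<subseteq> I \<longrightarrow> I = J \<or> I = carrier R)"
  proof (intro iffI allI impI)
    fix I assume "\<forall>I. ideal I ?Q \<longrightarrow> I = {J} \<or> I = ?h ` carrier R" "ideal I R" "J \<subseteq> I"
    then show "I = J \<or> I = carrier R" by (intro fwd) simp_all
  next
    fix I assume "\<forall>I. ideal I R \<longrightarrow> J \<subseteq> I \<longrightarrow> I = J \<or> I = carrier R" "ideal I ?Q"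
    then show "I = {J} \<or> I = ?h ` carrier R" by (intro bwd) simp_all
  qed
  then show ?thesis unfolding simple_ring_def triv unfolding carr zero by (rule arg_cong)
qed

section \<open>Ideals of the free \<open>*\<close>-algebra\<close>

lemma poly_mapping_eq_sum_single: "a = (\<Sum>w\<in>Poly_Mapping.keys a. Poly_Mapping.single w (Poly_Mapping.lookup a w))"
proof (rule poly_mapping_eqI)
  fix k
  show "Poly_Mapping.lookup a k = Poly_Mapping.lookup (\<Sum>w\<in>Poly_Mapping.keys a. Poly_Mapping.single w (Poly_Mapping.lookup a w)) k"
    by (simp add: lookup_sum lookup_single when_def in_keys_iff)
qed

lemma carrier_free_star_algebra_iff:
  "a \<in> carrier (free_star_algebra S) \<longleftrightarrow> Poly_Mapping.keys a \<subseteq> lists (S \<times> UNIV)"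
  by (simp add: free_star_algebra_def)

lemma free_star_algebra_simps [simp]:
  "\<zero>\<^bsub>free_star_algebra S\<^esub> = 0" "\<one>\<^bsub>free_star_algebra S\<^esub> = 1"
  "a \<otimes>\<^bsub>free_star_algebra S\<^esub> b = a * b" "a \<oplus>\<^bsub>free_star_algebra S\<^esub> b = a + b"
  by (simp_all add: free_star_algebra_def)

lemma free_star_algebra_closed:
  fixes a b :: "('s, 'k::field) star_poly"
  shows "0 \<in> carrier (free_star_algebra S)" (is ?zero) "1 \<in> carrier (free_star_algebra S)" (is ?one)
    "a \<in> carrier (free_star_algebra S) \<Longrightarrow> b \<in> carrier (free_star_algebra S) \<Longrightarrow> a + b \<in> carrier (free_star_algebra S)"
    "a \<in> carrier (free_star_algebra S) \<Longrightarrow> b \<in> carrier (free_star_algebra S) \<Longrightarrow> a - b \<in> carrier (free_star_algebra S)"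
    "a \<in> carrier (free_star_algebra S) \<Longrightarrow> b \<in> carrier (free_star_algebra S) \<Longrightarrow> a * b \<in> carrier (free_star_algebra S)"
    "a \<in> carrier (free_star_algebra S) \<Longrightarrow> - a \<in> carrier (free_star_algebra S)"
    "w \<in> lists (S \<times> UNIV) \<Longrightarrow> Poly_Mapping.single w c \<in> carrier (free_star_algebra S)"
proof -
  show ?zero ?one by (simp_all add: carrier_free_star_algebra_iff zero_list_def)
  show "a \<in> carrier (free_star_algebra S) \<Longrightarrow> b \<in> carrier (free_star_algebra S) \<Longrightarrow> a + b \<in> carrier (free_star_algebra S)"
    using Poly_Mapping.keys_add[of a b] by (auto simp: carrier_free_star_algebra_iff)
  show "a \<in> carrier (free_star_algebra S) \<Longrightarrow> b \<in> carrier (free_star_algebra S) \<Longrightarrow> a - b \<in> carrier (free_star_algebra S)"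
    using Poly_Mapping.keys_diff[of a b] by (auto simp: carrier_free_star_algebra_iff)
  show "a \<in> carrier (free_star_algebra S) \<Longrightarrow> - a \<in> carrier (free_star_algebra S)"
    by (auto simp: carrier_free_star_algebra_iff)
  show "w \<in> lists (S \<times> UNIV) \<Longrightarrow> Poly_Mapping.single w c \<in> carrier (free_star_algebra S)"
    by (auto simp: carrier_free_star_algebra_iff)
  show "a \<in> carrier (free_star_algebra S) \<Longrightarrow> b \<in> carrier (free_star_algebra S) \<Longrightarrow> a * b \<in> carrier (free_star_algebra S)"
    using Poly_Mapping.keys_mult[of a b] by (fastforce simp: carrier_free_star_algebra_iff plus_list_def)
qed

lemma sum_closed_free_star_algebra:
  "(\<And>i. i \<in> A \<Longrightarrow> h i \<in> carrier (free_star_algebra S)) \<Longrightarrow> sum h A \<in> carrier (free_star_algebra S)"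
  by (induction A rule: infinite_finite_induct) (simp_all add: free_star_algebra_closed)

lemma ring_free_star_algebra: "ring (free_star_algebra S :: ('s, 'k::field) star_poly ring)"
proof (rule ringI)
  let ?F = "free_star_algebra S :: ('s, 'k) star_poly ring"
  show "abelian_group ?F"
  proof (rule abelian_groupI)
    fix x assume "x \<in> carrier ?F"
    then show "\<exists>y\<in>carrier ?F. y \<oplus>\<^bsub>?F\<^esub> x = \<zero>\<^bsub>?F\<^esub>"
      by (intro bexI[of _ "- x"]) (simp_all add: free_star_algebra_closed)
  qed (simp_all add: free_star_algebra_closed add.assoc add.commute)
  show "monoid ?F" by (rule monoidI) (simp_all add: free_star_algebra_closed mult.assoc)
qed (simp_all add: distrib_left distrib_right)

text \<open>
  Closure under negation comes for free, as \<open>- 1\<close> is an element of the algebra.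
\<close>

lemma ideal_free_star_algebraI:
  assumes sub: "I \<subseteq> carrier (free_star_algebra S)" and "0 \<in> I"
    and add: "\<And>a b. a \<in> I \<Longrightarrow> b \<in> I \<Longrightarrow> a + b \<in> I"
    and l: "\<And>a x. a \<in> I \<Longrightarrow> x \<in> carrier (free_star_algebra S) \<Longrightarrow> x * a \<in> I"
    and r: "\<And>a x. a \<in> I \<Longrightarrow> x \<in> carrier (free_star_algebra S) \<Longrightarrow> a * x \<in> I"
  shows "ideal I (free_star_algebra S :: ('s, 'k::field) star_poly ring)"
proof -
  let ?F = "free_star_algebra S :: ('s, 'k) star_poly ring"
  interpret F: ring ?F by (rule ring_free_star_algebra)
  have neg: "- a \<in> I" if "a \<in> I" for a
    using l[OF that, of "- 1"] by (simp add: free_star_algebra_closed)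
  have inv: "\<ominus>\<^bsub>?F\<^esub> a = - a" if "a \<in> carrier ?F" for a
    using F.minus_equality[of "- a" a] that by (simp add: free_star_algebra_closed)
  show ?thesis
  proof (rule idealI[OF ring_free_star_algebra])
    show "subgroup I (add_monoid ?F)"
      by (rule group.subgroupI) (use assms F.add.is_group neg inv in \<open>auto simp: a_inv_def\<close>)
  qed (simp_all add: l r)
qed

lemma ideal_free_star_algebraD:
  assumes "ideal I (free_star_algebra S :: ('s, 'k::field) star_poly ring)"
  shows "I \<subseteq> carrier (free_star_algebra S)" "0 \<in> I"
    "\<And>a b. a \<in> I \<Longrightarrow> b \<in> I \<Longrightarrow> a + b \<in> I"
    "\<And>a b. a \<in> I \<Longrightarrow> b \<in> I \<Longrightarrow> a - b \<in> I"
    "\<And>a x. a \<in> I \<Longrightarrow> x \<in> carrier (free_star_algebra S) \<Longrightarrow> x * a \<in> I"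
    "\<And>a x. a \<in> I \<Longrightarrow> x \<in> carrier (free_star_algebra S) \<Longrightarrow> a * x \<in> I"
    "\<And>A h. (\<And>i. i \<in> A \<Longrightarrow> h i \<in> I) \<Longrightarrow> sum h A \<in> I"
proof -
  let ?F = "free_star_algebra S :: ('s, 'k) star_poly ring"
  interpret I: ideal I ?F by fact
  show zero: "0 \<in> I" using additive_subgroup.zero_closed[OF ideal.axioms(1)[OF assms]] by simp
  show add: "a + b \<in> I" if "a \<in> I" "b \<in> I" for a b using additive_subgroup.a_closed[OF ideal.axioms(1)[OF assms] that] by simp
  show l: "x * a \<in> I" if "a \<in> I" "x \<in> carrier ?F" for a x using I.I_l_closed[OF that] by simp
  show "a * x \<in> I" if "a \<in> I" "x \<in> carrier ?F" for a x using I.I_r_closed[OF that] by simp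
  show "I \<subseteq> carrier ?F" by (rule I.a_subset)
  have neg: "- a \<in> I" if "a \<in> I" for a
    using l[OF that, of "- 1"] by (simp add: free_star_algebra_closed)
  show "a - b \<in> I" if "a \<in> I" "b \<in> I" for a b
    using add[OF that(1) neg[OF that(2)]] by simp
  show "sum h A \<in> I" if "\<And>i. i \<in> A \<Longrightarrow> h i \<in> I" for A and h :: "'z \<Rightarrow> _"
    using that by (induction A rule: infinite_finite_induct) (simp_all add: zero add)
qed

lemma single_mult_single_list:
  "Poly_Mapping.single u (a::'k::semiring_0) * Poly_Mapping.single v b = Poly_Mapping.single (u @ v) (a * b)"
  by (simp add: mult_single plus_list_def)

lemma one_eq_single: "1 = Poly_Mapping.single [] (1::'k::semiring_1)"
  by (metis single_one zero_list_def)

lemma adj_single: "adj (Poly_Mapping.single w c) = Poly_Mapping.single (adj_word w) c"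
  unfolding adj_def using map_key_single[OF inj_adj_word, of "adj_word w" c] by simp

lemma lookup_adj: "Poly_Mapping.lookup (adj a) w = Poly_Mapping.lookup a (adj_word w)"
  unfolding adj_def by (simp add: map_key.rep_eq[OF inj_adj_word])

lemma keys_adj: "Poly_Mapping.keys (adj a) = adj_word ` Poly_Mapping.keys a"
  unfolding adj_def keys_map_key[OF inj_adj_word]
  by (auto simp: image_iff) (metis adj_word_adj_word)

section \<open>Sections at words\<close>

definition word_section :: "('x list \<Rightarrow> 'x list) \<Rightarrow> 'x list \<Rightarrow> 'x list \<Rightarrow> 'x list" where
  "word_section g u v = drop (length u) (g (u @ v))"

abbreviation ltr :: "'x \<Rightarrow> 'x nek_gen \<times> bool" where "ltr x \<equiv> (Letter x, False)"
abbreviation ltr_adj :: "'x \<Rightarrow> 'x nek_gen \<times> bool" where "ltr_adj x \<equiv> (Letter x, True)"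
abbreviation grp :: "('x list \<Rightarrow> 'x list) \<Rightarrow> 'x nek_gen \<times> bool" where "grp g \<equiv> (Elem g, False)"
abbreviation mon :: "'x list \<Rightarrow> ('x nek_gen \<times> bool) list" where "mon u \<equiv> map ltr u"
abbreviation mon_adj :: "'x list \<Rightarrow> ('x nek_gen \<times> bool) list" where "mon_adj u \<equiv> rev (map ltr_adj u)"

abbreviation prefix_word :: "(nat \<Rightarrow> 'x) \<Rightarrow> nat \<Rightarrow> 'x list" where
  "prefix_word \<xi> n \<equiv> map \<xi> [0..<n]"

locale self_similar =
  fixes \<Gamma> :: "('x list \<Rightarrow> 'x list) set"
  assumes self_similar_group: "self_similar_group \<Gamma>"
begin

lemma subgroup_\<Gamma>: "subgroup \<Gamma> (BijGroup UNIV)"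
  using self_similar_group by (simp add: self_similar_group_def)

lemma bij_\<Gamma>: "g \<in> \<Gamma> \<Longrightarrow> bij g"
  using subgroup.subset[OF subgroup_\<Gamma>] by (auto simp: BijGroup_def Bij_def)

lemma length_\<Gamma>: "g \<in> \<Gamma> \<Longrightarrow> length (g w) = length w"
  using self_similar_group by (simp add: self_similar_group_def)

lemma id_\<Gamma> [simp]: "id \<in> \<Gamma>"
  using subgroup.one_closed[OF subgroup_\<Gamma>]
  by (simp add: BijGroup_def restrict_UNIV id_def)

lemma comp_\<Gamma> [simp]: "g \<in> \<Gamma> \<Longrightarrow> h \<in> \<Gamma> \<Longrightarrow> g \<circ> h \<in> \<Gamma>"
  using subgroup.m_closed[OF subgroup_\<Gamma>, of g h] bij_\<Gamma>[of g] bij_\<Gamma>[of h]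
  by (simp add: BijGroup_def Bij_def compose_def restrict_UNIV comp_def)

lemma inv_\<Gamma> [simp]: "g \<in> \<Gamma> \<Longrightarrow> inv_into UNIV g \<in> \<Gamma>"
  using subgroup.m_inv_closed[OF subgroup_\<Gamma>, of g] inv_BijGroup[of g UNIV] bij_\<Gamma>[of g]
  by (simp add: Bij_def restrict_UNIV)

lemma Nil_\<Gamma>: "g \<in> \<Gamma> \<Longrightarrow> g [] = []"
  by (metis length_0_conv length_\<Gamma>)

lemmas section_at_\<Gamma> [simp] = self_similar_group_section_at(1)[OF self_similar_group]
lemmas \<Gamma>_Cons = self_similar_group_section_at(2)[OF self_similar_group]

lemma word_section_Nil [simp]: "word_section g [] = g"
  by (rule ext) (simp add: word_section_def)

lemma word_section_id [simp]: "word_section id u = id"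
  by (rule ext) (simp add: word_section_def)

lemma word_section_Cons: "g \<in> \<Gamma> \<Longrightarrow> word_section g (x # u) = word_section (section_at g x) u"
proof
  fix v assume "g \<in> \<Gamma>"
  then show "word_section g (x # u) v = word_section (section_at g x) u v"
    unfolding word_section_def append_Cons by (subst \<Gamma>_Cons) simp_all
qed

lemma word_section:
  assumes "g \<in> \<Gamma>"
  shows "word_section g u \<in> \<Gamma>" and "g (u @ v) = g u @ word_section g u v"
proof -
  have "word_section g u \<in> \<Gamma> \<and> g (u @ v) = g u @ word_section g u v"
    using assms
  proof (induction u arbitrary: g)
    case (Cons x u)
    then show ?case
      using Cons.IH[of "section_at g x"] \<Gamma>_Cons[of g x "u @ v"] \<Gamma>_Cons[of g x u]
      by (simp add: word_section_Cons)
  qed (simp add: Nil_\<Gamma>)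
  then show "word_section g u \<in> \<Gamma>" and "g (u @ v) = g u @ word_section g u v" by auto
qed

lemma word_section_append: "g \<in> \<Gamma> \<Longrightarrow> word_section g (u @ v) = word_section (word_section g u) v"
  by (induction u arbitrary: g) (simp_all add: word_section_Cons)

lemma word_section_comp:
  assumes "g \<in> \<Gamma>" "h \<in> \<Gamma>"
  shows "word_section (g \<circ> h) u = word_section g (h u) \<circ> word_section h u"
proof
  fix v
  have "g (h (u @ v)) = g (h u) @ word_section g (h u) (word_section h u v)"
    using word_section(2)[OF assms(1)] word_section(2)[OF assms(2)] by simp
  then show "word_section (g \<circ> h) u v = (word_section g (h u) \<circ> word_section h u) v"
    using length_\<Gamma>[OF assms(1)] length_\<Gamma>[OF assms(2)] by (simp add: word_section_def[of "g \<circ> h"])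
qed

text \<open>
  A letter of the image only depends on the prefix up to its position, so elements of \<open>\<Gamma>\<close> act
  on infinite words.
\<close>

lemma nth_prefix_stable:
  assumes "g \<in> \<Gamma>" "i < n"
  shows "g (prefix_word \<xi> n) ! i = g (prefix_word \<xi> (Suc i)) ! i"
proof -
  define P where "P = prefix_word \<xi> (Suc i)"
  define Q where "Q = map \<xi> [Suc i..<n]"
  have "[0..<n] = [0..<Suc i] @ [Suc i..<n]"
    using assms(2) upt_add_eq_append[of 0 "Suc i" "n - Suc i"] by simp
  then have PQ: "prefix_word \<xi> n = P @ Q" by (simp only: P_def Q_def map_append)
  have "length (g P) = Suc i" using length_\<Gamma>[OF assms(1), of P] by (simp add: P_def)
  then have "(g P @ word_section g P Q) ! i = g P ! i" by (simp add: nth_append)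
  then show ?thesis unfolding PQ word_section(2)[OF assms(1)] P_def[symmetric] .
qed

end

section \<open>Congruence of monomials modulo the relations\<close>

text \<open>
  The ideal \<open>J\<close> of the relations is a parameter because it carries the coefficient field, which the
  types of the congruence of words below do not mention.
\<close>

locale nekrashevych = self_similar \<Gamma> for \<Gamma> :: "('x::finite list \<Rightarrow> 'x list) set" +
  fixes J :: "('x nek_gen, 'k::field) star_poly set"
  assumes J_eq: "J = Idl\<^bsub>free_star_algebra (nek_gens \<Gamma>)\<^esub> (nek_relators \<Gamma> \<union> adj ` nek_relators \<Gamma>)"
begin

abbreviation F :: "('x nek_gen, 'k) star_poly ring" where "F \<equiv> free_star_algebra (nek_gens \<Gamma>)"

abbreviation W :: "('x nek_gen \<times> bool) list set" where "W \<equiv> lists (nek_gens \<Gamma> \<times> UNIV)"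

lemma nekrashevych_algebra_eq: "nekrashevych_algebra TYPE('k) \<Gamma> = F Quot J"
  by (simp add: nekrashevych_algebra_def star_presentation_def J_eq)

lemma gens_W [simp]: "Letter x \<in> nek_gens \<Gamma>" "g \<in> \<Gamma> \<Longrightarrow> Elem g \<in> nek_gens \<Gamma>"
  by (simp_all add: nek_gens_def)

lemma mon_W [simp]: "mon u \<in> W" "mon_adj u \<in> W"
  by auto

lemma single_F [simp]: "w \<in> W \<Longrightarrow> Poly_Mapping.single w c \<in> carrier F"
  by (rule free_star_algebra_closed)

lemma gen_F [simp]: "s \<in> nek_gens \<Gamma> \<Longrightarrow> gen s \<in> carrier F"
  by (simp add: gen_def)

lemma adj_F: 
  fixes a :: "('x nek_gen, 'k) star_poly"
  assumes "a \<in> carrier F" shows "adj a \<in> carrier F"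
proof -
  have "adj_word w \<in> W" if "w \<in> W" for w
    using that by (auto simp: adj_word_def)
  then show ?thesis using assms by (auto simp: carrier_free_star_algebra_iff keys_adj)
qed

lemma relators_F: "(nek_relators \<Gamma> :: ('x nek_gen, 'k) star_poly set) \<subseteq> carrier F"
  unfolding nek_relators_def
  by (auto intro!: free_star_algebra_closed sum_closed_free_star_algebra adj_F)

lemma ideal_J: "ideal J F"
  unfolding J_eq
  by (rule ring.genideal_ideal[OF ring_free_star_algebra]) (use relators_F adj_F in blast)

lemma relators_J: "nek_relators \<Gamma> \<subseteq> J"
proof -
  have "nek_relators \<Gamma> \<union> adj ` nek_relators \<Gamma> \<subseteq> J"
    unfolding J_eq
    by (rule ring.genideal_self[OF ring_free_star_algebra]) (use relators_F adj_F in blast)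
  then show ?thesis by blast
qed

lemma J_minimal:
  assumes "ideal I F" "nek_relators \<Gamma> \<union> adj ` nek_relators \<Gamma> \<subseteq> I" shows "J \<subseteq> I"
  unfolding J_eq by (rule ring.genideal_minimal[OF ring_free_star_algebra assms])

lemmas J_rules = ideal_free_star_algebraD[OF ideal_J]

definition cong_J :: "('x nek_gen, 'k) star_poly \<Rightarrow> ('x nek_gen, 'k) star_poly \<Rightarrow> bool" (infix \<open>\<approx>\<close> 50)
  where "a \<approx> b \<longleftrightarrow> a - b \<in> J"

lemma cong_refl [simp]: "a \<approx> a" by (simp add: cong_J_def J_rules)

lemma cong_sym: "a \<approx> b \<Longrightarrow> b \<approx> a"
  using J_rules(4)[OF J_rules(2), of "a - b"] by (simp add: cong_J_def)

lemma cong_trans [trans]: "a \<approx> b \<Longrightarrow> b \<approx> c \<Longrightarrow> a \<approx> c"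
  using J_rules(3)[of "a - b" "b - c"] by (simp add: cong_J_def)

lemma cong_add: "a \<approx> b \<Longrightarrow> c \<approx> d \<Longrightarrow> a + c \<approx> b + d"
  using J_rules(3)[of "a - b" "c - d"] by (simp add: cong_J_def algebra_simps)

lemma cong_sum: "(\<And>i. i \<in> A \<Longrightarrow> h i \<approx> h' i) \<Longrightarrow> sum h A \<approx> sum h' A"
  by (induction A rule: infinite_finite_induct) (simp_all add: cong_add)

lemma cong_mult_left: "a \<approx> b \<Longrightarrow> x \<in> carrier F \<Longrightarrow> x * a \<approx> x * b"
  using J_rules(5)[of "a - b" x] by (simp add: cong_J_def algebra_simps)

lemma cong_mult_right: "a \<approx> b \<Longrightarrow> x \<in> carrier F \<Longrightarrow> a * x \<approx> b * x"
  using J_rules(6)[of "a - b" x] by (simp add: cong_J_def algebra_simps)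

lemma cong_J: "a \<approx> b \<Longrightarrow> a \<in> J \<longleftrightarrow> b \<in> J"
  using J_rules(3)[of "a - b" b] J_rules(4)[of a "a - b"] by (auto simp: cong_J_def)

lemma cong_0: "a \<approx> 0 \<longleftrightarrow> a \<in> J"
  by (simp add: cong_J_def)

lemma cong_relator: "a - b \<in> nek_relators \<Gamma> \<Longrightarrow> a \<approx> b"
  using relators_J by (auto simp: cong_J_def)

text \<open>
  The relations, except for the one that sums over the alphabet, say that a monomial is congruent to
  another one or to zero. Most calculations therefore take place with words of generators.
\<close>

definition word_cong :: "('x nek_gen \<times> bool) list \<Rightarrow> ('x nek_gen \<times> bool) list \<Rightarrow> bool" (infix \<open>\<doteq>\<close> 50)
  where "v \<doteq> w \<longleftrightarrow> Poly_Mapping.single v 1 \<approx> Poly_Mapping.single w 1"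

definition word_zero :: "('x nek_gen \<times> bool) list \<Rightarrow> bool"
  where "word_zero w \<longleftrightarrow> Poly_Mapping.single w 1 \<in> J"

lemma word_cong_refl [simp]: "w \<doteq> w" by (simp add: word_cong_def)

lemma word_cong_trans [trans]: "u \<doteq> v \<Longrightarrow> v \<doteq> w \<Longrightarrow> u \<doteq> w"
  unfolding word_cong_def by (rule cong_trans)

lemma word_cong_context: "v \<doteq> w \<Longrightarrow> a \<in> W \<Longrightarrow> b \<in> W \<Longrightarrow> a @ v @ b \<doteq> a @ w @ b"
  unfolding word_cong_def
  using cong_mult_left[OF cong_mult_right, of "Poly_Mapping.single v 1" "Poly_Mapping.single w 1"
     "Poly_Mapping.single b 1" "Poly_Mapping.single a 1"]
  by (simp add: single_mult_single_list)

lemma word_cong_prefix: "v \<doteq> w \<Longrightarrow> a \<in> W \<Longrightarrow> a @ v \<doteq> a @ w"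
  using word_cong_context[of v w a "[]"] by simp

lemma word_cong_suffix: "v \<doteq> w \<Longrightarrow> b \<in> W \<Longrightarrow> v @ b \<doteq> w @ b"
  using word_cong_context[of v w "[]" b] by simp

lemma word_zero_context: "word_zero v \<Longrightarrow> a \<in> W \<Longrightarrow> b \<in> W \<Longrightarrow> word_zero (a @ v @ b)"
  unfolding word_zero_def
  using J_rules(5)[OF J_rules(6), of "Poly_Mapping.single v 1" "Poly_Mapping.single b 1" "Poly_Mapping.single a 1"]
  by (simp add: single_mult_single_list)

lemma word_zero_cong: "v \<doteq> w \<Longrightarrow> word_zero w \<Longrightarrow> word_zero v"
  unfolding word_zero_def word_cong_def using cong_J by blast

lemma single_cong: "v \<doteq> w \<Longrightarrow> Poly_Mapping.single v c \<approx> Poly_Mapping.single w c"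
  unfolding word_cong_def
  using cong_mult_left[of "Poly_Mapping.single v 1" "Poly_Mapping.single w 1" "Poly_Mapping.single [] c"]
  by (simp add: single_mult_single_list)

lemma single_J: "word_zero w \<Longrightarrow> Poly_Mapping.single w c \<in> J"
  unfolding word_zero_def
  using J_rules(5)[of "Poly_Mapping.single w 1" "Poly_Mapping.single [] c"]
  by (simp add: single_mult_single_list)

lemma word_cong_relator:
  "Poly_Mapping.single v 1 - Poly_Mapping.single w 1 \<in> (nek_relators \<Gamma> :: ('x nek_gen, 'k) star_poly set) \<Longrightarrow> v \<doteq> w"
  unfolding word_cong_def by (rule cong_relator)

lemma grp_id: "[grp id] \<doteq> []"
  by (rule word_cong_relator) (simp add: nek_relators_def gen_def one_eq_single)

lemma grp_comp: "g \<in> \<Gamma> \<Longrightarrow> h \<in> \<Gamma> \<Longrightarrow> [grp g, grp h] \<doteq> [grp (g \<circ> h)]"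
proof (rule word_cong_relator)
  assume "g \<in> \<Gamma>" "h \<in> \<Gamma>"
  then have "elem g * elem h - elem (g \<circ> h) \<in> (nek_relators \<Gamma> :: ('x nek_gen, 'k) star_poly set)"
    unfolding nek_relators_def by blast
  then show "Poly_Mapping.single [grp g, grp h] 1 - Poly_Mapping.single [grp (g \<circ> h)] 1 \<in> (nek_relators \<Gamma> :: ('x nek_gen, 'k) star_poly set)"
    by (simp add: gen_def single_mult_single_list)
qed

lemma grp_adj: "g \<in> \<Gamma> \<Longrightarrow> [(Elem g, True)] \<doteq> [grp (inv_into UNIV g)]"
proof (rule word_cong_relator)
  assume "g \<in> \<Gamma>"
  then have "adj (elem g) - elem (inv_into UNIV g) \<in> (nek_relators \<Gamma> :: ('x nek_gen, 'k) star_poly set)"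
    unfolding nek_relators_def by blast
  then show "Poly_Mapping.single [(Elem g, True)] 1 - Poly_Mapping.single [grp (inv_into UNIV g)] 1 \<in> (nek_relators \<Gamma> :: ('x nek_gen, 'k) star_poly set)"
    by (simp add: gen_def adj_single adj_word_def)
qed

lemma grp_ltr: "g \<in> \<Gamma> \<Longrightarrow> [grp g, ltr x] \<doteq> [ltr (hd (g [x])), grp (section_at g x)]"
proof (rule word_cong_relator)
  assume "g \<in> \<Gamma>"
  then have "elem g * letter x - letter (hd (g [x])) * elem (section_at g x) \<in> (nek_relators \<Gamma> :: ('x nek_gen, 'k) star_poly set)"
    unfolding nek_relators_def by blast
  then show "Poly_Mapping.single [grp g, ltr x] 1 - Poly_Mapping.single [ltr (hd (g [x])), grp (section_at g x)] 1 \<in> (nek_relators \<Gamma> :: ('x nek_gen, 'k) star_poly set)"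
    by (simp add: gen_def single_mult_single_list)
qed

lemma ltr_adj_ltr: "adj (letter y) * letter x \<approx> (if x = y then 1 else 0)"
  by (rule cong_relator) (unfold nek_relators_def, blast)

lemma ltr_adj_ltr_same: "[ltr_adj x, ltr x] \<doteq> []"
  using ltr_adj_ltr[of x x]
  by (simp add: word_cong_def gen_def adj_single adj_word_def single_mult_single_list one_eq_single)

lemma ltr_adj_ltr_diff: "x \<noteq> y \<Longrightarrow> word_zero [ltr_adj y, ltr x]"
  using ltr_adj_ltr[of y x]
  by (simp add: word_zero_def cong_0 gen_def adj_single adj_word_def single_mult_single_list)

lemma sum_ltr_ltr_adj: "(\<Sum>x\<in>UNIV. Poly_Mapping.single [ltr x, ltr_adj x] 1) \<approx> 1"
proof -
  have "(\<Sum>x\<in>UNIV. letter x * adj (letter x)) \<approx> 1"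
    by (rule cong_relator) (simp add: nek_relators_def)
  then show ?thesis
    by (simp add: gen_def adj_single adj_word_def single_mult_single_list)
qed

lemma grp_mon: "g \<in> \<Gamma> \<Longrightarrow> grp g # mon u \<doteq> mon (g u) @ [grp (word_section g u)]"
proof (induction u arbitrary: g)
  case (Cons x u)
  have W: "[ltr (hd (g [x]))] \<in> W" using Cons.prems by simp
  have "grp g # mon (x # u) = [grp g, ltr x] @ mon u" by simp
  also have "\<dots> \<doteq> [ltr (hd (g [x])), grp (section_at g x)] @ mon u"
    by (rule word_cong_suffix) (use Cons.prems grp_ltr in simp_all)
  also have "\<dots> = [ltr (hd (g [x]))] @ (grp (section_at g x) # mon u)" by simp
  also have "\<dots> \<doteq> [ltr (hd (g [x]))] @ (mon (section_at g x u) @ [grp (word_section (section_at g x) u)])"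
    by (rule word_cong_prefix[OF Cons.IH W]) (simp add: Cons.prems)
  also have "\<dots> = mon (g (x # u)) @ [grp (word_section g (x # u))]"
    using Cons.prems \<Gamma>_Cons[of g x u] by (simp add: word_section_Cons)
  finally show ?case .
qed (simp add: Nil_\<Gamma>)

lemma mon_adj_mon: "mon_adj u @ mon (u @ v) \<doteq> mon v"
proof (induction u)
  case (Cons x u)
  have "mon_adj (x # u) @ mon ((x # u) @ v) = mon_adj u @ [ltr_adj x, ltr x] @ mon (u @ v)" by simp
  also have "\<dots> \<doteq> mon_adj u @ [] @ mon (u @ v)"
    by (rule word_cong_context[OF ltr_adj_ltr_same]) (rule mon_W)+
  also have "\<dots> = mon_adj u @ mon (u @ v)" by simp
  also note Cons.IH
  finally show ?case .
qed simp

lemma mon_adj_mon_same: "mon_adj u @ mon u \<doteq> []"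
  using mon_adj_mon[of u "[]"] by simp

text \<open>
  Once the common prefix of \<open>y\<close> and \<open>u\<close> is cancelled, two different letters meet in \<open>y\<^sup>* u\<close>.
\<close>

lemma mon_adj_mon_mismatch:
  "i < length y \<Longrightarrow> i < length u \<Longrightarrow> y ! i \<noteq> u ! i \<Longrightarrow> word_zero (mon_adj y @ mon u)"
proof (induction y arbitrary: u i)
  case (Cons a y)
  then obtain b u' where u: "u = b # u'" by (cases u) auto
  have eq: "mon_adj (a # y) @ mon u = mon_adj y @ [ltr_adj a, ltr b] @ mon u'" by (simp add: u)
  show ?case
  proof (cases "a = b")
    case False
    then show ?thesis unfolding eq
      by (intro word_zero_context ltr_adj_ltr_diff mon_W) simp
  next
    case True
    then obtain i' where i: "i = Suc i'" using Cons.prems u by (cases i) auto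
    have "word_zero (mon_adj y @ mon u')"
      by (rule Cons.IH[of i']) (use Cons.prems u i in auto)
    then have "word_zero (mon_adj y @ [] @ mon u')" by simp
    moreover have "mon_adj y @ [ltr_adj a, ltr b] @ mon u' \<doteq> mon_adj y @ [] @ mon u'"
      unfolding True by (rule word_cong_context[OF ltr_adj_ltr_same]) (rule mon_W)+
    ultimately show ?thesis unfolding eq by (rule word_zero_cong[rotated])
  qed
qed simp

lemma mon_adj_mon_neq:
  assumes "length y = length u" "y \<noteq> u" shows "word_zero (mon_adj y @ mon u)"
proof -
  from assms have "\<exists>i<length u. y ! i \<noteq> u ! i" by (simp add: list_eq_iff_nth_eq)
  then obtain i where "i < length u" "y ! i \<noteq> u ! i" by (elim exE conjE)
  with assms show ?thesis by (intro mon_adj_mon_mismatch[of i]) simp_all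
qed

text \<open>
  Right multiplication by a long word \<open>x\<close> removes all adjoint letters from a monomial: when the
  generators of \<open>w\<close> are applied to \<open>x\<close> from right to left, group elements move past the letters of \<open>x\<close>,
  and every adjoint letter cancels against the first letter of the word next to it. One letter of \<open>x\<close>
  per generator of \<open>w\<close> suffices.
\<close>

lemma word_normal_form:
  assumes "w \<in> W"
  shows "\<exists>N. \<forall>x. N \<le> length x \<longrightarrow>
    word_zero (w @ mon x) \<or> (\<exists>u g. g \<in> \<Gamma> \<and> w @ mon x \<doteq> mon u @ [grp g])"
  using assms
proof (induction w)
  case Nil
  have "[] @ mon x \<doteq> mon x @ [grp id]" for x
    using word_cong_prefix[OF grp_id, of "mon x"]
    unfolding word_cong_def by (simp add: cong_sym)
  then show ?case using id_\<Gamma> by blast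
next
  case (Cons s w)
  from Cons obtain N where N: "\<And>x. N \<le> length x \<Longrightarrow>
      word_zero (w @ mon x) \<or> (\<exists>u g. g \<in> \<Gamma> \<and> w @ mon x \<doteq> mon u @ [grp g])" by auto
  have sW: "[s] \<in> W" using Cons by simp
  have "word_zero ((s # w) @ mon x) \<or> (\<exists>u g. g \<in> \<Gamma> \<and> (s # w) @ mon x \<doteq> mon u @ [grp g])"
    if x: "Suc N \<le> length x" for x
  proof -
    from x obtain x' a where xa: "x = x' @ [a]" by (cases x rule: rev_cases) auto
    with x N[of x'] consider "word_zero (w @ mon x')"
      | u g where "g \<in> \<Gamma>" "w @ mon x' \<doteq> mon u @ [grp g]" by auto
    then show ?thesis
    proof cases
      case 1
      then have "word_zero ([s] @ (w @ mon x') @ mon [a])" by (rule word_zero_context[OF _ sW mon_W(1)])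
      then show ?thesis by (simp add: xa)
    next
      case (2 u g)
      define b where "b = hd (g [a])"
      define h where "h = section_at g a"
      have h: "h \<in> \<Gamma>" using 2 by (simp add: h_def)
      have "(s # w) @ mon x = [s] @ (w @ mon x') @ [ltr a]" by (simp add: xa)
      also have "\<dots> \<doteq> [s] @ (mon u @ [grp g]) @ [ltr a]"
        by (rule word_cong_context[OF 2(2) sW]) simp
      also have "\<dots> = ([s] @ mon u) @ [grp g, ltr a]" by simp
      also have "\<dots> \<doteq> ([s] @ mon u) @ [ltr b, grp h]"
        unfolding b_def h_def by (rule word_cong_prefix[OF grp_ltr[OF 2(1)]]) (use sW in auto)
      also have "\<dots> = [s] @ mon (u @ [b]) @ [grp h]" by simp
      finally have eq: "(s # w) @ mon x \<doteq> [s] @ mon (u @ [b]) @ [grp h]" .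
      \<comment> \<open>Appending one more letter has made the word \<open>u @ [b]\<close> nonempty, so that an adjoint
          letter on the left can be cancelled against it.\<close>
      obtain c v where cv: "u @ [b] = c # v" by (cases "u @ [b]") auto
      have hW: "[grp h] \<in> W" using h by simp
      consider z where "s = ltr z" | z where "s = ltr_adj z" | k where "k \<in> \<Gamma>" "s = grp k"
        | k where "k \<in> \<Gamma>" "s = (Elem k, True)"
        using sW by (cases s) (auto simp: nek_gens_def)
      then show ?thesis
      proof cases
        case (1 z)
        then have "(s # w) @ mon x \<doteq> mon (z # u @ [b]) @ [grp h]" using eq by simp
        then show ?thesis using h by blast
      next
        case (2 z)
        show ?thesis
        proof (cases "z = c")
          case True
          have "[s] @ mon (u @ [b]) @ [grp h] \<doteq> mon v @ [grp h]"
            using word_cong_suffix[OF ltr_adj_ltr_same[of c], of "mon v @ [grp h]"] h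
            by (simp add: cv 2 True)
          then show ?thesis using eq h word_cong_trans by blast
        next
          case False
          then have "word_zero ([] @ [ltr_adj z, ltr c] @ (mon v @ [grp h]))"
            by (intro word_zero_context ltr_adj_ltr_diff) (use h in auto)
          then have "word_zero ([s] @ mon (u @ [b]) @ [grp h])" by (simp add: cv 2)
          then show ?thesis using word_zero_cong[OF eq] by blast
        qed
      next
        case (3 k)
        have "[s] @ mon (u @ [b]) @ [grp h] = (grp k # mon (u @ [b])) @ [grp h]" by (simp add: 3)
        also have "\<dots> \<doteq> (mon (k (u @ [b])) @ [grp (word_section k (u @ [b]))]) @ [grp h]"
          by (rule word_cong_suffix[OF grp_mon[OF 3(1)] hW])
        also have "\<dots> = mon (k (u @ [b])) @ [grp (word_section k (u @ [b])), grp h]" by simp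
        also have "\<dots> \<doteq> mon (k (u @ [b])) @ [grp (word_section k (u @ [b]) \<circ> h)]"
          by (rule word_cong_prefix[OF grp_comp]) (use 3 h word_section in auto)
        finally show ?thesis using eq h word_cong_trans 3 word_section(1) comp_\<Gamma> by meson
      next
        case (4 k)
        let ?k = "inv_into UNIV k"
        have "[s] @ mon (u @ [b]) @ [grp h] = [(Elem k, True)] @ mon (u @ [b]) @ [grp h]" by (simp add: 4)
        also have "\<dots> \<doteq> [grp ?k] @ mon (u @ [b]) @ [grp h]"
          by (rule word_cong_suffix[OF grp_adj]) (use 4 h in auto)
        also have "\<dots> = (grp ?k # mon (u @ [b])) @ [grp h]" by simp
        also have "\<dots> \<doteq> (mon (?k (u @ [b])) @ [grp (word_section ?k (u @ [b]))]) @ [grp h]"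
          by (rule word_cong_suffix[OF grp_mon[OF inv_\<Gamma>[OF 4(1)]] hW])
        also have "\<dots> = mon (?k (u @ [b])) @ [grp (word_section ?k (u @ [b])), grp h]" by simp
        also have "\<dots> \<doteq> mon (?k (u @ [b])) @ [grp (word_section ?k (u @ [b]) \<circ> h)]"
          by (rule word_cong_prefix[OF grp_comp]) (use 4 h word_section in auto)
        finally show ?thesis using eq h word_cong_trans 4 word_section(1) comp_\<Gamma> inv_\<Gamma> by meson
      qed
    qed
  qed
  then show ?case by blast
qed

end

section \<open>Ideals that contain a scalar corner\<close>

text \<open>
  The indicator of the squares works because the gaps between consecutive squares grow.
\<close>

lemma exists_aperiodic_sequence:
  assumes "a \<noteq> (b::'x)"
  shows "\<exists>\<xi>::nat \<Rightarrow> 'x. \<forall>e>0. \<forall>N. \<exists>k\<ge>N. \<xi> k \<noteq> \<xi> (k + e)"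
proof -
  define \<xi> where "\<xi> = (\<lambda>i. if \<exists>m::nat. i = m\<^sup>2 then a else b)"
  have "\<exists>k\<ge>N. \<xi> k \<noteq> \<xi> (k + e)" if e: "0 < e" for e N :: nat
  proof -
    \<comment> \<open>The next square after \<open>m\<^sup>2\<close> is \<open>m\<^sup>2 + 2 m + 1\<close>, beyond \<open>m\<^sup>2 + e\<close> as \<open>m \<ge> e\<close>.\<close>
    define m where "m = N + e"
    have m: "m \<ge> N" "m \<ge> e" by (simp_all add: m_def)
    have "\<not> (\<exists>l::nat. m\<^sup>2 + e = l\<^sup>2)"
    proof
      assume "\<exists>l::nat. m\<^sup>2 + e = l\<^sup>2"
      then obtain l :: nat where l: "m\<^sup>2 + e = l\<^sup>2" by (elim exE)
      have "m\<^sup>2 < l\<^sup>2" using l e by linarith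
      then have "m < l" by (rule power_less_imp_less_base) simp
      then have "(Suc m)\<^sup>2 \<le> l\<^sup>2" by (intro power_mono) simp_all
      then have "m\<^sup>2 + 2 * m + 1 \<le> m\<^sup>2 + e" unfolding l by (simp add: power2_eq_square)
      then show False using m(2) by linarith
    qed
    then have "\<xi> (m\<^sup>2 + e) = b" "\<xi> (m\<^sup>2) = a" by (auto simp: \<xi>_def)
    moreover have "m * 1 \<le> m * m" using e m(2) by (intro mult_le_mono) simp_all
    then have "m\<^sup>2 \<ge> N" using m(1) unfolding power2_eq_square by linarith
    ultimately show ?thesis using assms by (intro exI[of _ "m\<^sup>2"]) simp
  qed
  then show ?thesis by (intro exI[of _ \<xi>]) simp
qed

context nekrashevych
begin

abbreviation X :: "'x list \<Rightarrow> ('x nek_gen, 'k) star_poly" where "X u \<equiv> Poly_Mapping.single (mon u) 1"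
abbreviation Xs :: "'x list \<Rightarrow> ('x nek_gen, 'k) star_poly" where "Xs u \<equiv> Poly_Mapping.single (mon_adj u) 1"
abbreviation scalar :: "'k \<Rightarrow> ('x nek_gen, 'k) star_poly" where "scalar c \<equiv> Poly_Mapping.single [] c"

lemma X_append: "X (u @ v) = X u * X v" by (simp add: single_mult_single_list)
lemma Xs_append: "Xs (u @ v) = Xs v * Xs u" by (simp add: single_mult_single_list)
lemma X_F: "X u \<in> carrier F" "Xs u \<in> carrier F" "scalar c \<in> carrier F" by simp_all
lemma Xs_X: "Xs u * X u \<approx> 1"
  using mon_adj_mon_same[of u] by (simp add: word_cong_def single_mult_single_list one_eq_single)

text \<open>
  This is \<open>b = \<Sum> b x x\<^sup>*\<close>, the sum being over the words \<open>x\<close> of length \<open>N\<close>.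
\<close>

lemma mem_J_if_mult_X:
  assumes "b \<in> carrier F" "\<And>x. length x = N \<Longrightarrow> b * X x \<in> J"
  shows "b \<in> J"
  using assms
proof (induction N arbitrary: b)
  case 0
  from "0.prems"(2)[of "[]"] show ?case by (simp flip: one_eq_single)
next
  case (Suc N)
  have bx: "b * X [x] \<in> J" for x
  proof (rule Suc.IH)
    show "b * X [x] \<in> carrier F" by (intro free_star_algebra_closed Suc.prems X_F)
    show "b * X [x] * X w \<in> J" if "length w = N" for w
      using Suc.prems(2)[of "x # w"] that by (simp add: single_mult_single_list mult.assoc)
  qed
  have "b * X [x] * Xs [x] \<in> J" for x by (rule J_rules(6)[OF bx X_F(2)])
  then have "(\<Sum>x\<in>UNIV. b * X [x] * Xs [x]) \<in> J" by (rule J_rules(7))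
  then have J: "b * (\<Sum>x\<in>UNIV. Poly_Mapping.single [ltr x, ltr_adj x] 1) \<in> J"
    by (simp add: sum_distrib_left mult.assoc single_mult_single_list)
  from iffD1[OF cong_J[OF cong_mult_left[OF sum_ltr_ltr_adj Suc.prems(1)]] J]
  show ?case by simp
qed

text \<open>
  Similarly \<open>b = \<Sum> y y\<^sup>* b\<close>.
\<close>

lemma mem_J_if_Xs_mult:
  assumes "b \<in> carrier F" "\<And>y. length y = N \<Longrightarrow> Xs y * b \<in> J"
  shows "b \<in> J"
  using assms
proof (induction N arbitrary: b)
  case 0
  from "0.prems"(2)[of "[]"] show ?case by (simp flip: one_eq_single)
next
  case (Suc N)
  have bx: "Xs [x] * b \<in> J" for x
  proof (rule Suc.IH)
    show "Xs [x] * b \<in> carrier F" by (intro free_star_algebra_closed Suc.prems X_F)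
    show "Xs w * (Xs [x] * b) \<in> J" if "length w = N" for w
      using Suc.prems(2)[of "x # w"] that by (simp add: single_mult_single_list flip: mult.assoc)
  qed
  have "X [x] * (Xs [x] * b) \<in> J" for x by (rule J_rules(5)[OF bx X_F(1)])
  then have "(\<Sum>x\<in>UNIV. X [x] * (Xs [x] * b)) \<in> J" by (rule J_rules(7))
  then have J: "(\<Sum>x\<in>UNIV. Poly_Mapping.single [ltr x, ltr_adj x] 1) * b \<in> J"
    by (simp add: sum_distrib_right single_mult_single_list flip: mult.assoc)
  from iffD1[OF cong_J[OF cong_mult_right[OF sum_ltr_ltr_adj Suc.prems(1)]] J]
  show ?case by simp
qed

text \<open>
  The triple \<open>(c, u, g)\<close> stands for the term \<open>c u g\<close>.
\<close>

definition term_val :: "'k \<times> 'x list \<times> ('x list \<Rightarrow> 'x list) \<Rightarrow> ('x nek_gen, 'k) star_poly" where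
  "term_val = (\<lambda>(c, u, g). Poly_Mapping.single (mon u @ [grp g]) c)"

abbreviation val :: "('k \<times> 'x list \<times> ('x list \<Rightarrow> 'x list)) list \<Rightarrow> ('x nek_gen, 'k) star_poly" where
  "val ts \<equiv> sum_list (map term_val ts)"

abbreviation in_\<Gamma> :: "('k \<times> 'x list \<times> ('x list \<Rightarrow> 'x list)) list \<Rightarrow> bool" where
  "in_\<Gamma> ts \<equiv> (\<forall>t\<in>set ts. snd (snd t) \<in> \<Gamma>)"

lemma term_val_F: "snd (snd t) \<in> \<Gamma> \<Longrightarrow> term_val t \<in> carrier F"
  by (cases t) (simp add: term_val_def)

lemma val_F: "in_\<Gamma> ts \<Longrightarrow> val ts \<in> carrier F"
  by (induction ts) (simp_all add: free_star_algebra_closed term_val_F)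

lemma normal_form:
  assumes "b \<in> carrier F"
  shows "\<exists>N. \<forall>x. N \<le> length x \<longrightarrow> (\<exists>ts. in_\<Gamma> ts \<and> b * X x \<approx> val ts)"
proof -
  have "\<exists>N. \<forall>x. N \<le> length x \<longrightarrow>
      (\<exists>ts. in_\<Gamma> ts \<and> (\<Sum>w\<in>A. Poly_Mapping.single w (Poly_Mapping.lookup b w)) * X x \<approx> val ts)"
    if "finite A" "A \<subseteq> W" for A
    using that
  proof (induction A rule: finite_induct)
    case empty
    show ?case by (intro exI[of _ 0] allI impI exI[of _ "[]"]) simp
  next
    case (insert w A)
    let ?S = "\<Sum>w\<in>A. Poly_Mapping.single w (Poly_Mapping.lookup b w)"
    from insert obtain N1 where N1: "\<And>x. N1 \<le> length x \<Longrightarrow> \<exists>ts. in_\<Gamma> ts \<and> ?S * X x \<approx> val ts" by auto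
    from word_normal_form[of w] insert obtain N2 where N2: "\<And>x. N2 \<le> length x \<Longrightarrow>
        word_zero (w @ mon x) \<or> (\<exists>u g. g \<in> \<Gamma> \<and> w @ mon x \<doteq> mon u @ [grp g])" by auto
    have "\<exists>ts. in_\<Gamma> ts \<and> (\<Sum>w\<in>insert w A. Poly_Mapping.single w (Poly_Mapping.lookup b w)) * X x \<approx> val ts"
      if x: "max N1 N2 \<le> length x" for x
    proof -
      from N1[of x] x obtain ts where ts: "in_\<Gamma> ts" "?S * X x \<approx> val ts" by auto
      let ?c = "Poly_Mapping.lookup b w"
      have eq: "(\<Sum>w\<in>insert w A. Poly_Mapping.single w (Poly_Mapping.lookup b w)) * X x =
          Poly_Mapping.single (w @ mon x) ?c + ?S * X x"
        using insert by (simp add: distrib_right single_mult_single_list)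
      from N2[of x] x consider "word_zero (w @ mon x)"
        | u g where "g \<in> \<Gamma>" "w @ mon x \<doteq> mon u @ [grp g]" by auto
      then show ?thesis
      proof cases
        case 1
        then have "Poly_Mapping.single (w @ mon x) ?c \<approx> 0" by (simp add: cong_0 single_J)
        from cong_add[OF this ts(2)] show ?thesis unfolding eq using ts(1) by auto
      next
        case (2 u g)
        from cong_add[OF single_cong[OF 2(2), of ?c] ts(2)] show ?thesis
          unfolding eq using ts(1) 2(1) by (intro exI[of _ "(?c, u, g) # ts"]) (simp add: term_val_def)
      qed
    qed
    then show ?case by (intro exI[of _ "max N1 N2"]) simp
  qed
  from this[of "Poly_Mapping.keys b"] assms show ?thesis
    by (simp add: carrier_free_star_algebra_iff flip: poly_mapping_eq_sum_single)
qed

lemma term_val_mult_X: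
  assumes "g \<in> \<Gamma>"
  shows "term_val (c, u, g) * X w \<approx> term_val (c, u @ g w, word_section g w)"
proof -
  have "mon u @ (grp g # mon w) \<doteq> mon u @ mon (g w) @ [grp (word_section g w)]"
    by (rule word_cong_prefix[OF grp_mon[OF assms] mon_W(1)])
  from single_cong[OF this, of c] show ?thesis
    by (simp add: term_val_def single_mult_single_list)
qed

lemma Xs_mult_term_val_mismatch:
  assumes "g \<in> \<Gamma>" "i < length y" "i < length u" "y ! i \<noteq> u ! i"
  shows "Xs y * term_val (c, u, g) \<in> J"
proof -
  have "word_zero ([] @ (mon_adj y @ mon u) @ [grp g])"
    by (rule word_zero_context[OF mon_adj_mon_mismatch[OF assms(2-4)]]) (use assms in simp_all)
  from single_J[OF this, of c] show ?thesis by (simp add: term_val_def single_mult_single_list)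
qed

lemma val_split_prefix:
  "val ts = X u * val (map (\<lambda>(c, _, g). (c, [], g)) (filter (\<lambda>t. fst (snd t) = u) ts)) +
     val (filter (\<lambda>t. fst (snd t) \<noteq> u) ts)"
  by (induction ts) (auto simp: term_val_def distrib_left single_mult_single_list add_ac)

text \<open>
  The value is the sum over the words \<open>u\<close> of \<open>u a\<^sub>u\<close>, where \<open>a\<^sub>u\<close> collects the terms \<open>c g\<close> with prefix
  \<open>u\<close>; so not all \<open>a\<^sub>u\<close> vanish in the quotient.
\<close>

lemma exists_prefix_not_in_J:
  assumes "in_\<Gamma> ts" "val ts \<notin> J"
  shows "\<exists>u. val (map (\<lambda>(c, _, g). (c, [], g)) (filter (\<lambda>t. fst (snd t) = u) ts)) \<notin> J"
  using assms
proof (induction "length ts" arbitrary: ts rule: less_induct)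
  case less
  show ?case
  proof (cases ts)
    case Nil
    then show ?thesis using less.prems by (simp add: J_rules)
  next
    case (Cons t ts')
    let ?u = "fst (snd t)"
    let ?rest = "filter (\<lambda>t. fst (snd t) \<noteq> ?u) ts"
    let ?P = "\<lambda>u ts. val (map (\<lambda>(c, _, g). (c, [], g)) (filter (\<lambda>t. fst (snd t) = u) ts))"
    show ?thesis
    proof (cases "?P ?u ts \<in> J")
      case False then show ?thesis by (rule exI)
    next
      case True
      from J_rules(5)[OF this X_F(1)] have "X ?u * ?P ?u ts \<in> J" .
      then have rest: "val ?rest \<notin> J"
        using less.prems(2) J_rules(3) unfolding val_split_prefix[of ts ?u] by metis
      have "length ?rest < length ts" using Cons by (simp add: le_imp_less_Suc)
      then obtain v where v: "?P v ?rest \<notin> J"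
        using less.hyps[OF _ _ rest] less.prems(1) by auto
      have "v \<noteq> ?u" using v by (auto simp: J_rules filter_empty_conv cong: conj_cong)
      then have "filter (\<lambda>t. fst (snd t) = v) ?rest = filter (\<lambda>t. fst (snd t) = v) ts"
        by (simp add: conj_commute) (metis (mono_tags, lifting))
      then show ?thesis using v by metis
    qed
  qed
qed

text \<open>
  The product is governed by a comparison of the words \<open>u y \<xi>\<close> and \<open>u' g(w \<xi>)\<close>, and vanishes as soon as
  they differ. If \<open>u\<close> and \<open>u'\<close> have the same length, they differ inside \<open>u\<close>. Otherwise both words agree
  with \<open>\<xi>\<close> far out, since \<open>g\<close> preserves tails, but with different shifts \<open>|u| + |y|\<close> and \<open>|u'| + |w|\<close>;
  this is where aperiodicity of \<open>\<xi>\<close> enters.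
\<close>

lemma aperiodic_separates:
  assumes tails: "\<And>g \<xi>. g \<in> \<Gamma> \<Longrightarrow> \<exists>N. \<forall>i\<ge>N. g (prefix_word \<xi> (Suc i)) ! i = \<xi> i"
    and \<xi>: "\<And>e N. 0 < e \<Longrightarrow> \<exists>k\<ge>N. \<xi> k \<noteq> \<xi> (k + e)"
    and g: "g \<in> \<Gamma>" and yw: "length y = length w" and "u' \<noteq> u"
  shows "\<exists>T0. \<forall>T\<ge>T0. Xs (u @ y @ prefix_word \<xi> T) * term_val (c, u', g) * X (w @ prefix_word \<xi> T) \<in> J"
proof -
  define \<eta> where "\<eta> i = (if i < length w then w ! i else \<xi> (i - length w))" for i
  have \<eta>: "w @ prefix_word \<xi> T = prefix_word \<eta> (length w + T)" for T
    by (rule nth_equalityI) (simp_all add: \<eta>_def nth_append)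
  obtain N where N: "\<And>i. N \<le> i \<Longrightarrow> g (prefix_word \<eta> (Suc i)) ! i = \<eta> i"
    using tails[OF g, of \<eta>] by auto
  have img: "(u' @ g (w @ prefix_word \<xi> T)) ! (length u' + length w + k) = \<xi> k" if "N \<le> k" "k < T" for k T
  proof -
    have "(u' @ g (w @ prefix_word \<xi> T)) ! (length u' + length w + k) = g (prefix_word \<eta> (length w + T)) ! (length w + k)"
      by (simp add: nth_append \<eta> add.assoc)
    also have "\<dots> = g (prefix_word \<eta> (Suc (length w + k))) ! (length w + k)"
      by (rule nth_prefix_stable) (use g that in simp_all)
    also have "\<dots> = \<eta> (length w + k)" by (rule N) (use that in simp)
    finally show ?thesis by (simp add: \<eta>_def)
  qed
  have left: "(u @ y @ prefix_word \<xi> T) ! (length u + length w + k) = \<xi> k" if "k < T" for k T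
    using that yw by (simp add: nth_append)
  have "\<exists>T0. \<forall>T\<ge>T0. \<exists>j < length u + length w + T. j < length u' + length w + T \<and>
      (u @ y @ prefix_word \<xi> T) ! j \<noteq> (u' @ g (w @ prefix_word \<xi> T)) ! j"
  proof (rule linorder_cases[of "length u" "length u'"])
    assume "length u = length u'"
    then have "\<exists>j<length u. u ! j \<noteq> u' ! j" using \<open>u' \<noteq> u\<close> by (auto simp: list_eq_iff_nth_eq)
    then obtain j where "j < length u" "u ! j \<noteq> u' ! j" by (elim exE conjE)
    then show ?thesis using \<open>length u = length u'\<close>
      by (intro exI[of _ 0] allI impI exI[of _ j]) (simp add: nth_append)
  next
    assume "length u < length u'"
    define e where "e = length u' - length u"
    have e: "0 < e" "length u' = length u + e" using \<open>length u < length u'\<close> by (simp_all add: e_def)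
    from \<xi>[OF e(1), of N] obtain k where k: "k \<ge> N" "\<xi> k \<noteq> \<xi> (k + e)" by auto
    show ?thesis
    proof (rule exI[of _ "Suc (k + e)"], intro allI impI)
      fix T assume T: "Suc (k + e) \<le> T"
      have "(u @ y @ prefix_word \<xi> T) ! (length u' + length w + k) = \<xi> (k + e)"
        using left[of "k + e" T] T e by (simp add: ac_simps)
      then show "\<exists>j < length u + length w + T. j < length u' + length w + T \<and>
          (u @ y @ prefix_word \<xi> T) ! j \<noteq> (u' @ g (w @ prefix_word \<xi> T)) ! j"
        using img[of k T] T k e by (intro exI[of _ "length u' + length w + k"]) simp
    qed
  next
    assume "length u' < length u"
    define e where "e = length u - length u'"
    have e: "0 < e" "length u = length u' + e" using \<open>length u' < length u\<close> by (simp_all add: e_def)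
    from \<xi>[OF e(1), of N] obtain k where k: "k \<ge> N" "\<xi> k \<noteq> \<xi> (k + e)" by auto
    show ?thesis
    proof (rule exI[of _ "Suc (k + e)"], intro allI impI)
      fix T assume T: "Suc (k + e) \<le> T"
      have "(u' @ g (w @ prefix_word \<xi> T)) ! (length u + length w + k) = \<xi> (k + e)"
        using img[of "k + e" T] T e k by (simp add: ac_simps)
      then show "\<exists>j < length u + length w + T. j < length u' + length w + T \<and>
          (u @ y @ prefix_word \<xi> T) ! j \<noteq> (u' @ g (w @ prefix_word \<xi> T)) ! j"
        using left[of k T] T k e by (intro exI[of _ "length u + length w + k"]) simp
    qed
  qed
  then obtain T0 where T0: "\<And>T. T0 \<le> T \<Longrightarrow> \<exists>j < length u + length w + T. j < length u' + length w + T \<and>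
      (u @ y @ prefix_word \<xi> T) ! j \<noteq> (u' @ g (w @ prefix_word \<xi> T)) ! j" by auto
  have "Xs (u @ y @ prefix_word \<xi> T) * term_val (c, u', g) * X (w @ prefix_word \<xi> T) \<in> J" if "T0 \<le> T" for T
  proof -
    let ?z = "u @ y @ prefix_word \<xi> T" and ?x = "w @ prefix_word \<xi> T"
    from T0[OF that] obtain j where j: "j < length u + length w + T" "j < length u' + length w + T"
      "?z ! j \<noteq> (u' @ g ?x) ! j" by auto
    have cong: "Xs ?z * (term_val (c, u', g) * X ?x) \<approx> Xs ?z * term_val (c, u' @ g ?x, word_section g ?x)"
      by (rule cong_mult_left[OF term_val_mult_X[OF g] X_F(2)])
    have "Xs ?z * term_val (c, u' @ g ?x, word_section g ?x) \<in> J"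
      by (rule Xs_mult_term_val_mismatch[OF word_section(1)[OF g] _ _ j(3)])
        (use j yw length_\<Gamma>[OF g, of ?x] in simp_all)
    then have "Xs ?z * (term_val (c, u', g) * X ?x) \<in> J" unfolding cong_J[OF cong] .
    then show ?thesis by (simp only: mult.assoc)
  qed
  then show ?thesis by auto
qed

text \<open>
  The corner \<open>(u y t)\<^sup>* b x (w t)\<close> of a suitable \<open>b x\<close> in the ideal is a nonzero scalar: the terms with
  prefix \<open>u\<close> contribute \<open>t\<^sup>* (y\<^sup>* a w) t = c\<close>, and the other ones nothing if \<open>t\<close> is a long prefix of an
  aperiodic word.
\<close>

lemma ideal_eq_carrier_if_separated:
  assumes tails: "\<And>g \<xi>. g \<in> \<Gamma> \<Longrightarrow> \<exists>N. \<forall>i\<ge>N. g (prefix_word \<xi> (Suc i)) ! i = \<xi> i"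
    and two: "a \<noteq> (b::'x)"
    and scalar_corner: "\<And>ts. in_\<Gamma> ts \<Longrightarrow> (\<forall>t\<in>set ts. fst (snd t) = []) \<Longrightarrow> val ts \<notin> J \<Longrightarrow>
      \<exists>y w c. length y = length w \<and> c \<noteq> 0 \<and> Xs y * val ts * X w \<approx> scalar c"
    and I: "ideal I F" "J \<subseteq> I" "I \<noteq> J"
  shows "I = carrier F"
proof -
  note I_rules = ideal_free_star_algebraD[OF I(1)]
  have I_cong: "x \<in> I \<longleftrightarrow> y \<in> I" if "x \<approx> y" for x y
  proof -
    have "x - y \<in> I" using that I(2) by (auto simp: cong_J_def)
    then show ?thesis using I_rules(3)[of "x - y" y] I_rules(4)[of x "x - y"] by auto
  qed
  from I obtain z where z: "z \<in> I" "z \<notin> J" by auto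
  have zF: "z \<in> carrier F" using z I_rules(1) by auto
  from normal_form[OF zF] obtain N where
    N: "\<And>x. N \<le> length x \<Longrightarrow> \<exists>ts. in_\<Gamma> ts \<and> z * X x \<approx> val ts" by auto
  from mem_J_if_mult_X[OF zF, of N] z(2) obtain x where x: "length x = N" "z * X x \<notin> J" by auto
  from N[of x] x obtain ts where ts: "in_\<Gamma> ts" "z * X x \<approx> val ts" by auto
  have tsI: "val ts \<in> I" using I_cong[OF ts(2)] I_rules(6)[OF z(1) X_F(1)] by simp
  have "val ts \<notin> J" using cong_J[OF ts(2)] x(2) by simp
  from exists_prefix_not_in_J[OF ts(1) this] obtain u where
    u: "val (map (\<lambda>(c, _, g). (c, [], g)) (filter (\<lambda>t. fst (snd t) = u) ts)) \<notin> J" (is "val ?us \<notin> J") by auto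
  have us: "in_\<Gamma> ?us" "\<forall>t\<in>set ?us. fst (snd t) = []" using ts(1) by auto
  from scalar_corner[OF us u] obtain y w c where
    ywc: "length y = length w" "c \<noteq> 0" "Xs y * val ?us * X w \<approx> scalar c" by auto
  let ?vs = "filter (\<lambda>t. fst (snd t) \<noteq> u) ts"
  obtain \<xi> :: "nat \<Rightarrow> 'x" where \<xi>: "\<And>e N. 0 < e \<Longrightarrow> \<exists>k\<ge>N. \<xi> k \<noteq> \<xi> (k + e)"
    using exists_aperiodic_sequence[OF two] by auto
  have "\<forall>t\<in>set ?vs. \<forall>\<^sub>F T in sequentially.
      Xs (u @ y @ prefix_word \<xi> T) * term_val t * X (w @ prefix_word \<xi> T) \<in> J"
  proof
    fix t assume "t \<in> set ?vs"
    then have mem: "t \<in> set ts" "fst (snd t) \<noteq> u" by simp_all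
    obtain d v g where tt: "t = (d, v, g)" by (rule prod_cases3)
    with mem ts(1) have t: "t = (d, v, g)" "g \<in> \<Gamma>" "v \<noteq> u" by auto
    show "\<forall>\<^sub>F T in sequentially. Xs (u @ y @ prefix_word \<xi> T) * term_val t * X (w @ prefix_word \<xi> T) \<in> J"
      unfolding eventually_sequentially t(1)
      by (rule aperiodic_separates[OF tails \<xi> t(2) ywc(1) t(3)])
  qed
  then have "\<forall>\<^sub>F T in sequentially. \<forall>t\<in>set ?vs.
      Xs (u @ y @ prefix_word \<xi> T) * term_val t * X (w @ prefix_word \<xi> T) \<in> J"
    by (rule eventually_ball_finite[rotated]) simp
  then obtain T where T: "\<And>t. t \<in> set ?vs \<Longrightarrow>
      Xs (u @ y @ prefix_word \<xi> T) * term_val t * X (w @ prefix_word \<xi> T) \<in> J"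
    using eventually_happens'[OF sequentially_bot] by (metis (no_types, lifting))
  let ?p = "prefix_word \<xi> T"
  have rest: "Xs (u @ y @ ?p) * val vs * X (w @ ?p) \<in> J" if "set vs \<subseteq> set ?vs" for vs
    using that by (induction vs) (use T in \<open>simp_all add: J_rules distrib_left distrib_right\<close>)
  have "Xs (u @ y @ ?p) * val ts * X (w @ ?p) =
      Xs ?p * (Xs y * (Xs u * X u) * val ?us * X w) * X ?p + Xs (u @ y @ ?p) * val ?vs * X (w @ ?p)"
    unfolding val_split_prefix[of ts u] X_append Xs_append by (simp only: distrib_left distrib_right mult.assoc)
  also have "\<dots> \<approx> scalar c + 0"
  proof (rule cong_add)
    note clo = free_star_algebra_closed X_F val_F us(1)
    have "Xs y * (Xs u * X u) * val ?us * X w \<approx> Xs y * 1 * val ?us * X w"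
      by (intro cong_mult_right cong_mult_left Xs_X clo)
    also have "Xs y * 1 * val ?us * X w \<approx> scalar c" using ywc(3) by simp
    finally have "Xs ?p * (Xs y * (Xs u * X u) * val ?us * X w) * X ?p \<approx> Xs ?p * scalar c * X ?p"
      by (intro cong_mult_right cong_mult_left X_F)
    also have "Xs ?p * scalar c * X ?p = scalar c * (Xs ?p * X ?p)"
      by (simp add: single_mult_single_list)
    also have "\<dots> \<approx> scalar c * 1" by (intro cong_mult_left Xs_X X_F)
    finally show "Xs ?p * (Xs y * (Xs u * X u) * val ?us * X w) * X ?p \<approx> scalar c" by simp
    show "Xs (u @ y @ ?p) * val ?vs * X (w @ ?p) \<approx> 0" unfolding cong_0 by (rule rest[OF subset_refl])
  qed
  finally have "Xs (u @ y @ ?p) * val ts * X (w @ ?p) \<approx> scalar c" by (simp only: add_0_right)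
  from I_cong[OF this] have "scalar c \<in> I"
    using I_rules(6)[OF I_rules(5)[OF tsI X_F(2)] X_F(1)] by blast
  from I_rules(5)[OF this X_F(3)] have "scalar (inverse c) * scalar c \<in> I" .
  then have one: "1 \<in> I" using ywc(2) by (simp add: single_mult_single_list one_eq_single)
  have "v \<in> I" if "v \<in> carrier F" for v using I_rules(5)[OF one that] by simp
  then show ?thesis using I_rules(1) by auto
qed

end

section \<open>The nucleus of a Sunic group\<close>

lemma vec_of_list_image: "carrier_vec m = vec_of_list ` {xs. set xs \<subseteq> UNIV \<and> length xs = m}"
proof (intro equalityI subsetI)
  fix v :: "'a vec" assume "v \<in> carrier_vec m"
  then have len: "list_of_vec v \<in> {xs. set xs \<subseteq> UNIV \<and> length xs = m}" by simp
  show "v \<in> vec_of_list ` {xs. set xs \<subseteq> UNIV \<and> length xs = m}"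
    by (rule image_eqI[OF _ len]) (simp add: vec_list)
next
  fix v :: "'a vec" assume "v \<in> vec_of_list ` {xs. set xs \<subseteq> UNIV \<and> length xs = m}"
  then show "v \<in> carrier_vec m" by (elim imageE) (simp add: carrier_dim_vec)
qed

lemma finite_carrier_vec [simp]: "finite (carrier_vec m :: 'a::finite vec set)"
  unfolding vec_of_list_image by (intro finite_imageI finite_lists_length_eq) simp

lemma card_carrier_vec: "card (carrier_vec m :: 'a::finite vec set) = CARD('a) ^ m"
proof -
  have "inj_on (vec_of_list :: 'a list \<Rightarrow> 'a vec) A" for A
    by (rule inj_on_inverseI[where g = list_of_vec]) (simp add: list_vec)
  then show ?thesis
    unfolding vec_of_list_image using card_lists_length_eq[of "UNIV :: 'a set" m]
    by (subst card_image) simp_all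
qed

lemma H_act_props:
  "length (H_act h w) = length w" "H_act 0 w = w" "H_act (h + h') w = H_act h (H_act h' w)"
  by (cases w; simp add: add.assoc)+

lemma H_act_0 [simp]: "H_act 0 = id"
  by (rule ext) (simp add: H_act_props)

locale sunic =
  fixes f :: "'p::prime_card mod_ring poly"
  assumes monic: "monic f" and deg: "degree f \<ge> 1" and coeff_0: "coeff f 0 \<noteq> 0"
begin

abbreviation n :: nat where "n \<equiv> degree f"
abbreviation G :: "'p mod_ring vec set" where "G \<equiv> carrier_vec n"
abbreviation T :: "'p mod_ring vec \<Rightarrow> 'p mod_ring vec" where "T g \<equiv> companion f *\<^sub>v g"
abbreviation \<Gamma> where "\<Gamma> \<equiv> sunic_group f"

lemma n_pos: "0 < n" using deg by simp

lemma companion_carrier: "companion f \<in> carrier_mat n n"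
  by (simp add: companion_def)

lemma T_G [simp]: "g \<in> G \<Longrightarrow> T g \<in> G"
  by (rule mult_mat_vec_carrier[OF companion_carrier])

lemma index_T:
  assumes g: "g \<in> G" and i: "i < n"
  shows "T g $ i = (if i = 0 then 0 else g $ (i - 1)) - coeff f i * g $ (n - 1)"
proof -
  have "T g $ i = (\<Sum>j<n. ((if j = n - 1 then - coeff f i else 0) + (if i = j + 1 then 1 else 0)) * g $ j)"
    using g i by (simp add: companion_def scalar_prod_def lessThan_atLeast0) 
       (intro sum.cong refl, auto)
  also have "\<dots> = (\<Sum>j<n. if j = n - 1 then - coeff f i * g $ j else 0) + (\<Sum>j<n. if i = j + 1 then g $ j else 0)"
    unfolding distrib_right sum.distrib by (intro arg_cong2[of _ _ _ _ "(+)"] sum.cong) auto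
  also have "(\<Sum>j<n. if j = n - 1 then - coeff f i * g $ j else 0) = - coeff f i * g $ (n - 1)"
    using n_pos by simp
  also have "(\<Sum>j<n. if i = j + 1 then g $ j else 0) = (if i = 0 then 0 else g $ (i - 1))"
  proof (cases i)
    case (Suc k)
    then have "(\<Sum>j<n. if i = j + 1 then g $ j else 0) = (\<Sum>j<n. if j = k then g $ j else 0)"
      by (intro sum.cong) auto
    then show ?thesis using Suc i by simp
  qed simp
  finally show ?thesis by simp
qed

lemma T_add: "g \<in> G \<Longrightarrow> h \<in> G \<Longrightarrow> T (g + h) = T g + T h"
  by (rule mult_add_distrib_mat_vec[OF companion_carrier])

lemma T_minus: "g \<in> G \<Longrightarrow> h \<in> G \<Longrightarrow> T (g - h) = T g - T h"
  by (rule mult_minus_distrib_mat_vec[OF companion_carrier])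

lemma T_0: "T (0\<^sub>v n) = 0\<^sub>v n"
  by (metis T_minus T_G minus_cancel_vec zero_carrier_vec)

text \<open>
  The constant term of \<open>f\<close> is not \<open>0\<close>, so the first coordinate of \<open>T g\<close> determines the last one of \<open>g\<close>.
\<close>

lemma T_eq_0: 
  assumes "g \<in> G" "T g = 0\<^sub>v n" shows "g = 0\<^sub>v n"
proof -
  have *: "(if i = 0 then 0 else g $ (i - 1)) - coeff f i * g $ (n - 1) = 0" if "i < n" for i
    using index_T[OF assms(1) that] assms(2) that by simp
  from *[OF n_pos] have last: "g $ (n - 1) = 0" using coeff_0 by simp
  have "g $ i = 0" if "i < n" for i
  proof (cases "i = n - 1")
    case True then show ?thesis using last by simp
  next
    case False
    then have "Suc i < n" using that by simp
    from *[OF this] last show ?thesis by simp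
  qed
  with assms(1) show ?thesis by (intro eq_vecI) auto
qed

lemma inj_T: "inj_on T G"
proof (rule inj_onI)
  fix g h assume gh: "g \<in> G" "h \<in> G" "T g = T h"
  have "T (g - h) = T h - T h" unfolding T_minus[OF gh(1,2)] gh(3) ..
  also have "\<dots> = 0\<^sub>v n" by (rule minus_cancel_vec[OF T_G[OF gh(2)]])
  finally have z: "g - h = 0\<^sub>v n" by (rule T_eq_0[OF minus_carrier_vec[OF gh(1,2)]])
  have "g $ i = h $ i" if "i < n" for i
    using arg_cong[OF z, of "\<lambda>v. v $ i"] gh that by simp
  then show "g = h" using gh by (intro eq_vecI) auto
qed

lemma bij_T: "bij_betw T G G"
  unfolding bij_betw_def using endo_inj_surj[OF finite_carrier_vec _ inj_T] inj_T
  by (simp add: image_subset_iff)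

lemma T_pow_G [simp]: "g \<in> G \<Longrightarrow> (T ^^ k) g \<in> G"
  by (induction k) simp_all

lemma bij_T_pow: "bij_betw (T ^^ k) G G"
  by (rule bij_betw_funpow[OF bij_T])

lemma T_pow_add: "g \<in> G \<Longrightarrow> h \<in> G \<Longrightarrow> (T ^^ k) (g + h) = (T ^^ k) g + (T ^^ k) h"
  by (induction k) (simp_all add: T_add)

lemma T_pow_0 [simp]: "(T ^^ k) (0\<^sub>v n) = 0\<^sub>v n"
  by (induction k) (simp_all add: T_0)

lemma G_act_Cons:
  "G_act f g (0 # w) = 0 # G_act f (T g) w"
  "G_act f g (- 1 # w) = - 1 # H_act (g $ (n - 1)) w"
  "x \<noteq> 0 \<Longrightarrow> x \<noteq> - 1 \<Longrightarrow> G_act f g (x # w) = x # w"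
  by (simp_all add: Phi_def)

lemma G_act_add: 
  assumes "g \<in> G" "h \<in> G"
  shows "G_act f (g + h) w = G_act f g (G_act f h w)"
  using assms
proof (induction w arbitrary: g h)
  case (Cons x w)
  consider "x = 0" | "x = - 1" | "x \<noteq> 0" "x \<noteq> - 1" by blast
  then show ?case
  proof cases
    case 1
    then show ?thesis using Cons.IH[of "T g" "T h"] Cons.prems T_add[of g h] by (simp only: G_act_Cons T_G)
  next
    case 2
    have "(g + h) $ (n - 1) = g $ (n - 1) + h $ (n - 1)" using Cons.prems n_pos by simp
    then show ?thesis using 2 by (simp only: G_act_Cons H_act_props)
  next
    case 3
    then show ?thesis by (simp only: G_act_Cons(3)[OF 3])
  qed
qed simp

lemma length_G_act: "length (G_act f g w) = length w"
proof (induction w arbitrary: g)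
  case (Cons x w)
  consider "x = 0" | "x = - 1" | "x \<noteq> 0" "x \<noteq> - 1" by blast
  then show ?case by cases (simp_all add: G_act_Cons H_act_props Cons.IH del: G_act.simps)
qed simp

lemma G_act_0 [simp]: "G_act f (0\<^sub>v n) = id"
proof
  fix w show "G_act f (0\<^sub>v n) w = id w"
  proof (induction w)
    case (Cons x w)
    consider "x = 0" | "x = - 1" | "x \<noteq> 0" "x \<noteq> - 1" by blast
    then show ?case using n_pos by cases (simp_all add: G_act_Cons T_0 Cons.IH del: G_act.simps)
  qed simp
qed

definition nucleus :: "('p mod_ring list \<Rightarrow> 'p mod_ring list) set" where
  "nucleus = range H_act \<union> G_act f ` G"

lemma nucleus_cases [consumes 1, case_names H G]:
  assumes "s \<in> nucleus"
  obtains h where "s = H_act h" | g where "g \<in> G" "s = G_act f g"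
  using assms unfolding nucleus_def by auto

lemma nucleus_I [simp]: "H_act h \<in> nucleus" "g \<in> G \<Longrightarrow> G_act f g \<in> nucleus" "id \<in> nucleus"
  unfolding nucleus_def by (simp_all, metis H_act_0 rangeI)

lemma nucleus_inverse:
  assumes "s \<in> nucleus"
  obtains t where "t \<in> nucleus" "s \<circ> t = id" "t \<circ> s = id"
  using assms
proof (cases rule: nucleus_cases)
  case (H h)
  have "H_act h \<circ> H_act (- h) = id" "H_act (- h) \<circ> H_act h = id"
    by (rule ext, simp flip: H_act_props(3))+
  then show ?thesis using that[of "H_act (- h)"] H by simp
next
  case (G g)
  have "G_act f g \<circ> G_act f (- g) = id" "G_act f (- g) \<circ> G_act f g = id"
    using G(1) by (rule_tac ext, simp flip: G_act_add)+
  then show ?thesis using that[of "G_act f (- g)"] G by simp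
qed

lemma bij_nucleus: "s \<in> nucleus \<Longrightarrow> bij s"
  by (erule nucleus_inverse) (metis o_bij)

lemma carrier_BijGroup_UNIV: "g \<in> carrier (BijGroup UNIV) \<longleftrightarrow> bij g"
  by (simp add: BijGroup_def Bij_def)

lemma \<Gamma>_def: "\<Gamma> = generate (BijGroup UNIV) nucleus"
  by (simp add: sunic_group_def nucleus_def)

lemma nucleus_\<Gamma>: "nucleus \<subseteq> \<Gamma>"
  unfolding \<Gamma>_def by (auto intro: generate.incl)

lemma subgroup_sunic: "subgroup \<Gamma> (BijGroup UNIV)"
  unfolding \<Gamma>_def
  by (rule group.generate_is_subgroup[OF group_BijGroup])
    (use bij_nucleus in \<open>auto simp: carrier_BijGroup_UNIV\<close>)

lemma mult_BijGroup_UNIV: "bij g \<Longrightarrow> bij h \<Longrightarrow> g \<otimes>\<^bsub>BijGroup UNIV\<^esub> h = g \<circ> h"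
  by (simp add: BijGroup_def Bij_def compose_def comp_def restrict_UNIV)

lemma bij_sunic: "g \<in> \<Gamma> \<Longrightarrow> bij g"
  using subgroup.subset[OF subgroup_sunic] by (auto simp: carrier_BijGroup_UNIV)

lemma comp_sunic: "g \<in> \<Gamma> \<Longrightarrow> h \<in> \<Gamma> \<Longrightarrow> g \<circ> h \<in> \<Gamma>"
  using subgroup.m_closed[OF subgroup_sunic, of g h] by (simp add: mult_BijGroup_UNIV bij_sunic)

text \<open>
  The nucleus is closed under inverses, so it generates \<open>\<Gamma>\<close> already as a monoid.
\<close>

lemma sunic_induct [consumes 1, case_names nucleus comp]:
  assumes "g \<in> \<Gamma>"
    and nuc: "\<And>s. s \<in> nucleus \<Longrightarrow> P s"
    and comp: "\<And>g h. g \<in> \<Gamma> \<Longrightarrow> h \<in> \<Gamma> \<Longrightarrow> P g \<Longrightarrow> P h \<Longrightarrow> P (g \<circ> h)"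
  shows "P g"
  using assms(1) unfolding \<Gamma>_def
proof (induction rule: generate.induct)
  case one
  have one: "\<one>\<^bsub>BijGroup UNIV\<^esub> = (id :: 'p mod_ring list \<Rightarrow> _)" by (simp add: BijGroup_def id_def restrict_UNIV)
  show ?case unfolding one by (rule nuc[OF nucleus_I(3)])
next
  case (incl s)
  then show ?case by (rule nuc)
next
  case (inv s)
  then obtain t where t: "t \<in> nucleus" "s \<circ> t = id" "t \<circ> s = id" by (rule nucleus_inverse)
  have "inv\<^bsub>BijGroup UNIV\<^esub> s = inv_into UNIV s"
    using inv_BijGroup[of s UNIV] bij_nucleus[OF inv] by (simp add: Bij_def restrict_UNIV)
  also have "\<dots> = t" using t by (simp add: inv_unique_comp)
  finally show ?case using nuc[OF t(1)] by simp
next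
  case (eng g h)
  then have \<Gamma>: "g \<in> \<Gamma>" "h \<in> \<Gamma>" by (simp_all add: \<Gamma>_def)
  have eq: "g \<otimes>\<^bsub>BijGroup UNIV\<^esub> h = g \<circ> h" by (intro mult_BijGroup_UNIV bij_sunic \<Gamma>)
  show ?case unfolding eq by (rule comp[OF \<Gamma> eng.IH])
qed

lemma nucleus_section:
  assumes "s \<in> nucleus"
  shows "\<exists>t\<in>nucleus. \<exists>y. \<forall>w. s (x # w) = y # t w"
  using assms
proof (cases rule: nucleus_cases)
  case (H h)
  then show ?thesis by (intro bexI[of _ id] exI[of _ "h + x"]) simp_all
next
  case (G g)
  consider "x = 0" | "x = - 1" | "x \<noteq> 0" "x \<noteq> - 1" by blast
  then show ?thesis
  proof cases
    case 1
    then show ?thesis using G by (intro bexI[of _ "G_act f (T g)"] exI[of _ 0]) (simp_all add: G_act_Cons del: G_act.simps)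
  next
    case 2
    then show ?thesis using G by (intro bexI[of _ "H_act (g $ (n - 1))"] exI[of _ "- 1"]) (simp_all add: G_act_Cons del: G_act.simps)
  next
    case 3
    then show ?thesis using G by (intro bexI[of _ id] exI[of _ x]) (simp_all add: G_act_Cons del: G_act.simps)
  qed
qed

lemma length_nucleus: "s \<in> nucleus \<Longrightarrow> length (s w) = length w"
  by (erule nucleus_cases) (simp_all add: H_act_props length_G_act)

lemma self_similar_sunic: "self_similar_group \<Gamma>"
proof -
  have sec: "\<exists>h\<in>\<Gamma>. \<exists>y. \<forall>w. g (x # w) = y # h w" if "g \<in> \<Gamma>" for g x
    using that
  proof (induction arbitrary: x rule: sunic_induct)
    case (nucleus s)
    then show ?case using nucleus_section[of s x] nucleus_\<Gamma> by blast
  next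
    case (comp g h)
    from comp(4)[of x] obtain h' y where h: "h' \<in> \<Gamma>" "\<And>w. h (x # w) = y # h' w" by auto
    from comp(3)[of y] obtain g' z where g: "g' \<in> \<Gamma>" "\<And>w. g (y # w) = z # g' w" by auto
    show ?case
      by (intro bexI[of _ "g' \<circ> h'"] exI[of _ z]) (use g(2) h(2) comp_sunic[OF g(1) h(1)] in simp_all)
  qed
  have len: "length (g w) = length w" if "g \<in> \<Gamma>" for g w
    using that
    by (induction arbitrary: w rule: sunic_induct) (simp_all add: length_nucleus)
  have "\<exists>h\<in>\<Gamma>. \<forall>w. g (x # w) = g [x] @ h w" if g: "g \<in> \<Gamma>" for g x
  proof -
    from sec[OF g, of x] obtain h y where h: "h \<in> \<Gamma>" "\<And>w. g (x # w) = y # h w" by auto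
    have "h [] = []" by (metis len[OF h(1)] length_0_conv)
    then have y: "g [x] = [y]" using h(2)[of "[]"] by simp
    show ?thesis
    proof (rule bexI[OF _ h(1)], rule allI)
      show "g (x # w) = g [x] @ h w" for w using h(2)[of w] y by simp
    qed
  qed
  then show ?thesis unfolding self_similar_group_def using subgroup_sunic len by simp
qed

sublocale self_similar "sunic_group f"
  by standard (rule self_similar_sunic)

lemma section_at_nucleus:
  "section_at (H_act h) x = id"
  "section_at (G_act f g) 0 = G_act f (T g)"
  "section_at (G_act f g) (- 1) = H_act (g $ (n - 1))"
  "x \<noteq> 0 \<Longrightarrow> x \<noteq> - 1 \<Longrightarrow> section_at (G_act f g) x = id"
  by (rule ext, simp add: section_at_def G_act_Cons del: G_act.simps)+

lemma word_section_nucleus: "s \<in> nucleus \<Longrightarrow> word_section s w \<in> nucleus"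
proof (induction w arbitrary: s)
  case (Cons x w)
  from Cons.prems have "section_at s x \<in> nucleus"
  proof (cases rule: nucleus_cases)
    case (G g)
    consider "x = 0" | "x = - 1" | "x \<noteq> 0" "x \<noteq> - 1" by blast
    then show ?thesis by cases (use G in \<open>simp_all add: section_at_nucleus\<close>)
  qed (simp add: section_at_nucleus)
  with Cons show ?case using nucleus_\<Gamma> by (simp add: word_section_Cons subset_iff)
qed simp

text \<open>
  Elements of \<open>H\<close> have trivial sections at letters, so a product with a factor in \<open>H\<close> has the
  sections of its other factor; and \<open>G\<close> is closed under products.
\<close>

lemma section_comp_nucleus:
  assumes "s \<in> nucleus" "t \<in> nucleus"
  shows "word_section (s \<circ> t) [x] \<in> nucleus"
proof -
  have \<Gamma>: "s \<in> \<Gamma>" "t \<in> \<Gamma>" using assms nucleus_\<Gamma> by auto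
  have eq: "word_section (s \<circ> t) [x] = word_section s (t [x]) \<circ> word_section t [x]"
    by (rule word_section_comp[OF \<Gamma>])
  have one: "word_section (H_act h) [y] = id" for h y :: "'p mod_ring"
    using word_section_Cons[of "H_act h" y "[]"] nucleus_\<Gamma> by (simp add: section_at_nucleus subset_iff)
  have s: "word_section s (t [x]) \<in> nucleus" and t: "word_section t [x] \<in> nucleus"
    using assms by (simp_all add: word_section_nucleus)
  from assms(1) show ?thesis
  proof (cases rule: nucleus_cases)
    case (H h)
    obtain y where "t [x] = [y]" using length_\<Gamma>[OF \<Gamma>(2), of "[x]"] by (auto simp: length_Suc_conv)
    then show ?thesis using eq t one H by simp
  next
    case (G g)
    note s_G = this
    from assms(2) show ?thesis
    proof (cases rule: nucleus_cases)
      case (H h)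
      then show ?thesis using eq s one by simp
    next
      case (G h)
      have "s \<circ> t = G_act f (g + h)" using s_G G by (intro ext) (simp add: G_act_add)
      then show ?thesis using s_G G by (simp add: word_section_nucleus)
    qed
  qed
qed

text \<open>
  Passing to the sections of a product at one more letter brings a product of two elements of the
  nucleus back into the nucleus.
\<close>

lemma contracting: "g \<in> \<Gamma> \<Longrightarrow> \<exists>N. \<forall>w. N \<le> length w \<longrightarrow> word_section g w \<in> nucleus"
proof (induction rule: sunic_induct)
  case (nucleus s)
  then show ?case by (simp add: word_section_nucleus)
next
  case (comp g h)
  then obtain M N where M: "\<And>w. M \<le> length w \<Longrightarrow> word_section g w \<in> nucleus"
    and N: "\<And>w. N \<le> length w \<Longrightarrow> word_section h w \<in> nucleus" by auto
  have "word_section (g \<circ> h) w \<in> nucleus" if w: "Suc (max M N) \<le> length w" for w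
  proof -
    from w obtain v x where v: "w = v @ [x]" by (cases w rule: rev_cases) auto
    have len: "M \<le> length (h v)" "N \<le> length v" using w v length_\<Gamma>[OF comp(2)] by simp_all
    have "word_section (g \<circ> h) w = word_section (word_section g (h v) \<circ> word_section h v) [x]"
      using comp by (simp add: v word_section_append word_section_comp)
    then show ?thesis using section_comp_nucleus[OF M[OF len(1)] N[OF len(2)]] by simp
  qed
  then show ?case by (intro exI[of _ "Suc (max M N)"] allI impI)
qed

definition seq_act :: "('p mod_ring list \<Rightarrow> 'p mod_ring list) \<Rightarrow> (nat \<Rightarrow> 'p mod_ring) \<Rightarrow> nat \<Rightarrow> 'p mod_ring" where
  "seq_act g \<xi> i = g (prefix_word \<xi> (Suc i)) ! i"

lemma prefix_seq_act: "g \<in> \<Gamma> \<Longrightarrow> prefix_word (seq_act g \<xi>) k = g (prefix_word \<xi> k)"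
proof (rule nth_equalityI)
  assume g: "g \<in> \<Gamma>"
  show len: "length (prefix_word (seq_act g \<xi>) k) = length (g (prefix_word \<xi> k))"
    using length_\<Gamma>[OF g, of "prefix_word \<xi> k"] by simp
  fix i assume "i < length (prefix_word (seq_act g \<xi>) k)"
  then show "prefix_word (seq_act g \<xi>) k ! i = g (prefix_word \<xi> k) ! i"
    using nth_prefix_stable[OF g, of i k \<xi>] by (simp add: seq_act_def)
qed

lemma seq_act_comp: "g \<in> \<Gamma> \<Longrightarrow> h \<in> \<Gamma> \<Longrightarrow> seq_act (g \<circ> h) \<xi> = seq_act g (seq_act h \<xi>)"
  by (rule ext) (simp only: seq_act_def comp_apply prefix_seq_act[of h \<xi>, symmetric])

lemma nth_H_act: "0 < i \<Longrightarrow> H_act h w ! i = w ! i"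
  by (cases w) simp_all

text \<open>
  An element of \<open>G\<close> changes at most the letter that follows the first nonzero letter.
\<close>

lemma nth_G_act:
  assumes "i < length w" "(\<forall>j<i. w ! j = 0) \<or> (\<exists>j. Suc j < i \<and> w ! j \<noteq> 0)"
  shows "G_act f g w ! i = w ! i"
  using assms
proof (induction w arbitrary: g i)
  case (Cons x w)
  consider "x = 0" | "x = - 1" | "x \<noteq> 0" "x \<noteq> - 1" by blast
  then show ?case
  proof cases
    case 1
    show ?thesis
    proof (cases i)
      case (Suc k)
      have "(\<forall>j<k. w ! j = 0) \<or> (\<exists>j. Suc j < k \<and> w ! j \<noteq> 0)"
      proof (cases "\<forall>j<i. (x # w) ! j = 0")
        case True
        then have "w ! j = 0" if "j < k" for j using that Suc by (auto dest: spec[of _ "Suc j"])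
        then show ?thesis by simp
      next
        case False
        then obtain j where j: "Suc j < i" "(x # w) ! j \<noteq> 0" using Cons.prems by auto
        then obtain j' where "j = Suc j'" using 1 by (cases j) auto
        then show ?thesis using j Suc by auto
      qed
      then show ?thesis using Cons.IH[of k] Cons.prems 1 Suc by (simp add: G_act_Cons del: G_act.simps)
    qed (use 1 in \<open>simp add: G_act_Cons del: G_act.simps\<close>)
  next
    case 2
    show ?thesis
    proof (cases i)
      case (Suc k)
      have "\<not> (\<forall>j<i. (x # w) ! j = 0)" using 2 Suc by (auto intro!: exI[of _ 0])
      then have "0 < k" using Cons.prems Suc by auto
      then show ?thesis using 2 Suc by (simp add: G_act_Cons nth_H_act del: G_act.simps)
    qed (use 2 in \<open>simp add: G_act_Cons del: G_act.simps\<close>)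
  next
    case 3
    then show ?thesis by (simp add: G_act_Cons del: G_act.simps)
  qed
qed simp

text \<open>
  A generator changes at most one letter of an infinite word. The bound \<open>N\<close> depends on \<open>\<xi>\<close>: the
  changed position can be arbitrarily far out.
\<close>

lemma tails: "g \<in> \<Gamma> \<Longrightarrow> \<exists>N. \<forall>i\<ge>N. seq_act g \<xi> i = \<xi> i"
proof (induction arbitrary: \<xi> rule: sunic_induct)
  case (nucleus s)
  then show ?case
  proof (cases rule: nucleus_cases)
    case (H h)
    then show ?thesis
      by (intro exI[of _ 1]) (simp add: seq_act_def nth_H_act del: upt_Suc)
  next
    case (G g)
    have *: "seq_act s \<xi> i = \<xi> i" if "(\<forall>j<i. \<xi> j = 0) \<or> (\<exists>j. Suc j < i \<and> \<xi> j \<noteq> 0)" for i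
    proof -
      have nth: "prefix_word \<xi> (Suc i) ! j = \<xi> j" if "j \<le> i" for j using that by (simp del: upt_Suc)
      have "G_act f g (prefix_word \<xi> (Suc i)) ! i = prefix_word \<xi> (Suc i) ! i"
        by (rule nth_G_act) (use that nth in \<open>auto simp del: upt_Suc\<close>)
      then show ?thesis using G nth[of i] by (simp add: seq_act_def del: upt_Suc)
    qed
    show ?thesis
    proof (cases "\<exists>j. \<xi> j \<noteq> 0")
      case True
      then obtain j where "\<xi> j \<noteq> 0" by auto
      then have "seq_act s \<xi> i = \<xi> i" if "Suc (Suc j) \<le> i" for i
        using that by (intro *) (auto intro!: exI[of _ j])
      then show ?thesis by (intro exI[of _ "Suc (Suc j)"] allI impI)
    next
      case False
      then have "seq_act s \<xi> i = \<xi> i" for i by (intro *) simp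
      then show ?thesis by (intro exI[of _ 0] allI impI)
    qed
  qed
next
  case (comp g h)
  from comp(4)[of \<xi>] comp(3)[of "seq_act h \<xi>"] obtain M N where
    "\<And>i. M \<le> i \<Longrightarrow> seq_act h \<xi> i = \<xi> i" "\<And>i. N \<le> i \<Longrightarrow> seq_act g (seq_act h \<xi>) i = seq_act h \<xi> i" by auto
  then show ?case unfolding seq_act_comp[OF comp(1,2)] by (intro exI[of _ "max M N"]) simp
qed

end

section \<open>Corners of elements of the group algebra\<close>

lemma single_sum: "Poly_Mapping.single w (sum h A) = (\<Sum>i\<in>A. Poly_Mapping.single w (h i))"
  by (induction A rule: infinite_finite_induct) (simp_all add: single_add)

context nekrashevych
begin

text \<open>
  Corners turn a group element into its sections: \<open>y\<^sup>* g w = y\<^sup>* g(w) g|\<^sub>w\<close>.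
\<close>

lemma corner_grp:
  assumes "g \<in> \<Gamma>" "length y = length w"
  shows "Xs y * Poly_Mapping.single [grp g] c * X w \<approx>
    (if g w = y then Poly_Mapping.single [grp (word_section g w)] c else 0)"
proof -
  have s: "[grp (word_section g w)] \<in> W" using word_section(1)[OF assms(1)] by simp
  have "mon_adj y @ (grp g # mon w) \<doteq> mon_adj y @ mon (g w) @ [grp (word_section g w)]"
    by (rule word_cong_prefix[OF grp_mon[OF assms(1)] mon_W(2)])
  from single_cong[OF this, of c]
  have "Xs y * Poly_Mapping.single [grp g] c * X w \<approx>
      Poly_Mapping.single (mon_adj y @ mon (g w) @ [grp (word_section g w)]) c"
    by (simp add: single_mult_single_list)
  also have "\<dots> \<approx> (if g w = y then Poly_Mapping.single [grp (word_section g w)] c else 0)"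
  proof (cases "g w = y")
    case True
    from single_cong[OF word_cong_suffix[OF mon_adj_mon_same[of y] s], of c] True
    show ?thesis by simp
  next
    case False
    have "length y = length (g w)" using assms length_\<Gamma>[OF assms(1)] by simp
    from word_zero_context[OF mon_adj_mon_neq[OF this] mon_W(1)[of "[]"] s] False
    have "word_zero (mon_adj y @ mon (g w) @ [grp (word_section g w)])" by auto
    then show ?thesis using False by (simp add: cong_0 single_J)
  qed
  finally show ?thesis .
qed

lemma corner_sum:
  assumes "\<And>i. i \<in> A \<Longrightarrow> g i \<in> \<Gamma>" "length y = length w"
  shows "Xs y * (\<Sum>i\<in>A. Poly_Mapping.single [grp (g i)] (c i)) * X w \<approx>
    (\<Sum>i\<in>A. if g i w = y then Poly_Mapping.single [grp (word_section (g i) w)] (c i) else 0)"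
  unfolding sum_distrib_left sum_distrib_right
  by (intro cong_sum corner_grp assms)

lemma corner_val:
  assumes "in_\<Gamma> ts" "\<forall>t\<in>set ts. fst (snd t) = []" "length y = length w"
  shows "Xs y * val ts * X w \<approx>
    val (map (\<lambda>t. (fst t, [], word_section (snd (snd t)) w)) (filter (\<lambda>t. snd (snd t) w = y) ts))"
  using assms(1,2)
proof (induction ts)
  case (Cons t ts)
  obtain c u g where t: "t = (c, u, g)" by (rule prod_cases3)
  have g: "g \<in> \<Gamma>" and u: "u = []" using Cons.prems t by auto
  have "Xs y * term_val t * X w \<approx> (if g w = y then term_val (c, [], word_section g w) else 0)"
    using corner_grp[OF g assms(3), of c] by (simp add: t u term_val_def cong: if_cong)
  from cong_add[OF this Cons.IH] Cons.prems
  show ?case by (cases "g w = y") (simp_all add: t distrib_left distrib_right)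
qed simp

end

context sunic
begin

text \<open>
  The value at \<open>t\<close> of the push-forward of \<open>\<alpha>\<close> along the functional \<open>g \<mapsto> (T\<^sup>k g)\<^sub>n\<^sub>-\<^sub>1\<close>.
\<close>

definition push :: "nat \<Rightarrow> 'p mod_ring \<Rightarrow> ('p mod_ring vec \<Rightarrow> 'a::comm_monoid_add) \<Rightarrow> 'a" where
  "push k t \<alpha> = (\<Sum>g | g \<in> G \<and> (T ^^ k) g $ (n - 1) = t. \<alpha> g)"

lemma G_act_spine:
  "G_act f g (replicate k 0 @ - 1 # w) = replicate k 0 @ - 1 # H_act ((T ^^ k) g $ (n - 1)) w"
proof (induction k arbitrary: g)
  case (Suc k)
  then show ?case by (simp add: G_act_Cons funpow_swap1 del: G_act.simps)
qed (simp add: G_act_Cons del: G_act.simps)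

lemma word_section_spine: "g \<in> G \<Longrightarrow> word_section (G_act f g) (replicate k 0 @ [- 1, s]) = id"
  by (rule ext) (simp add: word_section_def G_act_spine)

end

locale sunic_algebra = sunic f + nekrashevych "sunic_group f" J
  for f :: "'p::prime_card mod_ring poly" and J :: "('p mod_ring nek_gen, 'k::field) star_poly set"
begin

definition gsum :: "('p mod_ring vec \<Rightarrow> 'k) \<Rightarrow> ('p mod_ring nek_gen, 'k) star_poly" where
  "gsum \<alpha> = (\<Sum>g\<in>G. Poly_Mapping.single [grp (G_act f g)] (\<alpha> g))"

definition hsum :: "('p mod_ring \<Rightarrow> 'k) \<Rightarrow> ('p mod_ring nek_gen, 'k) star_poly" where
  "hsum \<beta> = (\<Sum>h\<in>UNIV. Poly_Mapping.single [grp (H_act h)] (\<beta> h))"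

lemma G_\<Gamma>: "g \<in> G \<Longrightarrow> G_act f g \<in> \<Gamma>" and H_\<Gamma>: "H_act h \<in> \<Gamma>"
  using nucleus_\<Gamma> by auto

lemma gsum_F: "gsum \<alpha> \<in> carrier F"
  unfolding gsum_def by (intro sum_closed_free_star_algebra single_F) (simp add: G_\<Gamma>)

lemma gsum_add_single:
  assumes "g \<in> G"
  shows "gsum (\<lambda>x. \<alpha> x + (if x = g then c else 0)) = gsum \<alpha> + Poly_Mapping.single [grp (G_act f g)] c"
proof -
  have "gsum (\<lambda>x. \<alpha> x + (if x = g then c else 0)) =
      gsum \<alpha> + (\<Sum>x\<in>G. if x = g then Poly_Mapping.single [grp (G_act f g)] c else 0)"
    unfolding gsum_def single_add sum.distrib by (intro arg_cong2[of _ _ _ _ "(+)"] sum.cong) auto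
  then show ?thesis using assms by simp
qed

lemma hsum_add_single:
  "hsum (\<lambda>x. \<beta> x + (if x = h then c else 0)) = hsum \<beta> + Poly_Mapping.single [grp (H_act h)] c"
proof -
  have "hsum (\<lambda>x. \<beta> x + (if x = h then c else 0)) =
      hsum \<beta> + (\<Sum>x\<in>UNIV. if x = h then Poly_Mapping.single [grp (H_act h)] c else 0)"
    unfolding hsum_def single_add sum.distrib by (intro arg_cong2[of _ _ _ _ "(+)"] sum.cong) auto
  then show ?thesis by simp
qed

lemma nucleus_val:
  assumes "\<forall>t\<in>set ts. fst (snd t) = [] \<and> snd (snd t) \<in> nucleus"
  shows "\<exists>\<alpha> \<beta>. val ts = gsum \<alpha> + hsum \<beta>"
  using assms
proof (induction ts)
  case Nil
  show ?case by (intro exI[of _ "\<lambda>_. 0"]) (simp add: gsum_def hsum_def)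
next
  case (Cons t ts)
  then obtain \<alpha> \<beta> where IH: "val ts = gsum \<alpha> + hsum \<beta>" by auto
  obtain c u s where "t = (c, u, s)" by (rule prod_cases3)
  with Cons.prems have t: "t = (c, [], s)" and s: "s \<in> nucleus" by auto
  from s show ?case
  proof (cases rule: nucleus_cases)
    case (H h)
    have "val (t # ts) = gsum \<alpha> + hsum (\<lambda>x. \<beta> x + (if x = h then c else 0))"
      unfolding hsum_add_single using IH by (simp add: t H term_val_def add_ac)
    then show ?thesis by blast
  next
    case (G g)
    have "val (t # ts) = gsum (\<lambda>x. \<alpha> x + (if x = g then c else 0)) + hsum \<beta>"
      unfolding gsum_add_single[OF G(1)] using IH by (simp add: t G term_val_def add_ac)
    then show ?thesis by blast
  qed
qed

text \<open>
  By \<open>G_act_spine\<close>, \<open>g\<close> maps \<open>0\<^sup>k(-1)0\<close> to \<open>0\<^sup>k(-1)t\<close> for \<open>t = (T\<^sup>k g)\<^sub>n\<^sub>-\<^sub>1\<close>, with trivial section there.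
  The corner thus sums the coefficients over a fibre.
\<close>

lemma corner_push:
  "Xs (replicate k 0 @ [- 1, t]) * gsum \<alpha> * X (replicate k 0 @ [- 1, 0]) \<approx> scalar (push k t \<alpha>)"
proof -
  let ?w = "replicate k 0 @ [- 1, 0]" and ?y = "replicate k 0 @ [- 1, t]"
  have "Xs ?y * gsum \<alpha> * X ?w \<approx> (\<Sum>g\<in>G. if G_act f g ?w = ?y
      then Poly_Mapping.single [grp (word_section (G_act f g) ?w)] (\<alpha> g) else 0)"
    unfolding gsum_def by (rule corner_sum) (simp_all add: G_\<Gamma>)
  also have "\<dots> = (\<Sum>g\<in>G. if (T ^^ k) g $ (n - 1) = t then Poly_Mapping.single [grp id] (\<alpha> g) else 0)"
    by (intro sum.cong refl if_cong) (simp_all add: G_act_spine word_section_spine)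
  also have "\<dots> = (\<Sum>g | g \<in> G \<and> (T ^^ k) g $ (n - 1) = t. Poly_Mapping.single [grp id] (\<alpha> g))"
    by (rule sum.inter_filter[symmetric]) simp
  also have "\<dots> \<approx> (\<Sum>g | g \<in> G \<and> (T ^^ k) g $ (n - 1) = t. scalar (\<alpha> g))"
    by (intro cong_sum single_cong grp_id)
  also have "\<dots> = scalar (push k t \<alpha>)" by (simp add: push_def single_sum)
  finally show ?thesis .
qed

text \<open>
  Elements of \<open>G\<close> fix the one-letter word \<open>0\<close>, and \<open>h\<close> is the only element of \<open>H\<close> that maps it to
  the word \<open>h\<close>.
\<close>

lemma corner_hsum:
  assumes "h \<noteq> 0"
  shows "Xs [h] * (gsum \<alpha> + hsum \<beta>) * X [0] \<approx> scalar (\<beta> h)"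
proof -
  have "Xs [h] * gsum \<alpha> * X [0] \<approx> (\<Sum>g\<in>G. if G_act f g [0] = [h]
      then Poly_Mapping.single [grp (word_section (G_act f g) [0])] (\<alpha> g) else 0)"
    unfolding gsum_def by (rule corner_sum) (simp_all add: G_\<Gamma>)
  also have "\<dots> = (\<Sum>g\<in>G. 0)"
    using assms by (intro sum.cong refl) (simp add: G_act_Cons del: G_act.simps(2))
  finally have 1: "Xs [h] * gsum \<alpha> * X [0] \<approx> 0" by simp
  have sec: "word_section (H_act k) [x] = id" for k x :: "'p mod_ring"
    by (rule ext) (simp add: word_section_def)
  have "Xs [h] * hsum \<beta> * X [0] \<approx> (\<Sum>k\<in>UNIV. if H_act k [0] = [h]
      then Poly_Mapping.single [grp (word_section (H_act k) [0])] (\<beta> k) else 0)"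
    unfolding hsum_def by (rule corner_sum) (simp_all add: H_\<Gamma>)
  also have "\<dots> = (\<Sum>k\<in>UNIV. if k = h then Poly_Mapping.single [grp id] (\<beta> k) else 0)"
    by (intro sum.cong refl if_cong) (simp_all add: sec)
  also have "\<dots> = Poly_Mapping.single [grp id] (\<beta> h)" by simp
  also have "\<dots> \<approx> scalar (\<beta> h)" by (rule single_cong[OF grp_id])
  finally have 2: "Xs [h] * hsum \<beta> * X [0] \<approx> scalar (\<beta> h)" .
  from cong_add[OF 1 2] show ?thesis by (simp add: distrib_left distrib_right)
qed

text \<open>
  A corner at long words leads to a nonzero combination of elements of \<open>G \<union> H\<close>. If a nontrivial element
  of \<open>H\<close> occurs, its coefficient is a corner. Otherwise the combination lives on \<open>G\<close>, and its
  push-forwards, which do not all vanish, are corners.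
\<close>

lemma scalar_corner:
  assumes inj: "\<And>\<alpha> :: 'p mod_ring vec \<Rightarrow> 'k. (\<And>k t. push k t \<alpha> = 0) \<Longrightarrow> \<forall>g\<in>G. \<alpha> g = 0"
    and ts: "in_\<Gamma> ts" "\<forall>t\<in>set ts. fst (snd t) = []" "val ts \<notin> J"
  shows "\<exists>y w c. length y = length w \<and> c \<noteq> 0 \<and> Xs y * val ts * X w \<approx> scalar c"
proof -
  have "\<exists>N. \<forall>t\<in>set ts. \<forall>w. N \<le> length w \<longrightarrow> word_section (snd (snd t)) w \<in> nucleus"
    using ts(1)
  proof (induction ts)
    case (Cons t ts)
    from Cons obtain M where M: "\<forall>t\<in>set ts. \<forall>w. M \<le> length w \<longrightarrow> word_section (snd (snd t)) w \<in> nucleus"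
      by auto
    from contracting[of "snd (snd t)"] Cons.prems obtain N where
      N: "\<forall>w. N \<le> length w \<longrightarrow> word_section (snd (snd t)) w \<in> nucleus" by auto
    show ?case by (rule exI[of _ "max M N"]) (use M N in simp)
  qed simp
  then obtain N where N0: "\<forall>t\<in>set ts. \<forall>w. N \<le> length w \<longrightarrow> word_section (snd (snd t)) w \<in> nucleus"
    by (elim exE)
  have N: "word_section (snd (snd t)) w \<in> nucleus" if "t \<in> set ts" "length w = N" for t w
    using N0 that by simp
  have F1: "val ts * X w \<in> carrier F" for w
    by (intro free_star_algebra_closed val_F ts X_F)
  obtain w where w: "length w = N" "val ts * X w \<notin> J"
    using mem_J_if_mult_X[OF val_F[OF ts(1)]] ts(3) by blast
  obtain y where y: "length y = N" "Xs y * (val ts * X w) \<notin> J"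
    using mem_J_if_Xs_mult[OF F1] w(2) by blast
  let ?us = "map (\<lambda>t. (fst t, [], word_section (snd (snd t)) w)) (filter (\<lambda>t. snd (snd t) w = y) ts)"
  have yw: "length y = length w" using y w by simp
  have us: "Xs y * val ts * X w \<approx> val ?us" by (rule corner_val[OF ts(1,2) yw])
  have "\<forall>t\<in>set ?us. fst (snd t) = [] \<and> snd (snd t) \<in> nucleus" using N w(1) by auto
  from nucleus_val[OF this] obtain \<alpha> \<beta> where ab: "val ?us = gsum \<alpha> + hsum \<beta>" by (elim exE)
  have "\<exists>y' w' c. length y' = length w' \<and> c \<noteq> 0 \<and> Xs y' * val ?us * X w' \<approx> scalar c"
  proof (cases "\<exists>h. h \<noteq> 0 \<and> \<beta> h \<noteq> 0")
    case True
    then obtain h where "h \<noteq> 0" "\<beta> h \<noteq> 0" by (elim exE conjE)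
    then show ?thesis using corner_hsum[of h \<alpha> \<beta>] unfolding ab
      by (intro exI[of _ "[h]"] exI[of _ "[0]"] exI[of _ "\<beta> h"]) simp
  next
    case False
    \<comment> \<open>The neutral element is in \<open>G\<close> as well as in \<open>H\<close>; its coefficient is moved to \<open>G\<close>.\<close>
    then have "hsum \<beta> = (\<Sum>h\<in>UNIV. if h = 0 then Poly_Mapping.single [grp id] (\<beta> h) else 0)"
      unfolding hsum_def by (intro sum.cong refl) auto
    then have h0: "hsum \<beta> = Poly_Mapping.single [grp id] (\<beta> 0)" by simp
    define \<alpha>' where "\<alpha>' = (\<lambda>x. \<alpha> x + (if x = 0\<^sub>v n then \<beta> 0 else 0))"
    have a': "val ?us = gsum \<alpha>'"
      unfolding ab \<alpha>'_def h0 by (subst gsum_add_single) simp_all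
    \<comment> \<open>Otherwise \<open>\<alpha>'\<close> would vanish, and with it the corner of \<open>ts\<close>.\<close>
    have "\<exists>k t. push k t \<alpha>' \<noteq> 0"
    proof (rule ccontr)
      assume "\<not> ?thesis"
      then have "\<forall>g\<in>G. \<alpha>' g = 0" by (intro inj) simp
      then have "gsum \<alpha>' = 0" by (simp add: gsum_def)
      then have "Xs y * val ts * X w \<in> J" using us unfolding a' by (simp add: cong_0)
      then show False using y(2) by (simp add: mult.assoc)
    qed
    then obtain k t where "push k t \<alpha>' \<noteq> 0" by (elim exE)
    then show ?thesis unfolding a' using corner_push[of k t \<alpha>']
      by (intro exI[of _ "replicate k 0 @ [- 1, t]"] exI[of _ "replicate k 0 @ [- 1, 0]"] exI[of _ "push k t \<alpha>'"]) simp
  qed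
  then obtain y' w' c where c: "length y' = length w'" "c \<noteq> 0" "Xs y' * val ?us * X w' \<approx> scalar c"
    by (elim exE conjE)
  have "Xs (y @ y') * val ts * X (w @ w') = Xs y' * (Xs y * val ts * X w) * X w'"
    unfolding X_append Xs_append by (simp only: mult.assoc)
  also have "\<dots> \<approx> Xs y' * val ?us * X w'"
    by (intro cong_mult_left cong_mult_right us X_F)
  also note c(3)
  finally show ?thesis using c(1,2) yw
    by (intro exI[of _ "y @ y'"] exI[of _ "w @ w'"] exI[of _ c]) simp
qed

lemma ideal_trivial_if_push_injective:
  assumes "\<And>\<alpha> :: 'p mod_ring vec \<Rightarrow> 'k. (\<And>k t. push k t \<alpha> = 0) \<Longrightarrow> \<forall>g\<in>G. \<alpha> g = 0"
    and "ideal I F" "J \<subseteq> I" "I \<noteq> J"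
  shows "I = carrier F"
proof (rule ideal_eq_carrier_if_separated[where a = 0 and b = 1])
  show "\<exists>N. \<forall>i\<ge>N. g (prefix_word \<xi> (Suc i)) ! i = \<xi> i" if "g \<in> \<Gamma>" for g \<xi>
    using tails[OF that, of \<xi>] unfolding seq_act_def .
  show "(0 :: 'p mod_ring) \<noteq> 1" by simp
  show "\<exists>y w c. length y = length w \<and> c \<noteq> 0 \<and> Xs y * val ts * X w \<approx> scalar c"
    if "in_\<Gamma> ts" "\<forall>t\<in>set ts. fst (snd t) = []" "val ts \<notin> J" for ts
    by (rule scalar_corner[OF assms(1) that])
qed (rule assms(2-4))+

end

section \<open>Representations by partial injections\<close>

text \<open>
  Words of generators act on a set as partial injections, adjoint letters acting as inverses. The
  linear extension is a representation on the vector space with that set as a basis.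
\<close>

locale partial_rep =
  fixes act :: "'s \<times> bool \<Rightarrow> 'b \<Rightarrow> 'b option"
  assumes act_adjoint: "act (s, True) b = Some b' \<longleftrightarrow> act (s, False) b' = Some b"
begin

fun word_act :: "('s \<times> bool) list \<Rightarrow> 'b \<Rightarrow> 'b option" where
  "word_act [] b = Some b"
| "word_act (s # w) b = Option.bind (word_act w b) (act s)"

lemma word_act_append: "word_act (v @ w) b = Option.bind (word_act w b) (word_act v)"
proof (induction v)
  case Nil
  then show ?case by (cases "word_act w b") simp_all
next
  case (Cons s v)
  then show ?case by (cases "word_act w b") simp_all
qed

lemma act_adjoint': "act (s, \<not> e) b = Some b' \<longleftrightarrow> act (s, e) b' = Some b"
  by (cases e) (simp_all add: act_adjoint)

lemma word_act_adj: "word_act (adj_word w) b = Some b' \<longleftrightarrow> word_act w b' = Some b"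
proof (induction w arbitrary: b b')
  case Nil
  then show ?case by (auto simp: adj_word_def)
next
  case (Cons t w)
  obtain s e where t: "t = (s, e)" by (cases t)
  have eq: "adj_word (t # w) = adj_word w @ [(s, \<not> e)]" by (simp add: adj_word_def t)
  have "word_act (adj_word (t # w)) b = Some b' \<longleftrightarrow>
      (\<exists>c. act (s, \<not> e) b = Some c \<and> word_act (adj_word w) c = Some b')"
    by (simp add: eq word_act_append bind_eq_Some_conv)
  also have "\<dots> \<longleftrightarrow> (\<exists>c. word_act w b' = Some c \<and> act (s, e) c = Some b)"
    unfolding Cons.IH act_adjoint' by blast
  also have "\<dots> \<longleftrightarrow> word_act (t # w) b' = Some b"
    by (simp add: t bind_eq_Some_conv)
  finally show ?case .
qed

lemma word_act_inj: "word_act w b1 = Some b' \<Longrightarrow> word_act w b2 = Some b' \<Longrightarrow> b1 = b2"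
  by (metis word_act_adj option.inject)

text \<open>
  The entry of the matrix of \<open>a\<close> in the column of \<open>b\<close> and the row of \<open>b'\<close>.
\<close>

definition coef :: "('s, 'k::field) star_poly \<Rightarrow> 'b \<Rightarrow> 'b \<Rightarrow> 'k" where
  "coef a b b' = (\<Sum>w\<in>Poly_Mapping.keys a. if word_act w b = Some b' then Poly_Mapping.lookup a w else 0)"

lemma coef_superset:
  assumes "finite A" "Poly_Mapping.keys a \<subseteq> A"
  shows "coef a b b' = (\<Sum>w\<in>A. if word_act w b = Some b' then Poly_Mapping.lookup a w else 0)"
  unfolding coef_def using assms
  by (intro sum.mono_neutral_left) (auto simp: in_keys_iff)

lemma coef_add: "coef (a + c) b b' = coef a b b' + coef c b b'"
proof -
  let ?A = "Poly_Mapping.keys a \<union> Poly_Mapping.keys c"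
  have "coef (a + c) b b' = (\<Sum>w\<in>?A. if word_act w b = Some b' then Poly_Mapping.lookup (a + c) w else 0)"
    by (rule coef_superset) (use Poly_Mapping.keys_add[of a c] in simp_all)
  also have "\<dots> = coef a b b' + coef c b b'"
    unfolding coef_superset[of ?A a, OF finite_UnI[OF finite_keys finite_keys] Un_upper1]
      coef_superset[of ?A c, OF finite_UnI[OF finite_keys finite_keys] Un_upper2] sum.distrib[symmetric]
    by (intro sum.cong refl) (simp add: lookup_add)
  finally show ?thesis .
qed

lemma coef_0 [simp]: "coef 0 b b' = 0"
  by (simp add: coef_def)

lemma coef_minus: "coef (a - c) b b' = coef a b b' - coef c b b'"
  using coef_add[of "a - c" c b b'] by simp

lemma coef_sum: "coef (sum h A) b b' = (\<Sum>i\<in>A. coef (h i) b b')"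
  by (induction A rule: infinite_finite_induct) (simp_all add: coef_add)

lemma coef_single: "coef (Poly_Mapping.single w c) b b' = (if word_act w b = Some b' then c else 0)"
  by (subst coef_superset[of "{w}"]) auto

lemma coef_1: "coef 1 b b' = (if b = b' then 1 else 0)"
  by (simp add: one_eq_single coef_single)

lemma coef_single_mult:
  "coef (Poly_Mapping.single v d * a) b b' = (\<Sum>w\<in>Poly_Mapping.keys a.
     if word_act (v @ w) b = Some b' then d * Poly_Mapping.lookup a w else 0)"
  by (subst poly_mapping_eq_sum_single[of a])
    (simp only: sum_distrib_left single_mult_single_list coef_sum coef_single)

lemma coef_mult_single:
  "coef (a * Poly_Mapping.single v d) b b' = (\<Sum>w\<in>Poly_Mapping.keys a.
     if word_act (w @ v) b = Some b' then Poly_Mapping.lookup a w * d else 0)"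
  by (subst poly_mapping_eq_sum_single[of a])
    (simp only: sum_distrib_right single_mult_single_list coef_sum coef_single)

lemma coef_mult_left_eq_0:
  assumes "\<And>b'. coef a b b' = 0"
  shows "coef (x * a) b b' = 0"
proof -
  have "coef (Poly_Mapping.single v d * a) b b' = 0" for v d
  proof (cases "\<exists>c. word_act v c = Some b'")
    case True
    then obtain c where c: "word_act v c = Some b'" by (elim exE)
    have "word_act (v @ w) b = Some b' \<longleftrightarrow> word_act w b = Some c" for w
      unfolding word_act_append bind_eq_Some_conv using c word_act_inj by metis
    note iff = this
    have "coef (Poly_Mapping.single v d * a) b b' = (\<Sum>w\<in>Poly_Mapping.keys a.
        if word_act (v @ w) b = Some b' then d * Poly_Mapping.lookup a w else 0)"
      by (rule coef_single_mult)
    also have "\<dots> = d * coef a b c"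
      unfolding coef_def sum_distrib_left iff by (intro sum.cong refl) simp
    finally show ?thesis using assms by simp
  next
    case False
    then have "word_act (v @ w) b \<noteq> Some b'" for w
      by (auto simp: word_act_append bind_eq_Some_conv)
    then show ?thesis by (simp add: coef_single_mult)
  qed
  then show ?thesis
    by (subst poly_mapping_eq_sum_single[of x]) (simp add: sum_distrib_right coef_sum)
qed

lemma coef_mult_right_eq_0:
  assumes "\<And>v c. v \<in> Poly_Mapping.keys x \<Longrightarrow> word_act v b = Some c \<Longrightarrow> coef a c b' = 0"
  shows "coef (a * x) b b' = 0"
proof -
  have "coef (a * Poly_Mapping.single v d) b b' = 0" if "v \<in> Poly_Mapping.keys x" for v d
  proof (cases "word_act v b")
    case None
    then show ?thesis by (simp add: coef_mult_single word_act_append)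
  next
    case (Some c)
    have "coef (a * Poly_Mapping.single v d) b b' = (\<Sum>w\<in>Poly_Mapping.keys a.
        if word_act (w @ v) b = Some b' then Poly_Mapping.lookup a w * d else 0)"
      by (rule coef_mult_single)
    also have "\<dots> = coef a c b' * d"
      unfolding coef_def sum_distrib_right
      by (intro sum.cong refl) (simp add: word_act_append Some)
    finally show ?thesis using assms[OF that Some] by simp
  qed
  then show ?thesis
    by (subst poly_mapping_eq_sum_single[of x]) (simp add: sum_distrib_left coef_sum)
qed

text \<open>
  The matrix of the adjoint is the transpose, as adjoint letters act as inverse partial injections.
\<close>

lemma coef_adj: "coef (adj a) b b' = coef a b' b"
proof -
  have "coef (adj a) b b' = (\<Sum>w\<in>Poly_Mapping.keys a.
      if word_act (adj_word w) b = Some b' then Poly_Mapping.lookup (adj a) (adj_word w) else 0)"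
    unfolding coef_def keys_adj by (subst sum.reindex) (simp_all add: inj_on_subset[OF inj_adj_word])
  also have "\<dots> = coef a b' b"
    unfolding word_act_adj coef_def by (intro sum.cong refl) (simp add: lookup_adj)
  finally show ?thesis .
qed

lemma ideal_annihilator:
  assumes B: "\<And>b s b'. b \<in> B \<Longrightarrow> fst s \<in> S \<Longrightarrow> act s b = Some b' \<Longrightarrow> b' \<in> B"
  shows "ideal {a \<in> carrier (free_star_algebra S). \<forall>b\<in>B. \<forall>b'. coef a b b' = 0}
    (free_star_algebra S :: ('s, 'k::field) star_poly ring)"
proof (rule ideal_free_star_algebraI)
  have wB: "c \<in> B" if "word_act v b = Some c" "b \<in> B" "v \<in> lists (S \<times> UNIV)" for v b c
    using that
  proof (induction v arbitrary: c)
    case (Cons s v)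
    then obtain d where d: "word_act v b = Some d" "act s d = Some c" by (auto simp: bind_eq_Some_conv)
    with Cons have "d \<in> B" "fst s \<in> S" by auto
    then show ?case using B d(2) by blast
  qed simp
  fix a x :: "('s, 'k) star_poly"
  assume a: "a \<in> {a \<in> carrier (free_star_algebra S). \<forall>b\<in>B. \<forall>b'. coef a b b' = 0}"
    and x: "x \<in> carrier (free_star_algebra S)"
  have "coef (x * a) b b' = 0" if "b \<in> B" for b b'
    by (rule coef_mult_left_eq_0) (use a that in simp)
  then show "x * a \<in> {a \<in> carrier (free_star_algebra S). \<forall>b\<in>B. \<forall>b'. coef a b b' = 0}"
    using a x by (simp add: free_star_algebra_closed)
  have "coef (a * x) b b' = 0" if "b \<in> B" for b b'
  proof (rule coef_mult_right_eq_0)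
    fix v c assume v: "v \<in> Poly_Mapping.keys x" "word_act v b = Some c"
    have "v \<in> lists (S \<times> UNIV)" using x v(1) unfolding carrier_free_star_algebra_iff by (rule subsetD)
    from wB[OF v(2) that this] show "coef a c b' = 0" using a by simp
  qed
  then show "a * x \<in> {a \<in> carrier (free_star_algebra S). \<forall>b\<in>B. \<forall>b'. coef a b b' = 0}"
    using a x by (simp add: free_star_algebra_closed)
qed (auto simp: free_star_algebra_closed coef_add)

end

section \<open>Germs at infinite words\<close>

context sunic
begin

lemma T_pow_minus: "g \<in> G \<Longrightarrow> h \<in> G \<Longrightarrow> (T ^^ k) (g - h) = (T ^^ k) g - (T ^^ k) h"
  by (induction k) (simp_all add: T_minus)

text \<open>
  The last coordinates of \<open>T\<^sup>k g\<close> determine \<open>g\<close>: if they all vanish, the companion matrix merely shifts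
  coordinates upwards, so every coordinate of \<open>T\<^sup>k g\<close> reappears as the last one of a later \<open>T\<^sup>l g\<close>.
\<close>

lemma observable:
  assumes "g \<in> G" "\<And>k. (T ^^ k) g $ (n - 1) = 0"
  shows "g = 0\<^sub>v n"
proof -
  have "\<forall>k. (T ^^ k) g $ (n - 1 - j) = 0" if "j < n" for j
    using that
  proof (induction j)
    case 0
    then show ?case using assms(2) by simp
  next
    case (Suc j)
    have "(T ^^ k) g $ (n - 1 - Suc j) = 0" for k
    proof -
      have i: "n - 1 - j < n" "n - 1 - j \<noteq> 0" "n - 1 - j - 1 = n - 1 - Suc j" using Suc.prems by auto
      have "\<forall>k. (T ^^ k) g $ (n - 1 - j) = 0" using Suc by simp
      then have "(T ^^ Suc k) g $ (n - 1 - j) = 0" by (rule spec)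
      then have "T ((T ^^ k) g) $ (n - 1 - j) = 0" by simp
      then show ?thesis
        unfolding index_T[OF T_pow_G[OF assms(1)] i(1)] using i assms(2) by simp
    qed
    then show ?case by (rule allI)
  qed
  then have *: "(T ^^ 0) g $ (n - 1 - j) = 0" if "j < n" for j using that by blast
  have "g $ i = 0" if "i < n" for i
    using *[of "n - 1 - i"] that by simp
  with assms(1) show ?thesis by (intro eq_vecI) auto
qed

lemma G_act_inj:
  assumes "g \<in> G" "h \<in> G" "G_act f g = G_act f h"
  shows "g = h"
proof -
  have "(T ^^ k) g $ (n - 1) = (T ^^ k) h $ (n - 1)" for k
    using G_act_spine[of g k "[0]"] G_act_spine[of h k "[0]"] unfolding assms(3) by simp
  moreover have "(T ^^ k) (g - h) $ (n - 1) = (T ^^ k) g $ (n - 1) - (T ^^ k) h $ (n - 1)" for k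
    unfolding T_pow_minus[OF assms(1,2)]
    using T_pow_G[OF assms(1), of k] T_pow_G[OF assms(2), of k] n_pos by simp
  ultimately have z: "g - h = 0\<^sub>v n"
    by (intro observable[OF minus_carrier_vec[OF assms(1,2)]]) simp
  have "g $ i = h $ i" if "i < n" for i
    using arg_cong[OF z, of "\<lambda>v. v $ i"] assms(1,2) that by simp
  then show "g = h" using assms(1,2) by (intro eq_vecI) auto
qed

text \<open>
  Far down an infinite word \<open>\<xi>\<close>, the sections of \<open>g \<in> \<Gamma>\<close> lie in \<open>G\<close> and each is the image of the
  preceding one under \<open>T\<close> (both are trivial unless \<open>\<xi>\<close> is eventually \<open>0\<close>). They are recorded by the vector
  \<open>c\<close> for which they are \<open>T\<^sup>k c\<close>, which makes the germ independent of \<open>k\<close>.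
\<close>

definition is_germ :: "('p mod_ring list \<Rightarrow> 'p mod_ring list) \<Rightarrow> (nat \<Rightarrow> 'p mod_ring) \<Rightarrow> 'p mod_ring vec \<Rightarrow> bool" where
  "is_germ g \<xi> c \<longleftrightarrow> c \<in> G \<and> (\<exists>N. \<forall>k\<ge>N. word_section g (prefix_word \<xi> k) = G_act f ((T ^^ k) c))"

lemma is_germ_unique:
  assumes "is_germ g \<xi> c" "is_germ g \<xi> d"
  shows "c = d"
proof -
  from assms obtain M N where
    "c \<in> G" "\<forall>k\<ge>M. word_section g (prefix_word \<xi> k) = G_act f ((T ^^ k) c)"
    "d \<in> G" "\<forall>k\<ge>N. word_section g (prefix_word \<xi> k) = G_act f ((T ^^ k) d)"
    unfolding is_germ_def by (elim conjE exE)
  then have "G_act f ((T ^^ max M N) c) = G_act f ((T ^^ max M N) d)"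
    by (metis max.cobounded1 max.cobounded2)
  then have "(T ^^ max M N) c = (T ^^ max M N) d"
    by (rule G_act_inj[rotated 2]) (simp_all add: \<open>c \<in> G\<close> \<open>d \<in> G\<close>)
  then show ?thesis
    by (rule inj_onD[OF bij_betw_imp_inj_on[OF bij_T_pow]]) (fact \<open>c \<in> G\<close> \<open>d \<in> G\<close>)+
qed

lemma is_germ_comp:
  assumes "g \<in> \<Gamma>" "h \<in> \<Gamma>" "is_germ g (seq_act h \<xi>) c" "is_germ h \<xi> d"
  shows "is_germ (g \<circ> h) \<xi> (d + c)"
proof -
  from assms obtain M N where
    c: "c \<in> G" "\<And>k. M \<le> k \<Longrightarrow> word_section g (prefix_word (seq_act h \<xi>) k) = G_act f ((T ^^ k) c)" and
    d: "d \<in> G" "\<And>k. N \<le> k \<Longrightarrow> word_section h (prefix_word \<xi> k) = G_act f ((T ^^ k) d)"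
    unfolding is_germ_def by auto
  have "word_section (g \<circ> h) (prefix_word \<xi> k) = G_act f ((T ^^ k) (d + c))" if "max M N \<le> k" for k
  proof -
    have "word_section (g \<circ> h) (prefix_word \<xi> k) = G_act f ((T ^^ k) c) \<circ> G_act f ((T ^^ k) d)"
      using c(2)[of k] d(2)[of k] that
      by (simp add: word_section_comp[OF assms(1,2)] prefix_seq_act[OF assms(2), symmetric])
    also have "\<dots> = G_act f ((T ^^ k) c + (T ^^ k) d)"
      by (rule ext) (simp add: G_act_add c d)
    also have "\<dots> = G_act f ((T ^^ k) (d + c))"
      using T_pow_add[OF d(1) c(1)] comm_add_vec[OF T_pow_G[OF c(1)] T_pow_G[OF d(1)]] by simp
    finally show ?thesis .
  qed
  then show ?thesis unfolding is_germ_def using c(1) d(1)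
    by (intro conjI add_carrier_vec exI[of _ "max M N"] allI impI) simp_all
qed

lemma is_germ_H: "is_germ (H_act h) \<xi> (0\<^sub>v n)"
proof -
  have "word_section (H_act h) (x # w) = id" for x w
    by (rule ext) (simp add: word_section_def)
  then have "word_section (H_act h) w = id" if "1 \<le> length w" for w
    using that by (cases w) simp_all
  then show ?thesis unfolding is_germ_def
    by (intro conjI exI[of _ 1] allI impI) (simp_all del: upt_Suc)
qed

lemma word_section_G_act_nonzero:
  assumes "g \<in> G" "Suc j < length w" "w ! j \<noteq> 0"
  shows "word_section (G_act f g) w = id"
  using assms
proof (induction w arbitrary: g j)
  case (Cons x w)
  have \<Gamma>: "G_act f g \<in> \<Gamma>" using Cons.prems nucleus_\<Gamma> by auto
  have w0: "w \<noteq> []" using Cons.prems by auto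
  consider "x = 0" | "x = - 1" | "x \<noteq> 0" "x \<noteq> - 1" by blast
  then show ?case
  proof cases
    case 1
    then obtain i where i: "j = Suc i" using Cons.prems by (cases j) auto
    have "word_section (G_act f (T g)) w = id"
      by (rule Cons.IH[of _ i]) (use Cons.prems i in simp_all)
    then show ?thesis using 1 by (simp add: word_section_Cons[OF \<Gamma>] section_at_nucleus)
  next
    case 2
    obtain y v where "w = y # v" using w0 by (cases w) auto
    then have "word_section (H_act h) w = id" for h
      by (intro ext) (simp add: word_section_def)
    then show ?thesis using 2 by (simp add: word_section_Cons[OF \<Gamma>] section_at_nucleus)
  next
    case 3
    then show ?thesis by (simp add: word_section_Cons[OF \<Gamma>] section_at_nucleus)
  qed
qed simp

lemma word_section_G_act_zeros:
  "g \<in> G \<Longrightarrow> word_section (G_act f g) (replicate k 0) = G_act f ((T ^^ k) g)"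
proof (induction k arbitrary: g)
  case (Suc k)
  then have "G_act f g \<in> \<Gamma>" using nucleus_\<Gamma> by auto
  then show ?case using Suc by (simp add: word_section_Cons section_at_nucleus funpow_swap1)
qed simp

lemma is_germ_G_nonzero:
  assumes "g \<in> G" "\<xi> j \<noteq> 0"
  shows "is_germ (G_act f g) \<xi> (0\<^sub>v n)"
proof -
  have "word_section (G_act f g) (prefix_word \<xi> k) = id" if "Suc (Suc j) \<le> k" for k
    by (rule word_section_G_act_nonzero[of _ j]) (use assms that in simp_all)
  then show ?thesis unfolding is_germ_def
    by (intro conjI exI[of _ "Suc (Suc j)"] allI impI) simp_all
qed

lemma is_germ_G_zero: "g \<in> G \<Longrightarrow> is_germ (G_act f g) (\<lambda>_. 0) g"
  unfolding is_germ_def by (simp add: word_section_G_act_zeros map_replicate_const)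

lemma is_germ_exists: "g \<in> \<Gamma> \<Longrightarrow> \<exists>c. is_germ g \<xi> c"
proof (induction arbitrary: \<xi> rule: sunic_induct)
  case (nucleus s)
  then show ?case
  proof (cases rule: nucleus_cases)
    case (H h)
    then show ?thesis using is_germ_H by auto
  next
    case (G g)
    show ?thesis
    proof (cases "\<exists>j. \<xi> j \<noteq> 0")
      case True
      then show ?thesis using is_germ_G_nonzero[OF G(1)] G(2) by auto
    next
      case False
      then have "\<xi> = (\<lambda>_. 0)" by auto
      then show ?thesis using is_germ_G_zero[OF G(1)] G(2) by auto
    qed
  qed
next
  case (comp g h)
  from comp(3)[of "seq_act h \<xi>"] comp(4)[of \<xi>] show ?case
    using is_germ_comp[OF comp(1,2)] by (elim exE) (rule exI)
qed

definition germ :: "('p mod_ring list \<Rightarrow> 'p mod_ring list) \<Rightarrow> (nat \<Rightarrow> 'p mod_ring) \<Rightarrow> 'p mod_ring vec" where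
  "germ g \<xi> = (THE c. is_germ g \<xi> c)"

lemma germ_eqI: "is_germ g \<xi> c \<Longrightarrow> germ g \<xi> = c"
  unfolding germ_def by (rule the_equality) (auto intro: is_germ_unique)

lemma is_germ_germ: "g \<in> \<Gamma> \<Longrightarrow> is_germ g \<xi> (germ g \<xi>)"
proof -
  assume "g \<in> \<Gamma>"
  from is_germ_exists[OF this, of \<xi>] obtain c where "is_germ g \<xi> c" by (elim exE)
  then show ?thesis using germ_eqI by simp
qed

lemma germ_G [simp]: "g \<in> \<Gamma> \<Longrightarrow> germ g \<xi> \<in> G"
  using is_germ_germ[of g \<xi>] by (simp add: is_germ_def)

lemma germ_comp: "g \<in> \<Gamma> \<Longrightarrow> h \<in> \<Gamma> \<Longrightarrow> germ (g \<circ> h) \<xi> = germ h \<xi> + germ g (seq_act h \<xi>)"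
  by (intro germ_eqI is_germ_comp is_germ_germ)

lemma germ_id [simp]: "germ id \<xi> = 0\<^sub>v n"
  using germ_eqI[OF is_germ_H[of 0]] by simp

abbreviation seq_Cons :: "'p mod_ring \<Rightarrow> (nat \<Rightarrow> 'p mod_ring) \<Rightarrow> nat \<Rightarrow> 'p mod_ring" where
  "seq_Cons \<equiv> case_nat"

lemma prefix_seq_Cons: "prefix_word (seq_Cons x \<xi>) (Suc k) = x # prefix_word \<xi> k"
  by (simp add: map_upt_Suc del: upt_Suc)

text \<open>
  Dropping the first letter shifts the index \<open>k\<close> by one; this is why a letter acts by the inverse of \<open>T\<close>
  on the vectors that record germs.
\<close>

lemma germ_section:
  assumes "g \<in> \<Gamma>"
  shows "germ (section_at g x) \<xi> = T (germ g (seq_Cons x \<xi>))"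
proof (rule germ_eqI)
  let ?c = "germ g (seq_Cons x \<xi>)"
  from is_germ_germ[OF assms, of "seq_Cons x \<xi>"] obtain N where
    N: "\<And>k. N \<le> k \<Longrightarrow> word_section g (prefix_word (seq_Cons x \<xi>) k) = G_act f ((T ^^ k) ?c)"
    unfolding is_germ_def by auto
  have "word_section (section_at g x) (prefix_word \<xi> k) = G_act f ((T ^^ k) (T ?c))" if "N \<le> k" for k
    using N[of "Suc k"] that word_section_Cons[OF assms, of x "prefix_word \<xi> k"]
    by (simp only: prefix_seq_Cons funpow_Suc_right comp_apply le_SucI)
  then show "is_germ (section_at g x) \<xi> (T ?c)"
    unfolding is_germ_def using assms by (intro conjI exI[of _ N] allI impI) simp_all
qed

lemma seq_act_Cons:
  assumes "g \<in> \<Gamma>"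
  shows "seq_act g (seq_Cons x \<xi>) = seq_Cons (hd (g [x])) (seq_act (section_at g x) \<xi>)"
proof
  fix i
  have "seq_act g (seq_Cons x \<xi>) i = (hd (g [x]) # section_at g x (prefix_word \<xi> i)) ! i"
    unfolding seq_act_def prefix_seq_Cons using \<Gamma>_Cons[OF assms, of x "prefix_word \<xi> i"] by (rule arg_cong)
  also have "\<dots> = seq_Cons (hd (g [x])) (seq_act (section_at g x) \<xi>) i"
    by (cases i) (simp_all add: seq_act_def del: upt_Suc)
  finally show "seq_act g (seq_Cons x \<xi>) i = seq_Cons (hd (g [x])) (seq_act (section_at g x) \<xi>) i" .
qed

lemma seq_act_id [simp]: "seq_act id \<xi> = \<xi>"
  by (rule ext) (simp add: seq_act_def del: upt_Suc)

text \<open>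
  Vectors outside \<open>G\<close> are left alone, so that \<open>shift\<close> is a bijection of the whole type and \<open>translate\<close>
  commutes with it everywhere.
\<close>

definition shift :: "'p mod_ring vec \<Rightarrow> 'p mod_ring vec" where
  "shift \<gamma> = (if \<gamma> \<in> G then T \<gamma> else \<gamma>)"

definition translate :: "'p mod_ring vec \<Rightarrow> 'p mod_ring vec \<Rightarrow> 'p mod_ring vec" where
  "translate c \<gamma> = (if \<gamma> \<in> G then \<gamma> + c else \<gamma>)"

lemma bij_shift: "bij shift"
proof -
  have "bij_betw shift G G" by (rule bij_betw_cong[THEN iffD1, OF _ bij_T]) (simp add: shift_def)
  moreover have "bij_betw shift (- G) (- G)"
    by (rule bij_betw_cong[THEN iffD1, OF _ bij_betw_id]) (simp add: shift_def)
  ultimately have "bij_betw shift (G \<union> - G) (G \<union> - G)" by (rule bij_betw_combine) simp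
  then show ?thesis by simp
qed

definition unshift :: "'p mod_ring vec \<Rightarrow> 'p mod_ring vec" where
  "unshift = inv_into UNIV shift"

lemma shift_unshift [simp]: "shift (unshift \<gamma>) = \<gamma>" "unshift (shift \<gamma>) = \<gamma>"
  unfolding unshift_def using bij_shift by (simp_all add: bij_is_surj surj_f_inv_f bij_is_inj)

lemma shift_translate: "c \<in> G \<Longrightarrow> shift (translate c \<gamma>) = translate (T c) (shift \<gamma>)"
  by (simp add: shift_def translate_def T_add)

lemma translate_unshift: "c \<in> G \<Longrightarrow> translate c (unshift \<gamma>) = unshift (translate (T c) \<gamma>)"
  using shift_translate[of c "unshift \<gamma>"] by (metis shift_unshift)

lemma translate_add: "c \<in> G \<Longrightarrow> d \<in> G \<Longrightarrow> translate d (translate c \<gamma>) = translate (c + d) \<gamma>"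
  by (simp add: translate_def assoc_add_vec[of _ n])

lemma translate_0 [simp]: "translate (0\<^sub>v n) \<gamma> = \<gamma>"
  by (simp add: translate_def)

text \<open>
  The vector \<open>\<gamma>\<close> accumulates the germs of the elements that act, so that elements with the same action
  on infinite words but different germs are told apart.
\<close>

definition grp_act :: "('p mod_ring list \<Rightarrow> 'p mod_ring list) \<Rightarrow> (nat \<Rightarrow> 'p mod_ring) \<times> 'p mod_ring vec
    \<Rightarrow> ((nat \<Rightarrow> 'p mod_ring) \<times> 'p mod_ring vec) option" where
  "grp_act g = (\<lambda>(\<xi>, \<gamma>). if g \<in> \<Gamma> then Some (seq_act g \<xi>, translate (germ g \<xi>) \<gamma>) else None)"

fun germ_act :: "'p mod_ring nek_gen \<times> bool \<Rightarrow> (nat \<Rightarrow> 'p mod_ring) \<times> 'p mod_ring vec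
    \<Rightarrow> ((nat \<Rightarrow> 'p mod_ring) \<times> 'p mod_ring vec) option" where
  "germ_act (Letter x, False) (\<xi>, \<gamma>) = Some (seq_Cons x \<xi>, unshift \<gamma>)"
| "germ_act (Letter x, True) (\<xi>, \<gamma>) = (if \<xi> 0 = x then Some (\<lambda>i. \<xi> (Suc i), shift \<gamma>) else None)"
| "germ_act (Elem g, False) b = grp_act g b"
| "germ_act (Elem g, True) b = (if g \<in> \<Gamma> then grp_act (inv_into UNIV g) b else None)"

lemma germ_act_grp [simp]: "germ_act (grp g) = grp_act g"
  by (rule ext) simp

lemma grp_act_comp: "g \<in> \<Gamma> \<Longrightarrow> h \<in> \<Gamma> \<Longrightarrow> Option.bind (grp_act h b) (grp_act g) = grp_act (g \<circ> h) b"
  by (cases b) (simp add: grp_act_def seq_act_comp germ_comp translate_add del: comp_apply)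

lemma grp_act_id [simp]: "grp_act id b = Some b"
  by (cases b) (simp add: grp_act_def)

lemma grp_act_inv: "g \<in> \<Gamma> \<Longrightarrow> grp_act (inv_into UNIV g) b = Some b' \<longleftrightarrow> grp_act g b' = Some b"
proof -
  assume g: "g \<in> \<Gamma>"
  have "inv_into UNIV g \<circ> g = id" "g \<circ> inv_into UNIV g = id"
    using bij_\<Gamma>[OF g] by (simp_all add: bij_is_inj bij_is_surj flip: surj_iff)
  then have "Option.bind (grp_act g c) (grp_act (inv_into UNIV g)) = Some c"
    "Option.bind (grp_act (inv_into UNIV g) c) (grp_act g) = Some c" for c
    using g by (simp_all only: grp_act_comp inv_\<Gamma> grp_act_id)
  then show ?thesis by (metis bind.bind_lunit)
qed

sublocale germ_rep: partial_rep germ_act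
proof
  fix s and b b' :: "(nat \<Rightarrow> 'p mod_ring) \<times> 'p mod_ring vec"
  obtain \<xi> \<gamma> \<xi>' \<gamma>' where b: "b = (\<xi>, \<gamma>)" "b' = (\<xi>', \<gamma>')" by (cases b, cases b')
  show "germ_act (s, True) b = Some b' \<longleftrightarrow> germ_act (s, False) b' = Some b"
  proof (cases s)
    case (Letter x)
    have "(\<xi> 0 = x \<and> (\<lambda>i. \<xi> (Suc i)) = \<xi>') \<longleftrightarrow> seq_Cons x \<xi>' = \<xi>"
      by (auto simp: fun_eq_iff split: nat.split)
    moreover have "shift \<gamma> = \<gamma>' \<longleftrightarrow> unshift \<gamma>' = \<gamma>"
      by (metis shift_unshift)
    ultimately show ?thesis by (auto simp: Letter b)
  next
    case (Elem g)
    then show ?thesis using grp_act_inv[of g b b'] by (cases b') (simp add: grp_act_def)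
  qed
qed

lemma germ_rep_relators:
  assumes "r \<in> (nek_relators \<Gamma> :: ('p mod_ring nek_gen, 'a::field) star_poly set)"
  shows "germ_rep.coef r b b' = 0"
proof -
  obtain \<xi> \<gamma> where b: "b = (\<xi>, \<gamma>)" by (cases b)
  have eq: "germ_rep.coef (Poly_Mapping.single v c - Poly_Mapping.single w c :: ('p mod_ring nek_gen, 'a) star_poly) b b' = 0"
    if "germ_rep.word_act v b = germ_rep.word_act w b" for v w c
    using that by (simp add: germ_rep.coef_minus germ_rep.coef_single)
  from assms consider "r = elem id - 1"
    | g where "g \<in> \<Gamma>" "r = adj (elem g) - elem (inv_into UNIV g)"
    | g h where "g \<in> \<Gamma>" "h \<in> \<Gamma>" "r = elem g * elem h - elem (g \<circ> h)"
    | g x where "g \<in> \<Gamma>" "r = elem g * letter x - letter (hd (g [x])) * elem (section_at g x)"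
    | x y where "r = adj (letter y) * letter x - (if x = y then 1 else 0)"
    | "r = (\<Sum>x\<in>UNIV. letter x * adj (letter x)) - 1"
    unfolding nek_relators_def by blast
  then show ?thesis
  proof cases
    case 1
    show ?thesis unfolding 1 gen_def one_eq_single by (rule eq) simp
  next
    case (2 g)
    show ?thesis unfolding 2 gen_def adj_single by (rule eq) (simp add: adj_word_def 2(1))
  next
    case (3 g h)
    show ?thesis unfolding 3 gen_def single_mult_single_list mult_1_left
      by (rule eq) (simp add: grp_act_comp[OF 3(1,2)] del: comp_apply)
  next
    case (4 g x)
    show ?thesis unfolding 4 gen_def single_mult_single_list mult_1_left
    proof (rule eq)
      show "germ_rep.word_act ([grp g] @ [ltr x]) b =
          germ_rep.word_act ([ltr (hd (g [x]))] @ [grp (section_at g x)]) b"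
        using 4(1) translate_unshift[OF germ_G[OF 4(1)], of "seq_Cons x \<xi>" \<gamma>]
        by (simp add: b grp_act_def seq_act_Cons germ_section)
    qed
  next
    case (5 x y)
    show ?thesis
      by (simp add: 5 gen_def adj_single adj_word_def single_mult_single_list germ_rep.coef_minus
          germ_rep.coef_single germ_rep.coef_1 b)
  next
    case 6
    have wa: "germ_rep.word_act [ltr x, ltr_adj x] b = (if \<xi> 0 = x then Some b else None)" for x
      by (auto simp: b fun_eq_iff split: nat.split)
    have "germ_rep.coef r b b' = (\<Sum>x\<in>UNIV. if germ_rep.word_act [ltr x, ltr_adj x] b = Some b' then 1 else 0)
        - (if b = b' then 1 else 0)"
      by (simp add: 6 gen_def adj_single adj_word_def single_mult_single_list germ_rep.coef_minus
          germ_rep.coef_sum germ_rep.coef_single germ_rep.coef_1 del: germ_rep.word_act.simps)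
    also have "(\<Sum>x\<in>UNIV. if germ_rep.word_act [ltr x, ltr_adj x] b = Some b' then 1 else 0 :: 'a) =
        (\<Sum>x\<in>UNIV. if x = \<xi> 0 then if b = b' then 1 else 0 else 0)"
      unfolding wa by (intro sum.cong refl) auto
    finally show ?thesis by simp
  qed
qed

end

section \<open>Simplicity and push-forwards\<close>

context sunic_algebra
begin

text \<open>
  The relations hold in the representation on germs, hence so does everything they generate.
\<close>

lemma coef_J: "a \<in> J \<Longrightarrow> germ_rep.coef a b b' = 0"
proof -
  assume a: "a \<in> J"
  let ?I = "{a \<in> carrier F. \<forall>b\<in>UNIV. \<forall>b'. germ_rep.coef a b b' = 0}"
  have "ideal ?I F" by (rule germ_rep.ideal_annihilator) simp
  moreover have "nek_relators \<Gamma> \<union> adj ` nek_relators \<Gamma> \<subseteq> ?I"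
    using relators_F by (auto simp: germ_rep_relators germ_rep.coef_adj subset_iff intro: adj_F)
  ultimately have "J \<subseteq> ?I" by (rule J_minimal)
  then have "a \<in> ?I" using a by (rule subsetD)
  then show ?thesis by (cases b; cases b') simp
qed

lemma J_proper: "J \<noteq> carrier F"
proof
  let ?b = "(\<lambda>_. 0, 0\<^sub>v n) :: (nat \<Rightarrow> 'p mod_ring) \<times> 'p mod_ring vec"
  assume "J = carrier F"
  then have "1 \<in> J" by (simp add: free_star_algebra_closed)
  from coef_J[OF this, of ?b ?b] show False by (simp add: germ_rep.coef_1)
qed

text \<open>
  These basis vectors span an invariant subspace, on which germs are always trivial.
\<close>

definition not_eventually_0 :: "((nat \<Rightarrow> 'p mod_ring) \<times> 'p mod_ring vec) set" where
  "not_eventually_0 = {(\<xi>, \<gamma>). \<forall>N. \<exists>i\<ge>N. \<xi> i \<noteq> 0}"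

lemma grp_act_not_eventually_0:
  assumes "b \<in> not_eventually_0" "grp_act g b = Some b'"
  shows "b' \<in> not_eventually_0"
proof -
  obtain \<xi> \<gamma> where b: "b = (\<xi>, \<gamma>)" by (cases b)
  have g: "g \<in> \<Gamma>" and b': "b' = (seq_act g \<xi>, translate (germ g \<xi>) \<gamma>)"
    using assms(2) by (simp_all add: b grp_act_def split: if_splits)
  have inf: "\<exists>i\<ge>N. \<xi> i \<noteq> 0" for N using assms(1) by (simp add: b not_eventually_0_def)
  obtain M where M: "\<And>i. M \<le> i \<Longrightarrow> seq_act g \<xi> i = \<xi> i" using tails[OF g, of \<xi>] by auto
  have "\<exists>i\<ge>N. seq_act g \<xi> i \<noteq> 0" for N
  proof -
    obtain i where "max M N \<le> i" "\<xi> i \<noteq> 0" using inf[of "max M N"] by auto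
    then show ?thesis using M[of i] by (intro exI[of _ i]) simp
  qed
  then show ?thesis by (simp add: b' not_eventually_0_def)
qed

lemma germ_act_not_eventually_0:
  assumes "b \<in> not_eventually_0" "germ_act s b = Some b'"
  shows "b' \<in> not_eventually_0"
proof -
  obtain \<xi> \<gamma> where b: "b = (\<xi>, \<gamma>)" by (cases b)
  have inf: "\<exists>i\<ge>N. \<xi> i \<noteq> 0" for N using assms(1) by (simp add: b not_eventually_0_def)
  consider x where "s = (Letter x, False)" | x where "s = (Letter x, True)"
    | g where "s = (Elem g, False)" | g where "s = (Elem g, True)"
    by (cases s, cases "fst s") auto
  then show ?thesis
  proof cases
    case (1 x)
    have "\<exists>i\<ge>N. seq_Cons x \<xi> i \<noteq> 0" for N
    proof -
      obtain i where "N \<le> i" "\<xi> i \<noteq> 0" using inf[of N] by auto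
      then show ?thesis by (intro exI[of _ "Suc i"]) simp
    qed
    then show ?thesis using assms(2) by (auto simp: 1 b not_eventually_0_def)
  next
    case (2 x)
    have "\<exists>i\<ge>N. \<xi> (Suc i) \<noteq> 0" for N
    proof -
      obtain i where "Suc N \<le> i" "\<xi> i \<noteq> 0" using inf[of "Suc N"] by auto
      then show ?thesis by (intro exI[of _ "i - 1"]) simp
    qed
    then show ?thesis using assms(2) by (auto simp: 2 b not_eventually_0_def split: if_splits)
  next
    case (3 g)
    then show ?thesis using grp_act_not_eventually_0[OF assms(1)] assms(2) by simp
  next
    case (4 g)
    then show ?thesis using grp_act_not_eventually_0[OF assms(1)] assms(2) by (simp split: if_splits)
  qed
qed

lemma sum_push: "(\<Sum>g\<in>G. if P ((T ^^ k) g $ (n - 1)) then \<alpha> g else 0) = (\<Sum>t\<in>UNIV. if P t then push k t \<alpha> else 0)"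
proof -
  have "(\<Sum>g\<in>G. if P ((T ^^ k) g $ (n - 1)) then \<alpha> g else 0) =
      (\<Sum>t\<in>UNIV. \<Sum>g | g \<in> G \<and> (T ^^ k) g $ (n - 1) = t. if P ((T ^^ k) g $ (n - 1)) then \<alpha> g else 0)"
    by (rule sum.group[symmetric]) simp_all
  also have "\<dots> = (\<Sum>t\<in>UNIV. if P t then push k t \<alpha> else 0)"
    unfolding push_def by (intro sum.cong refl) simp
  finally show ?thesis .
qed

lemma coef_gsum: "germ_rep.coef (gsum \<alpha>) b b' = (\<Sum>g\<in>G. if grp_act (G_act f g) b = Some b' then \<alpha> g else 0)"
  by (simp add: gsum_def germ_rep.coef_sum germ_rep.coef_single)

lemma G_act_after_zeros:
  assumes "x \<noteq> 0"
  shows "G_act f g (replicate k 0 @ x # w) =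
    replicate k 0 @ x # (if x = - 1 then H_act ((T ^^ k) g $ (n - 1)) w else w)"
proof (induction k arbitrary: g)
  case (Suc k)
  then show ?case by (simp add: G_act_Cons funpow_swap1 del: G_act.simps)
qed (use assms in \<open>simp add: G_act_Cons del: G_act.simps\<close>)

text \<open>
  Let \<open>k\<close> be the position of the first nonzero letter of \<open>\<xi>\<close>. Then the image of \<open>(\<xi>, \<gamma>)\<close> under \<open>g \<in> G\<close>
  depends on \<open>g\<close> only through \<open>t = (T\<^sup>k g)\<^sub>n\<^sub>-\<^sub>1\<close>; the matrix entries of the sum over \<open>G\<close> are therefore
  combinations of values of the \<open>k\<close>-th push-forward.
\<close>

lemma gsum_annihilates:
  assumes push0: "\<And>k t. push k t \<alpha> = 0" and b: "b \<in> not_eventually_0"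
  shows "germ_rep.coef (gsum \<alpha>) b b' = 0"
proof -
  obtain \<xi> \<gamma> where b_eq: "b = (\<xi>, \<gamma>)" by (cases b)
  have "\<exists>i. \<xi> i \<noteq> 0" using b by (auto simp: b_eq not_eventually_0_def)
  define k where "k = (LEAST i. \<xi> i \<noteq> 0)"
  have k: "\<xi> k \<noteq> 0" unfolding k_def using \<open>\<exists>i. \<xi> i \<noteq> 0\<close> by (rule LeastI_ex)
  have below: "\<xi> i = 0" if "i < k" for i using not_less_Least[of i "\<lambda>i. \<xi> i \<noteq> 0"] that unfolding k_def by auto
  \<comment> \<open>Prefixes of length \<open>i + k + 1\<close> contain the first nonzero letter for every \<open>i\<close>.\<close>
  define W where "W i = map \<xi> [Suc k..<Suc (i + k)]" for i
  define \<Phi> where "\<Phi> t i = (replicate k 0 @ \<xi> k # (if \<xi> k = - 1 then H_act t (W i) else W i)) ! i" for t i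
  have pre: "prefix_word \<xi> (Suc (i + k)) = replicate k 0 @ \<xi> k # W i" for i
  proof -
    have "[0..<Suc (i + k)] = [0..<k] @ k # [Suc k..<Suc (i + k)]"
      using upt_add_eq_append[of 0 k "Suc i"] upt_conv_Cons[of k "Suc (i + k)"] by (simp add: add.commute del: upt_Suc)
    moreover have "prefix_word \<xi> k = replicate k 0"
      by (rule nth_equalityI) (simp_all add: below)
    ultimately show ?thesis by (simp add: W_def del: upt_Suc)
  qed
  have act: "grp_act (G_act f g) b = Some (\<Phi> ((T ^^ k) g $ (n - 1)), \<gamma>)" if g: "g \<in> G" for g
  proof -
    have \<Gamma>: "G_act f g \<in> \<Gamma>" by (rule G_\<Gamma>[OF g])
    have "seq_act (G_act f g) \<xi> i = \<Phi> ((T ^^ k) g $ (n - 1)) i" for i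
    proof -
      have "seq_act (G_act f g) \<xi> i = G_act f g (prefix_word \<xi> (Suc (i + k))) ! i"
        unfolding seq_act_def by (rule nth_prefix_stable[OF \<Gamma>, symmetric]) simp
      then show ?thesis unfolding pre G_act_after_zeros[OF k] \<Phi>_def .
    qed
    moreover have "germ (G_act f g) \<xi> = 0\<^sub>v n" by (rule germ_eqI[OF is_germ_G_nonzero[of g \<xi> k, OF g k]])
    ultimately show ?thesis using \<Gamma> by (simp add: b_eq grp_act_def fun_eq_iff)
  qed
  have "germ_rep.coef (gsum \<alpha>) b b' =
      (\<Sum>g\<in>G. if Some (\<Phi> ((T ^^ k) g $ (n - 1)), \<gamma>) = Some b' then \<alpha> g else 0)"
    unfolding coef_gsum by (intro sum.cong refl) (simp add: act)
  also have "\<dots> = (\<Sum>t\<in>UNIV. if Some (\<Phi> t, \<gamma>) = Some b' then push k t \<alpha> else 0)"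
    by (rule sum_push)
  also have "\<dots> = 0" unfolding push0 by simp
  finally show ?thesis .
qed

text \<open>
  At \<open>0\<^sup>\<infinity>\<close> the germ of \<open>g \<in> G\<close> is \<open>g\<close> itself, so the coefficients \<open>\<alpha>(g)\<close> are matrix entries.
\<close>

lemma gsum_not_in_J:
  assumes g0: "g0 \<in> G" "\<alpha> g0 \<noteq> 0"
  shows "gsum \<alpha> \<notin> J"
proof
  assume "gsum \<alpha> \<in> J"
  let ?z = "\<lambda>_::nat. 0 :: 'p mod_ring"
  have act: "grp_act (G_act f g) (?z, 0\<^sub>v n) = Some (?z, g)" if g: "g \<in> G" for g
  proof -
    have "seq_act (G_act f g) ?z i = 0" for i
    proof -
      have "G_act f g (prefix_word ?z (Suc i)) ! i = prefix_word ?z (Suc i) ! i"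
        by (rule nth_G_act) (simp_all del: upt_Suc)
      then show ?thesis by (simp add: seq_act_def del: upt_Suc)
    qed
    then have "seq_act (G_act f g) ?z = ?z" by (rule ext)
    moreover have "germ (G_act f g) ?z = g" by (rule germ_eqI[OF is_germ_G_zero[OF g]])
    ultimately show ?thesis using g G_\<Gamma>[OF g] by (simp add: grp_act_def translate_def)
  qed
  have "germ_rep.coef (gsum \<alpha>) (?z, 0\<^sub>v n) (?z, g0) = (\<Sum>g\<in>G. if g = g0 then \<alpha> g else 0)"
    unfolding coef_gsum by (intro sum.cong refl) (simp add: act)
  also have "\<dots> = \<alpha> g0" using g0 by simp
  finally show False using coef_J[OF \<open>gsum \<alpha> \<in> J\<close>] g0 by simp
qed

text \<open>
  If the push-forwards are not injective, the annihilator of \<open>not_eventually_0\<close> is an ideal strictly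
  between \<open>J\<close> and the whole algebra.
\<close>

lemma simple_quotient_iff_push_injective:
  "simple_ring (nekrashevych_algebra TYPE('k) \<Gamma>) \<longleftrightarrow>
    (\<forall>\<alpha> :: 'p mod_ring vec \<Rightarrow> 'k. (\<forall>k t. push k t \<alpha> = 0) \<longrightarrow> (\<forall>g\<in>G. \<alpha> g = 0))"
  unfolding nekrashevych_algebra_eq ring.simple_ring_quotient_iff[OF ring_free_star_algebra ideal_J]
proof (intro iffI allI impI conjI J_proper)
  fix \<alpha> :: "'p mod_ring vec \<Rightarrow> 'k"
  assume simple: "J \<noteq> carrier F \<and> (\<forall>I. ideal I F \<longrightarrow> J \<subseteq> I \<longrightarrow> I = J \<or> I = carrier F)"
    and push0: "\<forall>k t. push k t \<alpha> = 0"
  let ?I = "{a \<in> carrier F. \<forall>b\<in>not_eventually_0. \<forall>b'. germ_rep.coef a b b' = 0}"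
  have "ideal ?I F"
    by (rule germ_rep.ideal_annihilator) (rule germ_act_not_eventually_0)
  moreover have "J \<subseteq> ?I" using J_rules(1) coef_J by (simp add: subset_iff)
  ultimately have "?I = J \<or> ?I = carrier F" using simple by simp
  moreover have proper: "?I \<noteq> carrier F"
  proof
    let ?b = "(\<lambda>_. 1, 0\<^sub>v n) :: (nat \<Rightarrow> 'p mod_ring) \<times> 'p mod_ring vec"
    assume "?I = carrier F"
    then have "1 \<in> ?I" by (simp add: free_star_algebra_closed)
    moreover have "?b \<in> not_eventually_0" by (auto simp: not_eventually_0_def)
    ultimately have "germ_rep.coef (1 :: ('p mod_ring nek_gen, 'k) star_poly) ?b ?b = 0" by simp
    then show False by (simp add: germ_rep.coef_1)
  qed
  ultimately have eq: "?I = J" by argo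
  have "gsum \<alpha> \<in> ?I" using gsum_F gsum_annihilates[of \<alpha>] push0 by simp
  then have "gsum \<alpha> \<in> J" unfolding eq .
  then show "\<forall>g\<in>G. \<alpha> g = 0" using gsum_not_in_J by blast
next
  fix I assume inj: "\<forall>\<alpha> :: 'p mod_ring vec \<Rightarrow> 'k. (\<forall>k t. push k t \<alpha> = 0) \<longrightarrow> (\<forall>g\<in>G. \<alpha> g = 0)"
    and I: "ideal I F" "J \<subseteq> I"
  show "I = J \<or> I = carrier F"
  proof (cases "I = J")
    case False
    have "I = carrier F"
      by (rule ideal_trivial_if_push_injective[OF _ I False]) (use inj in simp)
    then show ?thesis ..
  qed simp
qed

end

context sunic
begin

theorem simple_iff_push_injective:
  "simple_ring (nekrashevych_algebra TYPE('k::field) \<Gamma>) \<longleftrightarrow>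
    (\<forall>\<alpha> :: 'p mod_ring vec \<Rightarrow> 'k. (\<forall>k t. push k t \<alpha> = 0) \<longrightarrow> (\<forall>g\<in>G. \<alpha> g = 0))"
proof -
  interpret sunic_algebra f "Idl\<^bsub>free_star_algebra (nek_gens \<Gamma>)\<^esub> (nek_relators \<Gamma> \<union> adj ` nek_relators \<Gamma>)
      :: ('p mod_ring nek_gen, 'k) star_poly set"
    by unfold_locales (rule refl)
  show ?thesis by (rule simple_quotient_iff_push_injective)
qed

end

section \<open>The orbit of the last coordinate functional\<close>

lemma vec_mat_mult_eq_transpose:
  "A \<in> carrier_mat m m \<Longrightarrow> v \<in> carrier_vec m \<Longrightarrow> v \<^sub>v* (A :: 'a::comm_ring_1 mat) = transpose_mat A *\<^sub>v v"
  unfolding vec_mat_mult_def mult_mat_vec_def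
  by (rule eq_vecI) (simp_all add: comm_scalar_prod[of _ m])

lemma vec_mat_mult_closed: "A \<in> carrier_mat m m \<Longrightarrow> v \<in> carrier_vec m \<Longrightarrow> v \<^sub>v* A \<in> carrier_vec m"
  by (simp add: vec_mat_mult_def)

lemma vec_mat_mult_scalar_prod:
  assumes "(A :: 'a::comm_ring_1 mat) \<in> carrier_mat m m" "v \<in> carrier_vec m" "g \<in> carrier_vec m"
  shows "(v \<^sub>v* A) \<bullet> g = v \<bullet> (A *\<^sub>v g)"
  unfolding vec_mat_mult_eq_transpose[OF assms(1,2)]
  by (rule transpose_vec_mult_scalar[OF assms(1,3,2)])

lemma vec_mat_mult_smult:
  assumes "(A :: 'a::field mat) \<in> carrier_mat m m" "v \<in> carrier_vec m"
  shows "(c \<cdot>\<^sub>v v) \<^sub>v* A = c \<cdot>\<^sub>v (v \<^sub>v* A)"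
  using assms by (simp add: vec_mat_mult_eq_transpose[of _ m] mult_mat_vec[of _ m m])

lemma vec_mat_mult_assoc:
  assumes "(A :: 'a::comm_ring_1 mat) \<in> carrier_mat m m" "B \<in> carrier_mat m m" "v \<in> carrier_vec m"
  shows "v \<^sub>v* (A * B) = (v \<^sub>v* A) \<^sub>v* B"
proof -
  have "v \<^sub>v* (A * B) = transpose_mat (A * B) *\<^sub>v v"
    by (rule vec_mat_mult_eq_transpose) (use assms in simp_all)
  also have "\<dots> = transpose_mat B *\<^sub>v (transpose_mat A *\<^sub>v v)"
    unfolding transpose_mult[OF assms(1,2)]
    by (rule assoc_mult_mat_vec[of _ m m]) (use assms in simp_all)
  also have "\<dots> = (v \<^sub>v* A) \<^sub>v* B"
    using assms by (simp add: vec_mat_mult_eq_transpose[of _ m])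
  finally show ?thesis .
qed

lemma vec_mat_mult_one: "v \<in> carrier_vec m \<Longrightarrow> v \<^sub>v* 1\<^sub>m m = (v :: 'a::comm_ring_1 vec)"
  by (simp add: vec_mat_mult_eq_transpose[of _ m])

lemma finite_carrier_mat: "finite (carrier_mat m m :: 'a::finite mat set)"
proof -
  have "carrier_mat m m \<subseteq> mat_of_cols m ` {xs :: 'a vec list. set xs \<subseteq> carrier_vec m \<and> length xs = m}"
  proof
    fix A :: "'a mat" assume A: "A \<in> carrier_mat m m"
    then have mem: "cols A \<in> {xs. set xs \<subseteq> carrier_vec m \<and> length xs = m}"
      by (auto simp: cols_def)
    have "A = mat_of_cols m (cols A)" using A mat_of_cols_cols[of A] by simp
    then show "A \<in> mat_of_cols m ` {xs. set xs \<subseteq> carrier_vec m \<and> length xs = m}" using mem by (rule image_eqI)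
  qed
  then show ?thesis
    by (rule finite_subset) (intro finite_imageI finite_lists_length_eq finite_carrier_vec)
qed

lemma card_translate:
  assumes "v0 \<in> carrier_vec m"
  shows "card {v \<in> carrier_vec m. Q (v + v0)} = card {v \<in> carrier_vec m. Q (v :: 'a::ring vec)}"
proof (rule bij_betw_same_card)
  show "bij_betw (\<lambda>v. v + v0) {v \<in> carrier_vec m. Q (v + v0)} {v \<in> carrier_vec m. Q v}"
  proof (rule bij_betw_byWitness[where f' = "\<lambda>v. v - v0"])
    have [simp]: "v + v0 - v0 = v" "v - v0 + v0 = v" if "v \<in> carrier_vec m" for v
      using that assms by (auto)
    show "\<forall>v\<in>{v \<in> carrier_vec m. Q (v + v0)}. v + v0 - v0 = v"
      "\<forall>v\<in>{v \<in> carrier_vec m. Q v}. v - v0 + v0 = v"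
      "(\<lambda>v. v + v0) ` {v \<in> carrier_vec m. Q (v + v0)} \<subseteq> {v \<in> carrier_vec m. Q v}"
      "(\<lambda>v. v - v0) ` {v \<in> carrier_vec m. Q v} \<subseteq> {v \<in> carrier_vec m. Q (v + v0)}"
      using assms by auto
  qed
qed

context sunic
begin

text \<open>
  The row vector of the functional \<open>g \<mapsto> (T\<^sup>k g)\<^sub>n\<^sub>-\<^sub>1\<close>, in the orbit of the last unit vector under
  right multiplication by the companion matrix.
\<close>

definition orbit_row :: "nat \<Rightarrow> 'p mod_ring vec" where
  "orbit_row k = ((\<lambda>v. v \<^sub>v* companion f) ^^ k) (unit_vec n (n - 1))"

lemma vec_mat_pow_G: "v \<in> G \<Longrightarrow> ((\<lambda>v. v \<^sub>v* companion f) ^^ k) v \<in> G"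
  by (induction k) (simp_all add: vec_mat_mult_closed[OF companion_carrier])

lemma orbit_row_G [simp]: "orbit_row k \<in> G"
  unfolding orbit_row_def by (rule vec_mat_pow_G) simp

lemma dim_orbit_row [simp]: "dim_vec (orbit_row k) = n"
  by (rule carrier_vecD[OF orbit_row_G])

lemma zero_smult_orbit_row [simp]: "0 \<cdot>\<^sub>v orbit_row k = 0\<^sub>v n"
  by (rule eq_vecI) simp_all

lemma vec_mat_pow_scalar_prod:
  "v \<in> G \<Longrightarrow> g \<in> G \<Longrightarrow> ((\<lambda>v. v \<^sub>v* companion f) ^^ k) v \<bullet> g = v \<bullet> (T ^^ k) g"
proof (induction k arbitrary: g)
  case (Suc k)
  then show ?case
    using vec_mat_mult_scalar_prod[OF companion_carrier vec_mat_pow_G[OF Suc.prems(1)] Suc.prems(2)]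
    by (simp add: funpow_swap1)
qed simp

lemma orbit_row_scalar_prod: "g \<in> G \<Longrightarrow> orbit_row k \<bullet> g = (T ^^ k) g $ (n - 1)"
  unfolding orbit_row_def using n_pos by (simp add: vec_mat_pow_scalar_prod)

lemma push_eq: "push k t \<alpha> = (\<Sum>g | g \<in> G \<and> orbit_row k \<bullet> g = t. \<alpha> g)"
  unfolding push_def by (intro sum.cong) (auto simp: orbit_row_scalar_prod)

lemma orbit_row_dual: "\<exists>e\<in>G. orbit_row k \<bullet> e = 1"
proof -
  \<comment> \<open>\<open>T\<close> is onto, so some \<open>T\<^sup>k e\<close> is the last unit vector.\<close>
  have "unit_vec n (n - 1) \<in> (T ^^ k) ` G"
    using bij_T_pow[of k] by (simp add: bij_betw_def)
  then obtain e where e: "e \<in> G" "unit_vec n (n - 1) = (T ^^ k) e" by (elim imageE)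
  have "orbit_row k \<bullet> e = unit_vec n (n - 1) $ (n - 1)" unfolding orbit_row_scalar_prod[OF e(1)] e(2)[symmetric] ..
  then show ?thesis using e(1) n_pos by (intro bexI[of _ e]) simp_all
qed

abbreviation GL where "GL \<equiv> units_of (ring_mat TYPE('p mod_ring) n ())"

lemma companion_Units: "companion f \<in> Units (ring_mat TYPE('p mod_ring) n ())"
proof (rule det_non_zero_imp_unit[OF companion_carrier])
  show "det (companion f) \<noteq> 0"
    unfolding det_0_iff_vec_prod_zero[OF companion_carrier] using T_eq_0 by blast
qed

lemma group_GL: "group GL"
  by (intro monoid.units_group ring.is_monoid[OF ring_mat])

lemma carrier_GL: "carrier GL = Units (ring_mat TYPE('p mod_ring) n ())"
  by (simp add: units_of_def)

lemma GL_mat: "A \<in> carrier GL \<Longrightarrow> A \<in> carrier_mat n n"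
  by (simp add: carrier_GL Units_def ring_mat_simps)

lemma finite_GL: "finite (carrier GL)"
  by (rule finite_subset[OF _ finite_carrier_mat[of n]]) (use GL_mat in blast)

lemma companion_GL: "companion f \<in> carrier GL"
  by (simp add: carrier_GL companion_Units)

lemma companion_pow:
  "companion f [^]\<^bsub>GL\<^esub> k \<in> carrier GL \<and> (\<forall>v\<in>G. v \<^sub>v* (companion f [^]\<^bsub>GL\<^esub> (k::nat)) = ((\<lambda>v. v \<^sub>v* companion f) ^^ k) v)"
proof (induction k)
  case 0
  have "\<one>\<^bsub>GL\<^esub> = 1\<^sub>m n" by (simp add: units_of_def ring_mat_simps)
  then show ?case using group.is_monoid[OF group_GL] monoid.one_closed[OF group.is_monoid[OF group_GL]]
    by (simp add: vec_mat_mult_one)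
next
  case (Suc k)
  let ?A = "companion f [^]\<^bsub>GL\<^esub> k"
  have eq: "companion f [^]\<^bsub>GL\<^esub> Suc k = ?A * companion f"
    by (simp add: units_of_def ring_mat_simps)
  have "companion f [^]\<^bsub>GL\<^esub> Suc k \<in> carrier GL"
    using monoid.nat_pow_closed[OF group.is_monoid[OF group_GL] companion_GL] .
  moreover have "v \<^sub>v* (?A * companion f) = ((\<lambda>v. v \<^sub>v* companion f) ^^ Suc k) v" if "v \<in> G" for v
    using Suc that vec_mat_mult_assoc[OF GL_mat companion_carrier that, of ?A] by simp
  ultimately show ?case unfolding eq by simp
qed

lemma generate_companion:
  "generate GL {companion f} = range (\<lambda>k::nat. companion f [^]\<^bsub>GL\<^esub> k)"
  using group.generate_pow_on_finite_carrier[OF group_GL finite_GL companion_GL] by auto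

lemma vec_mat_pow_order: "v \<in> G \<Longrightarrow> ((\<lambda>v. v \<^sub>v* companion f) ^^ (Coset.order GL)) v = v"
  using companion_pow[of "Coset.order GL"] group.pow_order_eq_1[OF group_GL companion_GL]
  by (simp add: units_of_def ring_mat_simps vec_mat_mult_one)

lemma vec_mat_pow_order_mult: "v \<in> G \<Longrightarrow> ((\<lambda>v. v \<^sub>v* companion f) ^^ (Coset.order GL * j)) v = v"
proof (induction j)
  case (Suc j)
  then show ?case using vec_mat_pow_order[of v] by (simp add: funpow_add)
qed simp

lemma order_GL_pos: "0 < Coset.order GL"
  using finite_GL monoid.one_closed[OF group.is_monoid[OF group_GL]]
  unfolding Coset.order_def by (auto simp: card_gt_0_iff)

lemma vec_mat_pow_smult:
  "v \<in> G \<Longrightarrow> ((\<lambda>v. v \<^sub>v* companion f) ^^ k) (c \<cdot>\<^sub>v v) = c \<cdot>\<^sub>v ((\<lambda>v. v \<^sub>v* companion f) ^^ k) v"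
  by (induction k) (simp_all add: vec_mat_mult_smult[OF companion_carrier] vec_mat_pow_G)

text \<open>
  The line of the last unit vector is moved onto every line. Powers with nonnegative exponents suffice,
  because the general linear group over a finite field is finite.
\<close>

lemma transitive_iff:
  "acts_transitively_on_lines n (companion f) \<longleftrightarrow> (\<forall>v\<in>G. v \<noteq> 0\<^sub>v n \<longrightarrow> (\<exists>k c. v = c \<cdot>\<^sub>v orbit_row k))"
proof (intro iffI ballI impI)
  fix v assume trans: "acts_transitively_on_lines n (companion f)" and v: "v \<in> G" "v \<noteq> 0\<^sub>v n"
  let ?e = "unit_vec n (n - 1) :: 'p mod_ring vec"
  let ?line = "\<lambda>u :: 'p mod_ring vec. {c \<cdot>\<^sub>v u | c. True}"
  have e: "?e \<in> G" "?e \<noteq> 0\<^sub>v n" using orbit_row_dual[of 0] by (auto simp: orbit_row_def)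
  have "?line ?e \<in> projective_space TYPE('p mod_ring) n" "?line v \<in> projective_space TYPE('p mod_ring) n"
    unfolding projective_space_def using v e by blast+
  with trans obtain A where A: "A \<in> generate GL {companion f}" "(\<lambda>v. v \<^sub>v* A) ` ?line ?e = ?line v"
    unfolding acts_transitively_on_lines_def by blast
  from A(1) obtain k :: nat where k: "A = companion f [^]\<^bsub>GL\<^esub> k" unfolding generate_companion by auto
  have "1 \<cdot>\<^sub>v v \<in> ?line v" by blast
  then have "v \<in> (\<lambda>v. v \<^sub>v* A) ` ?line ?e" unfolding A(2) by simp
  then obtain c where c: "v = (c \<cdot>\<^sub>v ?e) \<^sub>v* A" by auto
  also have "\<dots> = c \<cdot>\<^sub>v orbit_row k"
    using companion_pow[of k] vec_mat_pow_smult[OF e(1), of k c] by (simp add: k orbit_row_def)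
  finally show "\<exists>k c. v = c \<cdot>\<^sub>v orbit_row k" by blast
next
  assume all: "\<forall>v\<in>G. v \<noteq> 0\<^sub>v n \<longrightarrow> (\<exists>k c. v = c \<cdot>\<^sub>v orbit_row k)"
  show "acts_transitively_on_lines n (companion f)"
    unfolding acts_transitively_on_lines_def
  proof (intro ballI)
    fix L L' assume L: "L \<in> projective_space TYPE('p mod_ring) n" and L': "L' \<in> projective_space TYPE('p mod_ring) n"
    from L obtain u where u: "L = {c \<cdot>\<^sub>v u | c. True}" "u \<in> G" "u \<noteq> 0\<^sub>v n"
      unfolding projective_space_def by blast
    from L' obtain v where v: "L' = {c \<cdot>\<^sub>v v | c. True}" "v \<in> G" "v \<noteq> 0\<^sub>v n"
      unfolding projective_space_def by blast
    from all u obtain k c where c: "u = c \<cdot>\<^sub>v orbit_row k" by blast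
    from all v obtain l d where d: "v = d \<cdot>\<^sub>v orbit_row l" by blast
    have cd: "c \<noteq> 0" "d \<noteq> 0" using u v c d by auto
    \<comment> \<open>The exponent \<open>l - k\<close> modulo the order of \<open>GL\<close>.\<close>
    define j where "j = l + (Coset.order GL * k - k)"
    have "Suc 0 * k \<le> Coset.order GL * k"
      using order_GL_pos by (intro mult_le_mono1) (rule Suc_leI)
    then have jk: "j + k = l + Coset.order GL * k" unfolding j_def by linarith
    let ?S = "\<lambda>v. v \<^sub>v* companion f"
    have "(?S ^^ j) (orbit_row k) = (?S ^^ (j + k)) (unit_vec n (n - 1))"
      by (simp add: orbit_row_def funpow_add)
    also have "\<dots> = orbit_row l" unfolding jk by (simp add: funpow_add orbit_row_def vec_mat_pow_order_mult)
    finally have step: "(?S ^^ j) (orbit_row k) = orbit_row l" .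
    let ?A = "companion f [^]\<^bsub>GL\<^esub> j"
    have img: "(a \<cdot>\<^sub>v u) \<^sub>v* ?A = (a * c / d) \<cdot>\<^sub>v v" for a
    proof -
      have "(a \<cdot>\<^sub>v u) \<^sub>v* ?A = (?S ^^ j) ((a * c) \<cdot>\<^sub>v orbit_row k)"
        using companion_pow[of j] u by (simp add: c smult_smult_assoc)
      also have "\<dots> = (a * c) \<cdot>\<^sub>v orbit_row l" by (simp add: vec_mat_pow_smult step)
      finally show ?thesis using cd by (simp add: d smult_smult_assoc)
    qed
    have "(\<lambda>v. v \<^sub>v* ?A) ` L = L'"
    proof (intro equalityI subsetI)
      fix x assume "x \<in> (\<lambda>v. v \<^sub>v* ?A) ` L"
      then show "x \<in> L'" unfolding u(1) v(1) using img by auto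
    next
      fix x assume "x \<in> L'"
      then obtain a where "x = a \<cdot>\<^sub>v v" unfolding v(1) by auto
      then have "x = ((a * d / c) \<cdot>\<^sub>v u) \<^sub>v* ?A" using img[of "a * d / c"] cd by simp
      then show "x \<in> (\<lambda>v. v \<^sub>v* ?A) ` L" unfolding u(1) by blast
    qed
    then show "\<exists>A\<in>generate GL {companion f}. (\<lambda>v. v \<^sub>v* A) ` L = L'"
      unfolding generate_companion by (intro bexI[of _ ?A]) simp_all
  qed
qed

section \<open>Injectivity of the push-forwards\<close>

lemma push_injective_degree_1:
  assumes "n = 1" "\<And>k t. push k t \<alpha> = (0 :: 'k::field)" "g \<in> G"
  shows "\<alpha> g = 0"
proof -
  have "{h. h \<in> G \<and> (T ^^ 0) h $ (n - 1) = g $ 0} = {g}"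
    using assms(1,3) by (auto)
  then have "push 0 (g $ 0) \<alpha> = \<alpha> g" unfolding push_def by simp
  then show ?thesis using assms(2) by simp
qed

text \<open>
  All fibres of a nonzero functional have the same cardinality \<open>p\<^sup>n\<^sup>-\<^sup>1\<close>, which \<open>p\<close> divides for \<open>n \<ge> 2\<close>.
\<close>

lemma push_constant_char_p:
  assumes "n \<noteq> 1" "CHAR('k::field) = CARD('p)"
  shows "push k t (\<lambda>_. 1 :: 'k) = 0"
proof -
  obtain e where e: "e \<in> G" "orbit_row k \<bullet> e = 1" using orbit_row_dual by blast
  let ?fib = "\<lambda>t. {g \<in> G. orbit_row k \<bullet> g = t}"
  have fib: "card (?fib s) = card (?fib t)" for s
  proof -
    have "card {g \<in> G. orbit_row k \<bullet> (g + (t - s) \<cdot>\<^sub>v e) = t} = card (?fib t)"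
      by (rule card_translate) (simp add: e)
    moreover have "{g \<in> G. orbit_row k \<bullet> (g + (t - s) \<cdot>\<^sub>v e) = t} = ?fib s"
      using e by (auto simp: scalar_prod_add_distrib[of _ n] algebra_simps)
    ultimately show ?thesis by simp
  qed
  have "CARD('p) ^ n = card G" by (simp add: card_carrier_vec)
  also have "\<dots> = (\<Sum>s\<in>UNIV. card (?fib s))"
    using sum.group[of G UNIV "\<lambda>g. orbit_row k \<bullet> g" "\<lambda>_. 1 :: nat"] by simp
  also have "\<dots> = (\<Sum>s\<in>(UNIV :: 'p mod_ring set). card (?fib t))"
    by (rule sum.cong[OF refl fib])
  also have "\<dots> = CARD('p) * card (?fib t)" by simp
  finally have "CARD('p) ^ (n - 1) = card (?fib t)"
    using n_pos by (cases n) simp_all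
  then have "CARD('p) dvd card (?fib t)"
    using assms(1) n_pos by (metis dvd_power le_neq_implies_less One_nat_def Suc_leI zero_less_diff)
  then have "of_nat (card (?fib t)) = (0 :: 'k)" by (simp add: of_nat_eq_0_iff_char_dvd assms(2))
  then show ?thesis by (simp add: push_eq)
qed

text \<open>
  By transitivity the push-forwards along all functionals \<open>v\<close> vanish. Radon inversion: for a fixed \<open>g\<close>,
  sum over all \<open>v\<close> the value of the push-forward at \<open>v g\<close> minus its value at \<open>v g + 1\<close>. For \<open>h \<noteq> g\<close> as many
  \<open>v\<close> satisfy \<open>v (h - g) = 0\<close> as \<open>v (h - g) = 1\<close>, so \<open>\<alpha>(h)\<close> cancels, while \<open>\<alpha>(g)\<close> is counted \<open>p\<^sup>n\<close> times.
\<close>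

lemma push_injective_if_transitive:
  assumes trans: "\<And>v. v \<in> G \<Longrightarrow> v \<noteq> 0\<^sub>v n \<Longrightarrow> \<exists>k c. v = c \<cdot>\<^sub>v orbit_row k"
    and char: "CHAR('k::field) \<noteq> CARD('p)"
    and push0: "\<And>k t. push k t \<alpha> = (0 :: 'k)" and g: "g \<in> G"
  shows "\<alpha> g = 0"
proof -
  have fib0: "(\<Sum>h\<in>G. if v \<bullet> h = t then \<alpha> h else 0) = 0" if v: "v \<in> G" for v t
  proof (cases "v = 0\<^sub>v n")
    case True
    have "(\<Sum>h\<in>G. \<alpha> h) = (\<Sum>s\<in>UNIV. push 0 s \<alpha>)"
      unfolding push_eq using sum.group[of G UNIV "\<lambda>g. orbit_row 0 \<bullet> g" \<alpha>] by simp
    then have "(\<Sum>h\<in>G. \<alpha> h) = 0" by (simp add: push0)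
    moreover have "(\<Sum>h\<in>G. if v \<bullet> h = t then \<alpha> h else 0) = (\<Sum>h\<in>G. if 0 = t then \<alpha> h else 0)"
      using True by (intro sum.cong refl) simp
    ultimately show ?thesis by (cases "0 = t") simp_all
  next
    case False
    from trans[OF v False] obtain k c where c: "v = c \<cdot>\<^sub>v orbit_row k" by blast
    with False have "c \<noteq> 0" by auto
    have "(\<Sum>h\<in>G. if v \<bullet> h = t then \<alpha> h else 0) = (\<Sum>h\<in>G. if orbit_row k \<bullet> h = t / c then \<alpha> h else 0)"
      using \<open>c \<noteq> 0\<close> by (intro sum.cong refl if_cong) (auto simp: c field_simps)
    also have "\<dots> = push k (t / c) \<alpha>" unfolding push_eq by (rule sum.inter_filter[symmetric]) simp
    finally show ?thesis by (simp add: push0)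
  qed
  let ?N = "\<lambda>t d. \<Sum>v\<in>G. if v \<bullet> d = t then 1 else 0 :: 'k"
  have N: "?N t d = of_nat (card {v \<in> G. v \<bullet> d = t})" for t d
    by (simp add: sum.inter_filter[symmetric])
  have N_eq: "?N 0 d = ?N 1 d" if d: "d \<in> G" "d \<noteq> 0\<^sub>v n" for d
  proof -
    have "\<exists>i<n. d $ i \<noteq> 0"
    proof (rule ccontr)
      assume "\<not> ?thesis"
      then have "d = 0\<^sub>v n" using d by (intro eq_vecI) auto
      then show False using d by simp
    qed
    then obtain i where i: "i < n" "d $ i \<noteq> 0" by blast
    define v0 where "v0 = (1 / d $ i) \<cdot>\<^sub>v unit_vec n i"
    have v0: "v0 \<in> G" "v0 \<bullet> d = 1" using i d by (simp_all add: v0_def smult_scalar_prod_distrib[of _ n])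
    have "card {v \<in> G. (v + v0) \<bullet> d = 1} = card {v \<in> G. v \<bullet> d = 1}"
      by (rule card_translate[OF v0(1)])
    moreover have "{v \<in> G. (v + v0) \<bullet> d = 1} = {v \<in> G. v \<bullet> d = 0}"
      using v0 d by (auto simp: add_scalar_prod_distrib[of _ n])
    ultimately show ?thesis unfolding N by simp
  qed
  have "0 = (\<Sum>v\<in>G. (\<Sum>h\<in>G. if v \<bullet> h = v \<bullet> g then \<alpha> h else 0) - (\<Sum>h\<in>G. if v \<bullet> h = v \<bullet> g + 1 then \<alpha> h else 0))"
    by (simp add: fib0)
  also have "\<dots> = (\<Sum>v\<in>G. \<Sum>h\<in>G. \<alpha> h * ((if v \<bullet> (h - g) = 0 then 1 else 0) - (if v \<bullet> (h - g) = 1 then 1 else 0)))"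
    unfolding sum_subtractf[symmetric] using g
    by (intro sum.cong refl) (auto simp: scalar_prod_minus_distrib[of _ n] algebra_simps)
  also have "\<dots> = (\<Sum>h\<in>G. \<alpha> h * (?N 0 (h - g) - ?N 1 (h - g)))"
    by (subst sum.swap) (simp add: sum_distrib_left sum_subtractf right_diff_distrib)
  also have "\<dots> = (\<Sum>h\<in>G. if h = g then \<alpha> h * of_nat (CARD('p) ^ n) else 0)"
  proof (intro sum.cong refl)
    fix h assume h: "h \<in> G"
    show "\<alpha> h * (?N 0 (h - g) - ?N 1 (h - g)) = (if h = g then \<alpha> h * of_nat (CARD('p) ^ n) else 0)"
    proof (cases "h = g")
      case True
      then have "h - g = 0\<^sub>v n" using g by simp
      then show ?thesis using True by (simp add: card_carrier_vec)
    next
      case False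
      have "h - g \<noteq> 0\<^sub>v n"
      proof
        assume z: "h - g = 0\<^sub>v n"
        have "h $ i = g $ i" if "i < n" for i
          using arg_cong[OF z, of "\<lambda>v. v $ i"] g h that by simp
        then have "h = g" using g h by (intro eq_vecI) auto
        with False show False by simp
      qed
      then show ?thesis using N_eq[of "h - g"] g h False by simp
    qed
  qed
  also have "\<dots> = \<alpha> g * of_nat (CARD('p) ^ n)" using g by simp
  finally have "\<alpha> g = 0 \<or> of_nat (CARD('p)) = (0 :: 'k)" by auto
  moreover have "of_nat (CARD('p)) \<noteq> (0 :: 'k)"
  proof
    assume "of_nat (CARD('p)) = (0 :: 'k)"
    then have "CHAR('k) dvd CARD('p)" by (simp add: of_nat_eq_0_iff_char_dvd)
    moreover have "prime (CARD('p))" by (rule prime_card)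
    ultimately have "CHAR('k) = 1" using char by (auto simp: prime_nat_iff)
    then have "of_nat 1 = (0 :: 'k)" unfolding of_nat_eq_0_iff_char_dvd by simp
    then show False by simp
  qed
  ultimately show ?thesis by simp
qed

text \<open>
  A functional \<open>m\<close> that is not a multiple of \<open>\<ell>\<^sub>k\<close> does not vanish on the kernel of \<open>\<ell>\<^sub>k\<close>. A vector \<open>g\<^sub>0\<close>
  in that kernel with \<open>m g\<^sub>0 = 1\<close> translates the part of a fibre of \<open>\<ell>\<^sub>k\<close> with \<open>m = 0\<close> onto the part with
  \<open>m = 1\<close>.
\<close>

lemma push_not_injective_if_not_transitive:
  assumes m: "m \<in> G" and not_prop: "\<And>k c. m \<noteq> c \<cdot>\<^sub>v orbit_row k"
  shows "push k t (\<lambda>g. (if m \<bullet> g = 0 then 1 else 0) - (if m \<bullet> g = 1 then 1 else 0 :: 'k::field)) = 0"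
proof -
  obtain e where e: "e \<in> G" "orbit_row k \<bullet> e = 1" using orbit_row_dual by blast
  \<comment> \<open>\<open>d\<close> is \<open>m\<close> minus a multiple of \<open>\<ell>\<^sub>k\<close> and kills \<open>e\<close>; \<open>w\<close> is a unit vector projected to the kernel of
      \<open>\<ell>\<^sub>k\<close> along \<open>e\<close>. Hence \<open>m w\<close> is a coordinate of \<open>d\<close>.\<close>
  define d where "d = m - (m \<bullet> e) \<cdot>\<^sub>v orbit_row k"
  have d: "d \<in> G" using m by (simp add: d_def)
  have "\<exists>i<n. d $ i \<noteq> 0"
  proof (rule ccontr)
    assume "\<not> ?thesis"
    then have "m = (m \<bullet> e) \<cdot>\<^sub>v orbit_row k" using m orbit_row_G[of k] by (intro eq_vecI) (auto simp: d_def)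
    then show False using not_prop by blast
  qed
  then obtain i where i: "i < n" "d $ i \<noteq> 0" by blast
  define w where "w = unit_vec n i - (orbit_row k \<bullet> unit_vec n i) \<cdot>\<^sub>v e"
  have w: "w \<in> G" using e by (simp add: w_def)
  have rw: "orbit_row k \<bullet> w = 0" using e by (simp add: w_def scalar_prod_minus_distrib[of _ n])
  have mw: "m \<bullet> w = d $ i"
    using e m i orbit_row_G[of k]
    by (simp add: w_def d_def scalar_prod_minus_distrib[of _ n] mult.commute)
  define g0 where "g0 = (1 / d $ i) \<cdot>\<^sub>v w"
  have g0: "g0 \<in> G" "orbit_row k \<bullet> g0 = 0" "m \<bullet> g0 = 1"
    using w rw mw i m by (simp_all add: g0_def scalar_prod_smult_distrib[of _ n])
  have "card {g \<in> G. m \<bullet> (g + g0) = 1 \<and> orbit_row k \<bullet> (g + g0) = t} = card {g \<in> G. m \<bullet> g = 1 \<and> orbit_row k \<bullet> g = t}"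
    by (rule card_translate[OF g0(1)])
  moreover have "{g \<in> G. m \<bullet> (g + g0) = 1 \<and> orbit_row k \<bullet> (g + g0) = t} = {g \<in> G. m \<bullet> g = 0 \<and> orbit_row k \<bullet> g = t}"
    using g0 m by (auto simp: scalar_prod_add_distrib[of _ n])
  ultimately have "card {g \<in> G. m \<bullet> g = 0 \<and> orbit_row k \<bullet> g = t} = card {g \<in> G. m \<bullet> g = 1 \<and> orbit_row k \<bullet> g = t}" by simp
  moreover have "(\<Sum>g | g \<in> G \<and> orbit_row k \<bullet> g = t. if m \<bullet> g = s then 1 else 0 :: 'k) =
      of_nat (card {g \<in> G. m \<bullet> g = s \<and> orbit_row k \<bullet> g = t})" for s
  proof -
    have "{g. g \<in> G \<and> orbit_row k \<bullet> g = t} \<inter> {g. m \<bullet> g = s} = {g \<in> G. m \<bullet> g = s \<and> orbit_row k \<bullet> g = t}" by auto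
    then show ?thesis by (simp add: sum.If_cases)
  qed
  ultimately show ?thesis by (simp add: push_eq sum_subtractf)
qed

end

section \<open>Simplicity of the Nekrashevych algebras of Sunic groups\<close>

theorem theorem7p11:
  fixes f :: "'p::prime_card mod_ring poly"
  assumes "monic f" and "degree f \<ge> 1" and "coeff f 0 \<noteq> 0"
  shows "(degree f = 1 \<longrightarrow> simple_ring (nekrashevych_algebra TYPE('k::field) (sunic_group f))) \<and>
         (degree f \<noteq> 1 \<longrightarrow>
            (CHAR('k) = CARD('p) \<longrightarrow>
               \<not> simple_ring (nekrashevych_algebra TYPE('k) (sunic_group f))) \<and>
            (CHAR('k) \<noteq> CARD('p) \<longrightarrow>
               (simple_ring (nekrashevych_algebra TYPE('k) (sunic_group f)) \<longleftrightarrow>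
                acts_transitively_on_lines (degree f) (companion f))))"
proof -
  interpret sunic f by standard (fact assms)+
  have zero: "0\<^sub>v n \<in> G" by simp
  show ?thesis
  proof (intro conjI impI)
    assume "degree f = 1"
    then show "simple_ring (nekrashevych_algebra TYPE('k) \<Gamma>)"
      unfolding simple_iff_push_injective using push_injective_degree_1 by blast
  next
    assume "degree f \<noteq> 1" "CHAR('k) = CARD('p)"
    then have "\<forall>k t. push k t (\<lambda>_. 1 :: 'k) = 0" using push_constant_char_p by blast
    then show "\<not> simple_ring (nekrashevych_algebra TYPE('k) \<Gamma>)"
      unfolding simple_iff_push_injective using zero zero_neq_one by metis
  next
    assume "degree f \<noteq> 1" and char: "CHAR('k) \<noteq> CARD('p)"
    show "simple_ring (nekrashevych_algebra TYPE('k) \<Gamma>) \<longleftrightarrow> acts_transitively_on_lines n (companion f)"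
    proof
      assume simple: "simple_ring (nekrashevych_algebra TYPE('k) \<Gamma>)"
      show "acts_transitively_on_lines n (companion f)"
      proof (rule ccontr)
        assume "\<not> ?thesis"
        then obtain m where m: "m \<in> G" "\<And>k c. m \<noteq> c \<cdot>\<^sub>v orbit_row k" unfolding transitive_iff by blast
        let ?\<alpha> = "\<lambda>g. (if m \<bullet> g = 0 then 1 else 0) - (if m \<bullet> g = 1 then 1 else 0 :: 'k)"
        have "\<forall>k t. push k t ?\<alpha> = 0" using push_not_injective_if_not_transitive[OF m] by blast
        with simple have "\<forall>g\<in>G. ?\<alpha> g = 0" unfolding simple_iff_push_injective by blast
        from bspec[OF this zero] show False using m(1) by simp
      qed
    next
      assume "acts_transitively_on_lines n (companion f)"
      then have "\<exists>k c. v = c \<cdot>\<^sub>v orbit_row k" if "v \<in> G" "v \<noteq> 0\<^sub>v n" for v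
        using that unfolding transitive_iff by blast
      then show "simple_ring (nekrashevych_algebra TYPE('k) \<Gamma>)"
        unfolding simple_iff_push_injective using push_injective_if_transitive[OF _ char] by blast
    qed
  qed
qed

end
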